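(* Let $R$ be any ring as in the definition of $\mathscr{B}_n^k$, and fix, for each $0\le l\le n$, the sets $\widetilde{\mathcal X}_{l,k}\subseteq\mathscr{B}_n^k$ as described in the context. Then $\mathscr{B}_n^k(R)$ is spanned over $R$ by the set of all elements $$\alpha_{i_1,j_1,n-1}^{s_1}\,\alpha_{i_2,j_2,n-3}^{s_2}\cdots\alpha_{i_m,j_m,n-2m+1}^{s_m}\;\chi\;(\alpha_{g_m,h_m,n-2m}^{t_m})^*\cdots(\alpha_{g_2,h_2,n-4}^{t_2})^*(\alpha_{g_1,h_1,n-2}^{t_1})^*,$$ where $0\le m\le\lfloor n/2\rfloor$, $i_1>i_2>\dots>i_m$, $g_1>g_2>\dots>g_m$, and for each $f=1,\dots,m$: $1\le i_f\le j_f\le n-2f+1$, $1\le g_f\le h_f\le n-2f+1$, $s_f,t_f\in P$, and $\chi\in\widetilde{\mathcal X}_{n-2m,k}$.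
   Context: Fix integers $n\ge 1$, $k\ge 1$. Let $R$ be a unital commutative ring containing units $q_0,q,\lambda$ and further elements $q_1,\dots,q_{k-1},A_0,\dots,A_{k-1}$ such that $\lambda-\lambda^{-1}=\delta(1-A_0)$, where $\delta:=q-q^{-1}$. The cyclotomic BMW algebra $\mathscr{B}_n^k=\mathscr{B}_n^k(R)$ is the unital associative $R$-algebra generated by $Y^{\pm1},X_1^{\pm1},\dots,X_{n-1}^{\pm1},e_1,\dots,e_{n-1}$ subject to the following relations (for all indices for which they make sense): $X_i-X_i^{-1}=\delta(1-e_i)$; $X_iX_j=X_jX_i$, $X_ie_j=e_jX_i$, $e_ie_j=e_je_i$ for $|i-j|\ge 2$; $X_iX_{i+1}X_i=X_{i+1}X_iX_{i+1}$; $X_ie_i=e_iX_i=\lambda e_i$; $X_iX_je_i=e_je_i=e_jX_iX_j$ for $|i-j|=1$; $e_ie_{i\pm1}e_i=e_i$; $e_i^2=A_0e_i$; $Y^k=\sum_{i=0}^{k-1}q_iY^i$; $X_1YX_1Y=YX_1YX_1$; $YX_i=X_iY$ and $Ye_i=e_iY$ for $i>1$; $YX_1Ye_1=\lambda^{-1}e_1=e_1YX_1Y$; $e_1Y^me_1=A_me_1$ for $0\le m\le k-1$. For $1\le i\le n$ put $Y_i':=X_{i-1}\cdots X_2X_1\,Y\,X_1X_2\cdots X_{i-1}$ (so $Y_1'=Y$). Let $^*$ be the unique $R$-algebra anti-involution of $\mathscr{B}_n^k$ fixing $Y$, all $X_i$ and all $e_i$. For $1\le i\le j\le l+1$, $l\le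 n-1$ and $p\in\mathbb Z$, define $\alpha_{i,j,l}^p:=(Y_i')^p X_iX_{i+1}\cdots X_{j-1}\,e_je_{j+1}\cdots e_l$ (empty products are $1$). Let $P:=\{\lfloor k/2\rfloor-(k-1),\dots,\lfloor k/2\rfloor\}$ (a set of $k$ consecutive integers). Ariki–Koike algebra: for $l\ge 0$, $\mathfrak h_{l,k}(R)$ is the unital $R$-algebra with generators $T_0^{\pm1},T_1^{\pm1},\dots,T_{l-1}^{\pm1}$ and relations $T_0T_1T_0T_1=T_1T_0T_1T_0$; $T_iT_{i+1}T_i=T_{i+1}T_iT_{i+1}$; $T_iT_j=T_jT_i$ for $|i-j|\ge2$; $T_0^k=\sum_{i=0}^{k-1}q_iT_0^i$; $T_i^2=(q^2-1)T_i+q^2$ for $1\le i\le l-1$ (and $\mathfrak h_{0,k}(R)=R$). It is $R$-free of rank $k^l l!$. There is a surjective $R$-algebra homomorphism $\pi_l:\mathscr{B}_l^k(R)\to\mathfrak h_{l,k}(R)$ with $Y\mapsto T_0$, $X_i\mapsto q^{-1}T_i$, $e_i\mapsto 0$. For each $0\le l\le n$ fix an $R$-basis $\mathcal X_{l,k}$ of $\mathfrak h_{l,k}(R)$ (with $\mathcal X_{0,k}=\{1\}$), choose a subset $\overline{\mathcal X}_{l,k}\subseteq\mathscr{B}_l^k(R)$ mapped by $\pi_l$ bijectively onto $\mathcal X_{l,k}$, and let $\widetilde{\mathcal X}_{l,k}$ be the image of $\overline{\mathcal X}_{l,k}$ under the natural homomorphism $\mathscr{B}_l^k(R)\to\mathscr{B}_n^k(R)$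 sending each generator to the generator of the same name (for $l=0$, $\widetilde{\mathcal X}_{0,k}=\{1\}$). *)

theory Defs
  imports Main "HOL-Library.Function_Algebras"
begin

text \<open>An element of the free algebra R<G> is represented by its coefficient
function on words (lists of letters); genuine elements have finite support.\<close>

definition fa_mono :: "'g list \<Rightarrow> ('g list \<Rightarrow> 'a::comm_ring_1)" where
  "fa_mono u = (\<lambda>w. if w = u then 1 else 0)"

definition fa_smult :: "'a::comm_ring_1 \<Rightarrow> ('g list \<Rightarrow> 'a) \<Rightarrow> ('g list \<Rightarrow> 'a)" where
  "fa_smult c f = (\<lambda>w. c * f w)"

definition fa_mult :: "('g list \<Rightarrow> 'a::comm_ring_1) \<Rightarrow> ('g list \<Rightarrow> 'a) \<Rightarrow> ('g list \<Rightarrow> 'a)" where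
  "fa_mult f g = (\<lambda>w. \<Sum>i\<in>{0..length w}. f (take i w) * g (drop i w))"

definition fa_supp :: "('g list \<Rightarrow> 'a::zero) \<Rightarrow> 'g list set" where
  "fa_supp f = {w. f w \<noteq> 0}"

definition fa_elem :: "('g \<Rightarrow> bool) \<Rightarrow> ('g list \<Rightarrow> 'a::zero) \<Rightarrow> bool" where
  "fa_elem ok f \<longleftrightarrow> finite (fa_supp f) \<and> (\<forall>w\<in>fa_supp f. \<forall>x\<in>set w. ok x)"

inductive_set lspan :: "('g list \<Rightarrow> 'a::comm_ring_1) set \<Rightarrow> ('g list \<Rightarrow> 'a) set"
  for S where
  zero: "(\<lambda>w. 0) \<in> lspan S"
| step: "s \<in> S \<Longrightarrow> x \<in> lspan S \<Longrightarrow> (\<lambda>w. c * s w + x w) \<in> lspan S"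

text \<open>R-module generators u (lhs - rhs) v of the two-sided ideal generated by a
set of relations lhs = rhs.  Its R-span is the two-sided ideal.\<close>
definition ideal_gens :: "(('g list \<Rightarrow> 'a::comm_ring_1) \<times> ('g list \<Rightarrow> 'a)) set \<Rightarrow> ('g list \<Rightarrow> 'a) set" where
  "ideal_gens rels = {fa_mult (fa_mult (fa_mono u) (\<lambda>w. fst r w - snd r w)) (fa_mono v) | u v r. r \<in> rels}"

datatype bgen = Yp | Ym | Xp nat | Xm nat | E nat

definition bmw_letter :: "nat \<Rightarrow> bgen \<Rightarrow> bool" where
  "bmw_letter n g = (case g of Yp \<Rightarrow> True | Ym \<Rightarrow> True
     | Xp i \<Rightarrow> 1 \<le> i \<and> i < n | Xm i \<Rightarrow> 1 \<le> i \<and> i < n | E i \<Rightarrow> 1 \<le> i \<and> i < n)"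

definition bmw_rels :: "'a::comm_ring_1 \<Rightarrow> 'a \<Rightarrow> 'a \<Rightarrow> 'a \<Rightarrow> (nat \<Rightarrow> 'a) \<Rightarrow> (nat \<Rightarrow> 'a)
    \<Rightarrow> nat \<Rightarrow> nat \<Rightarrow> ((bgen list \<Rightarrow> 'a) \<times> (bgen list \<Rightarrow> 'a)) set" where
  "bmw_rels q qi lam lami qs As k n =
    (let M = (fa_mono :: bgen list \<Rightarrow> bgen list \<Rightarrow> 'a); gi = (\<lambda>i::nat. 1 \<le> i \<and> i < n); \<delta> = q - qi in
      {(M [Yp, Ym], M []), (M [Ym, Yp], M [])}
    \<union> {(M [Xp i, Xm i], M []) | i. gi i}
    \<union> {(M [Xm i, Xp i], M []) | i. gi i}
    \<union> {(M [Xp i] - M [Xm i], fa_smult \<delta> (M [] - M [E i])) | i. gi i}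
    \<union> {(M [Xp i, Xp j], M [Xp j, Xp i]) | i j. gi i \<and> gi j \<and> (i + 2 \<le> j \<or> j + 2 \<le> i)}
    \<union> {(M [Xp i, E j], M [E j, Xp i]) | i j. gi i \<and> gi j \<and> (i + 2 \<le> j \<or> j + 2 \<le> i)}
    \<union> {(M [E i, E j], M [E j, E i]) | i j. gi i \<and> gi j \<and> (i + 2 \<le> j \<or> j + 2 \<le> i)}
    \<union> {(M [Xp i, Xp (i+1), Xp i], M [Xp (i+1), Xp i, Xp (i+1)]) | i. gi i \<and> gi (i+1)}
    \<union> {(M [Xp i, E i], fa_smult lam (M [E i])) | i. gi i}
    \<union> {(M [E i, Xp i], fa_smult lam (M [E i])) | i. gi i}
    \<union> {(M [Xp i, Xp j, E i], M [E j, E i]) | i j. gi i \<and> gi j \<and> (j = i + 1 \<or> i = j + 1)}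
    \<union> {(M [E j, E i], M [E j, Xp i, Xp j]) | i j. gi i \<and> gi j \<and> (j = i + 1 \<or> i = j + 1)}
    \<union> {(M [E i, E j, E i], M [E i]) | i j. gi i \<and> gi j \<and> (j = i + 1 \<or> i = j + 1)}
    \<union> {(M [E i, E i], fa_smult (As 0) (M [E i])) | i. gi i}
    \<union> {(M (replicate k Yp), (\<Sum>i<k. fa_smult (qs i) (M (replicate i Yp))))}
    \<union> (if gi 1 then {(M [Xp 1, Yp, Xp 1, Yp], M [Yp, Xp 1, Yp, Xp 1])} else {})
    \<union> {(M [Yp, Xp i], M [Xp i, Yp]) | i. gi i \<and> 1 < i}
    \<union> {(M [Yp, E i], M [E i, Yp]) | i. gi i \<and> 1 < i}
    \<union> (if gi 1 then {(M [Yp, Xp 1, Yp, E 1], fa_smult lami (M [E 1])),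
                     (M [E 1, Yp, Xp 1, Yp], fa_smult lami (M [E 1]))} else {})
    \<union> {(M ([E 1] @ replicate m Yp @ [E 1]), fa_smult (As m) (M [E 1])) | m. m < k \<and> gi 1})"

datatype tgen = T0p | T0m | Tp nat | Tm nat

definition ak_letter :: "nat \<Rightarrow> tgen \<Rightarrow> bool" where
  "ak_letter l g = (case g of T0p \<Rightarrow> 0 < l | T0m \<Rightarrow> 0 < l
     | Tp i \<Rightarrow> 1 \<le> i \<and> i < l | Tm i \<Rightarrow> 1 \<le> i \<and> i < l)"

definition tT :: "nat \<Rightarrow> tgen" where
  "tT i = (if i = 0 then T0p else Tp i)"

definition ak_rels :: "'a::comm_ring_1 \<Rightarrow> (nat \<Rightarrow> 'a) \<Rightarrow> nat \<Rightarrow> nat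
    \<Rightarrow> ((tgen list \<Rightarrow> 'a) \<times> (tgen list \<Rightarrow> 'a)) set" where
  "ak_rels q qs k l =
    (let M = (fa_mono :: tgen list \<Rightarrow> tgen list \<Rightarrow> 'a); gi = (\<lambda>i::nat. 1 \<le> i \<and> i < l) in
      {(M [T0p, T0m], M []), (M [T0m, T0p], M [])}
    \<union> {(M [Tp i, Tm i], M []) | i. gi i}
    \<union> {(M [Tm i, Tp i], M []) | i. gi i}
    \<union> (if gi 1 then {(M [T0p, Tp 1, T0p, Tp 1], M [Tp 1, T0p, Tp 1, T0p])} else {})
    \<union> {(M [Tp i, Tp (i+1), Tp i], M [Tp (i+1), Tp i, Tp (i+1)]) | i. gi i \<and> gi (i+1)}
    \<union> {(M [tT i, tT j], M [tT j, tT i]) | i j. i < l \<and> j < l \<and> (i + 2 \<le> j \<or> j + 2 \<le> i)}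
    \<union> {(M (replicate k T0p), (\<Sum>i<k. fa_smult (qs i) (M (replicate i T0p))))}
    \<union> {(M [Tp i, Tp i], fa_smult (q^2 - 1) (M [Tp i]) + fa_smult (q^2) (M [])) | i. gi i})"

definition pi_gen :: "'a::comm_ring_1 \<Rightarrow> 'a \<Rightarrow> bgen \<Rightarrow> (tgen list \<Rightarrow> 'a)" where
  "pi_gen q qi g = (case g of Yp \<Rightarrow> fa_mono [T0p] | Ym \<Rightarrow> fa_mono [T0m]
     | Xp i \<Rightarrow> fa_smult qi (fa_mono [Tp i]) | Xm i \<Rightarrow> fa_smult q (fa_mono [Tm i])
     | E i \<Rightarrow> (\<lambda>w. 0))"

definition pi_word :: "'a::comm_ring_1 \<Rightarrow> 'a \<Rightarrow> bgen list \<Rightarrow> (tgen list \<Rightarrow> 'a)" where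
  "pi_word q qi w = foldr (\<lambda>g acc. fa_mult (pi_gen q qi g) acc) w (fa_mono [])"

definition pi_elem :: "'a::comm_ring_1 \<Rightarrow> 'a \<Rightarrow> (bgen list \<Rightarrow> 'a) \<Rightarrow> (tgen list \<Rightarrow> 'a)" where
  "pi_elem q qi f = (\<Sum>w\<in>fa_supp f. fa_smult (f w) (pi_word q qi w))"

text \<open>The family xb (indexed by Ix) of elements of B_l (given by representatives in
the free algebra on the generators of B_l) is mapped by pi_l onto an R-basis of h_{l,k}
(spanning and linearly independent); this is the chosen set X-bar_{l,k}.\<close>
definition AK_basis :: "'a::comm_ring_1 \<Rightarrow> 'a \<Rightarrow> (nat \<Rightarrow> 'a) \<Rightarrow> nat \<Rightarrow> nat
    \<Rightarrow> 'i set \<Rightarrow> ('i \<Rightarrow> bgen list \<Rightarrow> 'a) \<Rightarrow> bool" where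
  "AK_basis q qi qs k l Ix xb \<longleftrightarrow>
     (\<forall>x\<in>Ix. fa_elem (bmw_letter l) (xb x)) \<and>
     (\<forall>h. fa_elem (ak_letter l) h \<longrightarrow>
          h \<in> lspan (pi_elem q qi ` xb ` Ix \<union> ideal_gens (ak_rels q qs k l))) \<and>
     (\<forall>F c. finite F \<longrightarrow> F \<subseteq> Ix \<longrightarrow>
          (\<Sum>x\<in>F. fa_smult (c x) (pi_elem q qi (xb x))) \<in> lspan (ideal_gens (ak_rels q qs k l))
          \<longrightarrow> (\<forall>x\<in>F. c x = 0))"

definition yw :: "nat \<Rightarrow> bgen list" where
  "yw i = map Xp (rev [1..<i]) @ [Yp] @ map Xp [1..<i]"

definition ywinv :: "nat \<Rightarrow> bgen list" where
  "ywinv i = map Xm (rev [1..<i]) @ [Ym] @ map Xm [1..<i]"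

definition ypow :: "nat \<Rightarrow> int \<Rightarrow> bgen list" where
  "ypow i p = (if 0 \<le> p then concat (replicate (nat p) (yw i))
               else concat (replicate (nat (- p)) (ywinv i)))"

definition alpha_w :: "nat \<Rightarrow> nat \<Rightarrow> nat \<Rightarrow> int \<Rightarrow> bgen list" where
  "alpha_w i j l p = ypow i p @ map Xp [i..<j] @ map E [j..<Suc l]"

text \<open>The anti-involution * fixes all generators (hence also Y^{-1}, X_i^{-1}), so on a
monomial word it is list reversal.\<close>

definition Pset :: "nat \<Rightarrow> int set" where
  "Pset k = {int (k div 2) - (int k - 1) .. int (k div 2)}"

definition chiset :: "nat \<Rightarrow> ('i set) \<Rightarrow> ('i \<Rightarrow> bgen list \<Rightarrow> 'a::comm_ring_1) \<Rightarrow> (bgen list \<Rightarrow> 'a) set" where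
  "chiset l Ix xb = (if l = 0 then {fa_mono []} else xb ` Ix)"

definition bmw_span_set :: "nat \<Rightarrow> nat \<Rightarrow> (nat \<Rightarrow> 'i set) \<Rightarrow> (nat \<Rightarrow> 'i \<Rightarrow> bgen list \<Rightarrow> 'a::comm_ring_1)
    \<Rightarrow> (bgen list \<Rightarrow> 'a) set" where
  "bmw_span_set n k Ix xb =
    {fa_mult (fa_mult
        (fa_mono (concat (map (\<lambda>f. alpha_w (i f) (j f) (n - 2*f + 1) (s f)) [1..<m+1])))
        chi)
        (fa_mono (concat (map (\<lambda>f. rev (alpha_w (g f) (h f) (n - 2*f) (t f))) (rev [1..<m+1]))))
     | m i j s g h t chi.
        m \<le> n div 2 \<and>
        (\<forall>f. 1 \<le> f \<and> f < m \<longrightarrow> i (Suc f) < i f \<and> g (Suc f) < g f) \<and>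
        (\<forall>f. 1 \<le> f \<and> f \<le> m \<longrightarrow>
            1 \<le> i f \<and> i f \<le> j f \<and> j f \<le> n - 2*f + 1 \<and>
            1 \<le> g f \<and> g f \<le> h f \<and> h f \<le> n - 2*f + 1 \<and>
            s f \<in> Pset k \<and> t f \<in> Pset k) \<and>
        chi \<in> chiset (n - 2*m) (Ix (n - 2*m)) (xb (n - 2*m))}"

end

theory Submission
  imports Defs "HOL.Modules" "HOL-Library.Poly_Mapping"
begin

text \<open>
  Put \<open>a = Y'\<^sub>i\<close> and \<open>b = Y'\<^sub>i\<^sub>+\<^sub>1 = X\<^sub>i a X\<^sub>i\<close>. Then \<open>b\<close> commutes with everything generated by \<open>Y\<close> and the
  \<open>X\<^sub>c, e\<^sub>c\<close> with \<open>c < i\<close>, and \<open>a b e\<^sub>i = e\<^sub>i\<close>. Moving \<open>X\<^sub>i\<close> past powers of \<open>a\<close> and \<open>b\<close> therefore changes the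
  exponents within explicit ranges, and the elements \<open>\<alpha>\<close>, with coefficients from a smaller algebra on
  the right, span a left ideal. Starting from the relation for \<open>Y\<^sup>k\<close>, induction on \<open>i\<close> restricts the
  exponents to the set \<open>P\<close>.

  Hence \<open>B\<^sub>n e\<^sub>n\<^sub>-\<^sub>1 e\<^sub>n\<^sub>-\<^sub>3 \<dots> e\<^sub>n\<^sub>-\<^sub>2\<^sub>m\<^sub>+\<^sub>1\<close> is spanned by products of \<open>m\<close> elements \<open>\<alpha>\<close>. If two consecutive first indices are
  not decreasing, exchanging the two arcs expresses the product by products with a larger first
  index; the near symmetry of \<open>P\<close> keeps the exponents in \<open>P\<close>, and descending induction on the first
  index sorts the product. The anti-involution gives the same on the right. Finally the middle factor
  is determined, up to the two-sided ideal for \<open>m + 1\<close>, by its image in the Ariki--Koike algebra.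
\<close>

subsection \<open>Evaluating elements of the free algebra\<close>

text \<open>For \<open>i > 1\<close> no relation of degree \<open>k\<close> for
  \<open>Y'\<^sub>i\<close> is at hand, so its exponents cannot be reduced as those of
  \<open>Y\<close> are. The induction works because \<open>Y'\<^sub>i\<^sub>+\<^sub>1\<close> lies
  in the algebra of \<open>Y\<close> and the \<open>X\<^sub>c, e\<^sub>c\<close> with
  \<open>c \<le> i\<close>. These letters send an exponent \<open>p\<close> at first index
  \<open>i + 1\<close> to exponents between \<open>0\<close> and \<open>p\<close>; an exponent
  changes sign, and so may leave \<open>P\<close>, only at first indices up to \<open>i\<close>,
  where it is already reducible. This uses that \<open>P\<close> consists of \<open>k\<close>
  consecutive integers and contains \<open>0\<close>.

  That \<open>P\<close> is centred matters for the exchange of arcs. There, crossings act on an arc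
  at whose first index signs may change, with no smaller case to fall back on, so the exponents must
  lie in the symmetric part of \<open>P\<close>, of radius \<open>(k - 1) div 2\<close>. For even
  \<open>k\<close> this leaves no slack, and the correction terms of a commutation have to be listed
  exactly.\<close>

abbreviation fin :: "('g list \<Rightarrow> 'a::zero) \<Rightarrow> bool" where
  "fin f \<equiv> finite (fa_supp f)"

lemma fa_mono_supp: "fa_supp (fa_mono u :: _ \<Rightarrow> 'a::comm_ring_1) = {u}"
  by (auto simp: fa_supp_def fa_mono_def)

lemma fin_mono [simp]: "fin (fa_mono u :: _ \<Rightarrow> 'a::comm_ring_1)"
  by (simp add: fa_mono_supp)

lemma fin_zero [simp]: "fin (\<lambda>w. 0)"
  by (simp add: fa_supp_def)

lemma fin_smult [simp]: "fin f \<Longrightarrow> fin (fa_smult c f)"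
  by (rule finite_subset[of _ "fa_supp f"]) (auto simp: fa_supp_def fa_smult_def)

lemma fin_add [simp]: "fin f \<Longrightarrow> fin g \<Longrightarrow> fin (f + g)" for f g :: "_ \<Rightarrow> 'a::comm_ring_1"
  by (rule finite_subset[of _ "fa_supp f \<union> fa_supp g"]) (auto simp: fa_supp_def)

lemma fin_diff [simp]: "fin f \<Longrightarrow> fin g \<Longrightarrow> fin (f - g)" for f g :: "_ \<Rightarrow> 'a::comm_ring_1"
  by (rule finite_subset[of _ "fa_supp f \<union> fa_supp g"]) (auto simp: fa_supp_def)

lemma fin_sum [simp]: "(\<And>i. i \<in> A \<Longrightarrow> fin (F i)) \<Longrightarrow> fin (sum F A)"
  for F :: "_ \<Rightarrow> _ \<Rightarrow> 'a::comm_ring_1"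
  by (induction A rule: infinite_finite_induct) (auto simp: zero_fun_def)

lemma fa_mult_supp: "fa_supp (fa_mult f g) \<subseteq> (\<lambda>(u, v). u @ v) ` (fa_supp f \<times> fa_supp g)"
proof
  fix w assume "w \<in> fa_supp (fa_mult f g)"
  then have "(\<Sum>i\<in>{0..length w}. f (take i w) * g (drop i w)) \<noteq> 0"
    by (simp add: fa_supp_def fa_mult_def)
  then obtain i where "f (take i w) * g (drop i w) \<noteq> 0"
    by (rule sum.not_neutral_contains_not_neutral)
  then have "(take i w, drop i w) \<in> fa_supp f \<times> fa_supp g"
    by (auto simp: fa_supp_def)
  then show "w \<in> (\<lambda>(u, v). u @ v) ` (fa_supp f \<times> fa_supp g)"
    by (intro image_eqI[of _ _ "(take i w, drop i w)"]) auto
qed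

lemma fin_mult [simp]: "fin f \<Longrightarrow> fin g \<Longrightarrow> fin (fa_mult f g)"
  by (rule finite_subset[OF fa_mult_supp]) auto

lemma fa_elem_fin: "fa_elem ok f \<Longrightarrow> fin f"
  by (simp add: fa_elem_def)

lemma fa_elem_mono: "(\<And>g. g \<in> set w \<Longrightarrow> ok g) \<Longrightarrow> fa_elem ok (fa_mono w :: _ \<Rightarrow> 'a::comm_ring_1)"
  by (simp add: fa_elem_def fa_mono_supp)

lemma fa_elem_zero [simp]: "fa_elem ok (\<lambda>w. 0)"
  by (simp add: fa_elem_def fa_supp_def)

lemma fa_elem_smult: "fa_elem ok f \<Longrightarrow> fa_elem ok (fa_smult c f)"
  using fin_smult[of f c] unfolding fa_elem_def fa_supp_def fa_smult_def
  by clarsimp (metis mult_zero_right)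

lemma fa_elem_add: "fa_elem ok f \<Longrightarrow> fa_elem ok g \<Longrightarrow> fa_elem ok (f + g)"
  for f g :: "_ \<Rightarrow> 'a::comm_ring_1"
  using fin_add[of f g] unfolding fa_elem_def fa_supp_def
  by clarsimp (metis add.right_neutral)

lemma fa_elem_mult: "fa_elem ok f \<Longrightarrow> fa_elem ok g \<Longrightarrow> fa_elem ok (fa_mult f g)"
  using fa_mult_supp[of f g] by (fastforce simp: fa_elem_def)

lemma lspan_base: "s \<in> S \<Longrightarrow> s \<in> lspan S"
  using lspan.step[OF _ lspan.zero, of s S 1] by simp

lemma lspan_add: "x \<in> lspan S \<Longrightarrow> y \<in> lspan S \<Longrightarrow> x + y \<in> lspan S"
proof (induction rule: lspan.induct)
  case zero
  then show ?case by (simp flip: zero_fun_def)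
next
  case (step s x c)
  have "(\<lambda>w. c * s w + x w) + y = (\<lambda>w. c * s w + (x + y) w)"
    by (simp add: fun_eq_iff add.assoc)
  then show ?case using step by (auto intro: lspan.step)
qed

lemma lspan_smult: "x \<in> lspan S \<Longrightarrow> fa_smult c x \<in> lspan S"
proof (induction rule: lspan.induct)
  case zero
  then show ?case by (simp add: fa_smult_def lspan.zero)
next
  case (step s x d)
  have "fa_smult c (\<lambda>w. d * s w + x w) = (\<lambda>w. (c * d) * s w + fa_smult c x w)"
    by (simp add: fun_eq_iff fa_smult_def algebra_simps)
  then show ?case using step by (auto intro: lspan.step)
qed

lemma lspan_mono: "x \<in> lspan S \<Longrightarrow> S \<subseteq> T \<Longrightarrow> x \<in> lspan T"
  by (induction rule: lspan.induct) (auto intro: lspan.intros)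

text \<open>An algebra is encoded as a ring with a central homomorphism \<open>sc\<close> from the
  scalars. The same locale then serves the free algebra, its quotient, and the evaluation of
  Ariki--Koike words in the BMW algebra.\<close>

locale fa_eval =
  fixes sc :: "'a::comm_ring_1 \<Rightarrow> 'b::ring_1" and gn :: "'g \<Rightarrow> 'b"
  assumes sc_add: "sc (a + b) = sc a + sc b"
    and sc_mult: "sc (a * b) = sc a * sc b"
    and sc_one [simp]: "sc 1 = 1"
    and sc_central: "sc a * x = x * sc a"
begin

abbreviation pe :: "'g list \<Rightarrow> 'b" where "pe w \<equiv> prod_list (map gn w)"

definition Ev :: "('g list \<Rightarrow> 'a) \<Rightarrow> 'b" where
  "Ev f = (\<Sum>w\<in>fa_supp f. sc (f w) * pe w)"

sublocale md: module "\<lambda>c x. sc c * x"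
  by unfold_locales (auto simp: sc_add sc_mult algebra_simps)

lemma sc_0 [simp]: "sc 0 = 0"
  using sc_add[of 0 0] by simp

lemma mult_sc: "x * (sc c * y) = sc c * (x * y)"
  by (metis sc_central mult.assoc)

lemma span_mult2:
  assumes "u \<in> md.span S" "\<And>s. s \<in> S \<Longrightarrow> x * s * y \<in> md.span T"
  shows "x * u * y \<in> md.span T"
  using assms(1)
proof (induction rule: md.span_induct_alt)
  case base
  then show ?case by (simp add: md.span_zero)
next
  case (step c z w)
  have "x * (sc c * z + w) * y = sc c * (x * z * y) + x * w * y"
    by (simp add: algebra_simps mult_sc)
  then show ?case
    using step assms(2) by (metis md.span_add md.span_scale)
qed

lemma span_multL:
  assumes "u \<in> md.span S" "\<And>s. s \<in> S \<Longrightarrow> x * s \<in> md.span T"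
  shows "x * u \<in> md.span T"
  using span_mult2[of u S x 1 T] assms by simp

lemma span_multR:
  assumes "u \<in> md.span S" "\<And>s. s \<in> S \<Longrightarrow> s * y \<in> md.span T"
  shows "u * y \<in> md.span T"
  using span_mult2[of u S 1 y T] assms by simp

lemma span_subsetI: "u \<in> md.span S \<Longrightarrow> (\<And>s. s \<in> S \<Longrightarrow> s \<in> md.span T) \<Longrightarrow> u \<in> md.span T"
  using span_mult2[of u S 1 1 T] by simp

lemma sc_sum: "sc (sum f A) = (\<Sum>x\<in>A. sc (f x))"
  by (induction A rule: infinite_finite_induct) (auto simp: sc_add)

lemma Ev_superset: "finite A \<Longrightarrow> fa_supp f \<subseteq> A \<Longrightarrow> Ev f = (\<Sum>w\<in>A. sc (f w) * pe w)"
  unfolding Ev_def by (rule sum.mono_neutral_left) (auto simp: fa_supp_def)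

lemma Ev_add: "fin f \<Longrightarrow> fin g \<Longrightarrow> Ev (f + g) = Ev f + Ev g"
proof -
  assume fg: "fin f" "fin g"
  let ?A = "fa_supp f \<union> fa_supp g"
  have "finite ?A" "fa_supp (f + g) \<subseteq> ?A" using fg by (auto simp: fa_supp_def)
  then show ?thesis
    using Ev_superset[of ?A f] Ev_superset[of ?A g] Ev_superset[of ?A "f + g"]
    by (simp add: sc_add distrib_right sum.distrib)
qed

lemma Ev_smult: "fin f \<Longrightarrow> Ev (fa_smult c f) = sc c * Ev f"
proof -
  assume "fin f"
  moreover have "fa_supp (fa_smult c f) \<subseteq> fa_supp f" by (auto simp: fa_supp_def fa_smult_def)
  ultimately show ?thesis
    using Ev_superset[of "fa_supp f" "fa_smult c f"]
    by (simp add: fa_smult_def sum_distrib_left Ev_def)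
qed

lemma Ev_zero [simp]: "Ev (\<lambda>w. 0) = 0"
  by (simp add: Ev_def fa_supp_def)

lemma Ev_diff: "fin f \<Longrightarrow> fin g \<Longrightarrow> Ev (f - g) = Ev f - Ev g"
  using Ev_add[of "f - g" g] by simp

lemma Ev_sum: "(\<And>i. i \<in> A \<Longrightarrow> fin (F i)) \<Longrightarrow> Ev (sum F A) = (\<Sum>i\<in>A. Ev (F i))"
  by (induction A rule: infinite_finite_induct) (auto simp: Ev_add, auto simp: zero_fun_def)

lemma Ev_mono [simp]: "Ev (fa_mono u) = pe u"
  by (simp add: Ev_def fa_mono_supp sc_one) (simp add: fa_mono_def sc_one)

lemma Ev_mult:
  assumes "fin f" "fin g"
  shows "Ev (fa_mult f g) = Ev f * Ev g"
proof -
  let ?P = "fa_supp f \<times> fa_supp g"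
  let ?W = "(\<lambda>(u, v). u @ v) ` ?P"
  define W where "W = ?W"
  have W: "finite W" "fa_supp (fa_mult f g) \<subseteq> W"
    unfolding W_def using assms fa_mult_supp by auto
  have memb: "u @ v \<in> W" if "u \<in> fa_supp f" "v \<in> fa_supp g" for u v
    unfolding W_def using that by force
  let ?T = "\<lambda>u v. sc (f u) * pe u * (sc (g v) * pe v)"
  have T: "sc (f u * g v) * pe (u @ v) = ?T u v" for u v
    by (simp add: mult.assoc mult_sc[of "pe u"])
  have T': "sc (f (take i w) * g (drop i w)) * pe w = ?T (take i w) (drop i w)" for i w
    using T[of "take i w" "drop i w"] by simp
  have "Ev (fa_mult f g) = (\<Sum>w\<in>W. sc (fa_mult f g w) * pe w)"
    by (rule Ev_superset[OF W])
  also have "\<dots> = (\<Sum>w\<in>W. \<Sum>i\<in>{0..length w}. ?T (take i w) (drop i w))"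
    unfolding fa_mult_def sc_sum sum_distrib_right T' ..
  also have "\<dots> = (\<Sum>(w, i)\<in>(SIGMA w:W. {0..length w}). ?T (take i w) (drop i w))"
    using W by (simp add: sum.Sigma)
  \<comment> \<open>A word with a cut position is the same as a pair of words. Cuts of words in
    \<open>W\<close> may produce pairs outside the supports; these form \<open>S'\<close> and
    contribute zero.\<close>
  also have "\<dots> = (\<Sum>(u, v)\<in>?P. ?T u v)"
  proof (rule sum.reindex_bij_witness_not_neutral[where S' = "{(w, i). w \<in> W \<and> i \<in> {0..length w} \<and>
        (take i w \<notin> fa_supp f \<or> drop i w \<notin> fa_supp g)}" and T' = "{}"
        and i = "\<lambda>(u, v). (u @ v, length u)" and j = "\<lambda>(w, i). (take i w, drop i w)"])
    show "finite {(w, i). w \<in> W \<and> i \<in> {0..length w} \<and> (take i w \<notin> fa_supp f \<or> drop i w \<notin> fa_supp g)}"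
      by (rule finite_subset[of _ "SIGMA w:W. {0..length w}"]) (use W in auto)
    show "(case a of (w, i) \<Rightarrow> ?T (take i w) (drop i w)) = 0"
      if "a \<in> {(w, i). w \<in> W \<and> i \<in> {0..length w} \<and> (take i w \<notin> fa_supp f \<or> drop i w \<notin> fa_supp g)}" for a
      using that by (auto simp: fa_supp_def)
  qed (use memb in auto)
  also have "\<dots> = Ev f * Ev g"
    by (simp add: Ev_def sum_product sum.cartesian_product)
  finally show ?thesis .
qed

lemma fin_lspan: "f \<in> lspan S \<Longrightarrow> (\<And>s. s \<in> S \<Longrightarrow> fin s) \<Longrightarrow> fin f"
proof (induction rule: lspan.induct)
  case (step s x c)
  then have "fin (fa_smult c s + x)" by simp
  then show ?case by (simp add: fa_smult_def plus_fun_def)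
qed simp

lemma Ev_lspan:
  assumes V: "0 \<in> V" "\<And>x y. x \<in> V \<Longrightarrow> y \<in> V \<Longrightarrow> x + y \<in> V" "\<And>c x. x \<in> V \<Longrightarrow> sc c * x \<in> V"
    and S: "\<And>s. s \<in> S \<Longrightarrow> fin s" "\<And>s. s \<in> S \<Longrightarrow> Ev s \<in> V" and f: "f \<in> lspan S"
  shows "Ev f \<in> V"
  using f
proof (induction rule: lspan.induct)
  case zero
  then show ?case using V by simp
next
  case (step s x c)
  have "(\<lambda>w. c * s w + x w) = fa_smult c s + x" by (simp add: fa_smult_def plus_fun_def)
  then show ?case
    using step S fin_lspan[OF step(2) S(1)] V by (simp add: Ev_add Ev_smult)
qed

end

locale cyc_bmw = fa_eval sc gn
  for sc :: "'a::comm_ring_1 \<Rightarrow> 'b::ring_1" and gn :: "bgen \<Rightarrow> 'b" +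
  fixes star :: "'b \<Rightarrow> 'b"
    and dl lam lami q0i :: 'a
    and qs As :: "nat \<Rightarrow> 'a"
    and n k :: nat
  assumes star_add: "star (x + y) = star x + star y"
    and star_mult: "star (x * y) = star y * star x"
    and star_sc: "star (sc a) = sc a"
    and star_gn [simp]: "star (gn g) = gn g"
    and star_star [simp]: "star (star x) = x"
    and k_pos: "1 \<le> k"
    and lam_inv: "lam * lami = 1"
    and q0_inv: "qs 0 * q0i = 1"
    and Y_Yi: "gn Yp * gn Ym = 1"
    and Yi_Y: "gn Ym * gn Yp = 1"
    and X_Xi: "1 \<le> i \<Longrightarrow> i < n \<Longrightarrow> gn (Xp i) * gn (Xm i) = 1"
    and Xi_X: "1 \<le> i \<Longrightarrow> i < n \<Longrightarrow> gn (Xm i) * gn (Xp i) = 1"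
    and skein: "1 \<le> i \<Longrightarrow> i < n \<Longrightarrow> gn (Xp i) - gn (Xm i) = sc dl * (1 - gn (E i))"
    and XX_far: "1 \<le> i \<Longrightarrow> i + 2 \<le> j \<Longrightarrow> j < n \<Longrightarrow> gn (Xp i) * gn (Xp j) = gn (Xp j) * gn (Xp i)"
    and XE_far: "1 \<le> i \<Longrightarrow> i < n \<Longrightarrow> 1 \<le> j \<Longrightarrow> j < n \<Longrightarrow> i + 2 \<le> j \<or> j + 2 \<le> i
       \<Longrightarrow> gn (Xp i) * gn (E j) = gn (E j) * gn (Xp i)"
    and EE_far: "1 \<le> i \<Longrightarrow> i + 2 \<le> j \<Longrightarrow> j < n \<Longrightarrow> gn (E i) * gn (E j) = gn (E j) * gn (E i)"
    and braid: "1 \<le> i \<Longrightarrow> Suc i < n \<Longrightarrow>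
       gn (Xp i) * (gn (Xp (Suc i)) * gn (Xp i)) = gn (Xp (Suc i)) * (gn (Xp i) * gn (Xp (Suc i)))"
    and XE: "1 \<le> i \<Longrightarrow> i < n \<Longrightarrow> gn (Xp i) * gn (E i) = sc lam * gn (E i)"
    and XXE: "1 \<le> i \<Longrightarrow> i < n \<Longrightarrow> 1 \<le> j \<Longrightarrow> j < n \<Longrightarrow> j = Suc i \<or> i = Suc j
       \<Longrightarrow> gn (Xp i) * (gn (Xp j) * gn (E i)) = gn (E j) * gn (E i)"
    and EEE: "1 \<le> i \<Longrightarrow> i < n \<Longrightarrow> 1 \<le> j \<Longrightarrow> j < n \<Longrightarrow> j = Suc i \<or> i = Suc j
       \<Longrightarrow> gn (E i) * (gn (E j) * gn (E i)) = gn (E i)"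
    and EE: "1 \<le> i \<Longrightarrow> i < n \<Longrightarrow> gn (E i) * gn (E i) = sc (As 0) * gn (E i)"
    and Y_pow: "gn Yp ^ k = (\<Sum>i<k. sc (qs i) * gn Yp ^ i)"
    and XYXY: "1 < n \<Longrightarrow> gn (Xp 1) * (gn Yp * (gn (Xp 1) * gn Yp)) = gn Yp * (gn (Xp 1) * (gn Yp * gn (Xp 1)))"
    and YX: "1 < i \<Longrightarrow> i < n \<Longrightarrow> gn Yp * gn (Xp i) = gn (Xp i) * gn Yp"
    and YE: "1 < i \<Longrightarrow> i < n \<Longrightarrow> gn Yp * gn (E i) = gn (E i) * gn Yp"
    and YXYE: "1 < n \<Longrightarrow> gn Yp * (gn (Xp 1) * (gn Yp * gn (E 1))) = sc lami * gn (E 1)"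
    and EYE: "1 < n \<Longrightarrow> m < k \<Longrightarrow> gn (E 1) * (gn Yp ^ m * gn (E 1)) = sc (As m) * gn (E 1)"
begin

abbreviation "Y \<equiv> gn Yp"
abbreviation "Yi \<equiv> gn Ym"
abbreviation "X i \<equiv> gn (Xp i)"
abbreviation "Xi i \<equiv> gn (Xm i)"
abbreviation "e i \<equiv> gn (E i)"

lemma sc_minus: "sc (- c) = - sc c"
  using sc_add[of c "- c"] by (simp add: eq_neg_iff_add_eq_0 add.commute)

lemma star_0 [simp]: "star 0 = 0"
  using star_add[of 0 0] by simp

lemma star_minus: "star (- x) = - star x"
  using star_add[of x "- x"] by (simp add: eq_neg_iff_add_eq_0 add.commute)

lemma star_diff: "star (x - y) = star x - star y"
  using star_add[of x "- y"] by (simp add: star_minus)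

lemma star_1 [simp]: "star 1 = 1"
  using star_sc[of 1] by simp

lemma star_eqD: "x = y \<Longrightarrow> star x = star y"
  by simp

lemmas star_simps = star_mult star_add star_diff star_minus star_sc

text \<open>As a rewrite rule, \<open>mult_sc\<close> itself loops on \<open>x = sc d\<close>.\<close>

lemmas gn_sc = mult_sc[of "gn g" for g] sc_central[of _ "gn g" for g, symmetric]

lemma star_smult: "star (sc c * x) = sc c * star x"
  by (simp add: star_mult star_sc sc_central)

lemma lam_lami: "sc lam * (sc lami * x) = x" "sc lami * (sc lam * x) = x"
  using lam_inv by (simp_all add: mult.assoc[symmetric] sc_mult[symmetric] mult.commute)

lemma lami_lam: "lami * lam = 1"
  using lam_inv by (simp add: mult.commute)

lemma span_star:
  assumes "u \<in> md.span S"
  shows "star u \<in> md.span (star ` S)"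
  using assms
proof (induction rule: md.span_induct_alt)
  case base
  then show ?case by (simp add: md.span_zero)
next
  case (step c z w)
  then show ?case
    by (metis star_add star_smult md.span_add md.span_scale md.span_base imageI)
qed

subsection \<open>Words and subalgebras\<close>

definition ev :: "bgen list \<Rightarrow> 'b" where
  "ev w = prod_list (map gn w)"

lemma ev_Nil [simp]: "ev [] = 1"
  and ev_Cons [simp]: "ev (g # w) = gn g * ev w"
  and ev_append: "ev (u @ w) = ev u * ev w"
  by (simp_all add: ev_def)

lemma star_ev: "star (ev w) = ev (rev w)"
  by (induction w) (simp_all add: star_mult ev_append)

text \<open>Unlike \<open>bmw_letter 0\<close>, this excludes \<open>Y\<close> for \<open>d = 0\<close>, so that \<open>Bs 0\<close> consists of scalars.\<close>

definition let_ok :: "nat \<Rightarrow> bgen \<Rightarrow> bool" where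
  "let_ok d g \<longleftrightarrow> 0 < d \<and> bmw_letter d g"

inductive_set Bs :: "nat \<Rightarrow> 'b set" for d where
  Bs_sc: "sc c \<in> Bs d"
| Bs_gn: "let_ok d g \<Longrightarrow> gn g \<in> Bs d"
| Bs_add: "x \<in> Bs d \<Longrightarrow> y \<in> Bs d \<Longrightarrow> x + y \<in> Bs d"
| Bs_mult: "x \<in> Bs d \<Longrightarrow> y \<in> Bs d \<Longrightarrow> x * y \<in> Bs d"

lemma Bs_1: "1 \<in> Bs d"
  using Bs_sc[of 1 d] by simp

lemma Bs_0: "0 \<in> Bs d"
  using Bs_sc[of 0 d] by simp

lemma Bs_smult: "x \<in> Bs d \<Longrightarrow> sc c * x \<in> Bs d"
  by (intro Bs_mult Bs_sc)

lemma subspace_Bs: "md.subspace (Bs d)"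
  by (rule md.subspaceI) (auto intro: Bs_0 Bs_add Bs_smult)

lemma let_ok_mono: "let_ok d g \<Longrightarrow> d \<le> d' \<Longrightarrow> let_ok d' g"
  by (auto simp: let_ok_def bmw_letter_def split: bgen.splits)

lemma Bs_mono: "x \<in> Bs d \<Longrightarrow> d \<le> d' \<Longrightarrow> x \<in> Bs d'"
  by (induction rule: Bs.induct) (auto intro: Bs.intros let_ok_mono)

lemma Bs_Y: "0 < d \<Longrightarrow> Y \<in> Bs d"
  and Bs_Yi: "0 < d \<Longrightarrow> Yi \<in> Bs d"
  and Bs_X: "1 \<le> c \<Longrightarrow> c < d \<Longrightarrow> X c \<in> Bs d"
  and Bs_Xi: "1 \<le> c \<Longrightarrow> c < d \<Longrightarrow> Xi c \<in> Bs d"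
  and Bs_e: "1 \<le> c \<Longrightarrow> c < d \<Longrightarrow> e c \<in> Bs d"
  by (auto intro!: Bs_gn simp: let_ok_def bmw_letter_def)

lemma Bs_ev: "(\<And>g. g \<in> set w \<Longrightarrow> let_ok d g) \<Longrightarrow> ev w \<in> Bs d"
  by (induction w) (auto intro: Bs_1 Bs_mult Bs_gn)

lemma Bs_pow: "x \<in> Bs d \<Longrightarrow> x ^ m \<in> Bs d"
  by (induction m) (auto intro: Bs_1 Bs_mult)

lemma star_Bs: "x \<in> Bs d \<Longrightarrow> star x \<in> Bs d"
  by (induction rule: Bs.induct) (auto simp: star_simps intro: Bs.intros)

lemma comm_inv:
  fixes x u w :: 'b
  assumes "x * u = u * x" "u * w = 1" "w * u = 1"
  shows "x * w = w * x"
proof -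
  have "x * w = w * u * x * w" using assms(3) by simp
  also have "\<dots> = w * (x * u) * w" by (metis assms(1) mult.assoc)
  also have "\<dots> = w * x" using assms(2) by (simp add: mult.assoc)
  finally show ?thesis .
qed

lemma Bs_commute0:
  assumes "z \<in> Bs d" "\<And>g. let_ok d g \<Longrightarrow> x * gn g = gn g * x"
  shows "x * z = z * x"
  using assms(1)
proof (induction rule: Bs.induct)
  case (Bs_mult y z)
  then show ?case by (metis mult.assoc)
qed (auto simp: sc_central assms algebra_simps)

lemma Bs_commute:
  assumes "z \<in> Bs d" "d \<le> n" "0 < d \<Longrightarrow> x * Y = Y * x"
    and "\<And>c. 1 \<le> c \<Longrightarrow> c < d \<Longrightarrow> x * X c = X c * x"
    and "\<And>c. 1 \<le> c \<Longrightarrow> c < d \<Longrightarrow> x * e c = e c * x"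
  shows "x * z = z * x"
proof (rule Bs_commute0[OF assms(1)])
  fix g assume g: "let_ok d g"
  show "x * gn g = gn g * x"
  proof (cases g)
    case Ym
    with g show ?thesis
      using comm_inv[OF assms(3) Y_Yi Yi_Y] by (simp add: let_ok_def)
  next
    case (Xm c)
    with g assms(2) show ?thesis
      using comm_inv[OF assms(4)[of c] X_Xi Xi_X] by (simp add: let_ok_def bmw_letter_def)
  qed (use g assms in \<open>auto simp: let_ok_def bmw_letter_def\<close>)
qed

lemma X_far: "1 \<le> i \<Longrightarrow> i < n \<Longrightarrow> 1 \<le> j \<Longrightarrow> j < n \<Longrightarrow> i + 2 \<le> j \<or> j + 2 \<le> i \<Longrightarrow> X i * X j = X j * X i"
  using XX_far by metis

lemma e_far: "1 \<le> i \<Longrightarrow> i < n \<Longrightarrow> 1 \<le> j \<Longrightarrow> j < n \<Longrightarrow> i + 2 \<le> j \<or> j + 2 \<le> i \<Longrightarrow> e i * e j = e j * e i"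
  using EE_far by metis

lemma X_Bs: "z \<in> Bs d \<Longrightarrow> d < c \<Longrightarrow> c < n \<Longrightarrow> X c * z = z * X c"
  by (erule Bs_commute) (auto simp: XE_far X_far YX)

lemma e_Bs: "z \<in> Bs d \<Longrightarrow> d < c \<Longrightarrow> c < n \<Longrightarrow> e c * z = z * e c"
  by (erule Bs_commute) (auto simp: XE_far e_far YE)

lemma Xi_Bs: "z \<in> Bs d \<Longrightarrow> d < c \<Longrightarrow> c < n \<Longrightarrow> Xi c * z = z * Xi c"
  using comm_inv[of z "X c" "Xi c"] X_Bs[of z d c] X_Xi[of c] Xi_X[of c] by simp

subsection \<open>Consequences of the relations\<close>

definition adj :: "nat \<Rightarrow> nat \<Rightarrow> bool" where
  "adj i j \<longleftrightarrow> 1 \<le> i \<and> i < n \<and> 1 \<le> j \<and> j < n \<and> (j = Suc i \<or> i = Suc j)"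

lemma adj_sym: "adj i j \<Longrightarrow> adj j i"
  by (auto simp: adj_def)

lemma X_Xi_cancel: "1 \<le> i \<Longrightarrow> i < n \<Longrightarrow> X i * (Xi i * z) = z"
  and Xi_X_cancel: "1 \<le> i \<Longrightarrow> i < n \<Longrightarrow> Xi i * (X i * z) = z"
  by (simp_all add: mult.assoc[symmetric] X_Xi Xi_X)

lemma X_eq: "1 \<le> i \<Longrightarrow> i < n \<Longrightarrow> X i = Xi i + sc dl * 1 - sc dl * e i"
  using skein[of i] by (simp add: algebra_simps)

lemma Xi_eq: "1 \<le> i \<Longrightarrow> i < n \<Longrightarrow> Xi i = X i - sc dl * 1 + sc dl * e i"
  using skein[of i] by (simp add: algebra_simps)

lemma EX: "1 \<le> i \<Longrightarrow> i < n \<Longrightarrow> e i * X i = sc lam * e i"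
  using star_eqD[OF XE[of i]] by (simp add: star_simps sc_central)

lemma XiE: "1 \<le> i \<Longrightarrow> i < n \<Longrightarrow> Xi i * e i = sc lami * e i"
  by (metis XE Xi_X_cancel mult_sc lam_lami(2))

lemma EXX: "adj i j \<Longrightarrow> e i * (X j * X i) = e i * e j"
  using star_eqD[OF XXE[of i j]] by (simp add: star_simps adj_def mult.assoc)

lemma XXEa: "adj i j \<Longrightarrow> X i * (X j * e i) = e j * e i"
  using XXE[of i j] by (simp add: adj_def)

lemma EEEa: "adj i j \<Longrightarrow> e i * (e j * e i) = e i"
  using EEE[of i j] by (simp add: adj_def)

lemma EEEz: "adj i j \<Longrightarrow> e i * (e j * (e i * z)) = e i * z"
  by (metis EEEa mult.assoc)

lemma adjD: "adj i j \<Longrightarrow> 1 \<le> i \<and> i < n \<and> 1 \<le> j \<and> j < n"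
  by (auto simp: adj_def)

text \<open>The counterpart for \<open>e\<close> of the braid relation \<open>braid_adj\<close>;
  with both, \<open>X\<close> and \<open>e\<close> can be moved past pairs of crossings by one
  argument.\<close>

lemma XXE_EXX: "adj i j \<Longrightarrow> X i * (X j * e i) = e j * (X i * X j)"
  by (simp add: XXEa EXX[OF adj_sym])

lemma XE_adj: "adj i j \<Longrightarrow> X j * e i = Xi i * (e j * e i)"
  by (metis XXEa Xi_X_cancel adjD)

text \<open>Multiplying \<open>X j * (X i * e j) = e i * e j\<close> by \<open>e i\<close> on the
  right and cancelling \<open>X j\<close> gives the claim.\<close>

lemma XEE_adj: "adj i j \<Longrightarrow> X i * (e j * e i) = Xi j * e i"
proof -
  assume a: "adj i j"
  have "X j * (X i * (e j * e i)) = e i * (e j * e i)"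
    using XXEa[OF adj_sym[OF a]] by (metis mult.assoc)
  then show ?thesis
    using a by (metis EEEa Xi_X_cancel adjD)
qed

lemma XiE_adj: "adj i j \<Longrightarrow> Xi j * e i = X i * (e j * e i)"
  by (simp add: XEE_adj)

lemma EX_adj: "adj i j \<Longrightarrow> e i * X j = e i * (e j * Xi i)"
  using star_eqD[OF XE_adj[of i j]] by (simp add: star_simps mult.assoc)

lemma EXi_adj: "adj i j \<Longrightarrow> e i * Xi j = e i * (e j * X i)"
  using star_eqD[OF XiE_adj[of i j]] by (simp add: star_simps mult.assoc)

lemma EXE_adj: "adj i j \<Longrightarrow> e i * (X j * e i) = sc lami * e i"
  using EX_adj[of i j] XiE[of i] EEEa[of i j] adjD[of i j]
  by (metis mult.assoc mult_sc)

lemma braid_adj: "adj i j \<Longrightarrow> X i * (X j * X i) = X j * (X i * X j)"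
  using braid[of i] braid[of j] by (auto simp: adj_def)

subsection \<open>The elements \<open>Y'\<^sub>i\<close>\<close>

definition yy :: "nat \<Rightarrow> 'b" where "yy i = ev (yw i)"
definition yi :: "nat \<Rightarrow> 'b" where "yi i = ev (ywinv i)"
definition zp :: "nat \<Rightarrow> int \<Rightarrow> 'b" where "zp i p = ev (ypow i p)"

lemmas yy_sc = mult_sc[of "yy i" for i] sc_central[of _ "yy i" for i, symmetric]
lemmas yi_sc = mult_sc[of "yi i" for i] sc_central[of _ "yi i" for i, symmetric]
lemmas zp_sc = mult_sc[of "zp i p" for i p] sc_central[of _ "zp i p" for i p, symmetric]

lemma yy_1: "yy (Suc 0) = Y" and yi_1: "yi (Suc 0) = Yi"
  by (simp_all add: yy_def yi_def yw_def ywinv_def)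

lemma yy_Suc: "1 \<le> i \<Longrightarrow> yy (Suc i) = X i * (yy i * X i)"
  and yi_Suc: "1 \<le> i \<Longrightarrow> yi (Suc i) = Xi i * (yi i * Xi i)"
  by (simp_all add: yy_def yi_def yw_def ywinv_def ev_append mult.assoc)

lemma yy_yi: "1 \<le> i \<Longrightarrow> i \<le> n \<Longrightarrow> yy i * yi i = 1"
  and yi_yy: "1 \<le> i \<Longrightarrow> i \<le> n \<Longrightarrow> yi i * yy i = 1"
proof (induction i rule: dec_induct)
  case base
  { case 1 then show ?case by (simp add: yy_1 yi_1 Y_Yi) }
  { case 2 then show ?case by (simp add: yy_1 yi_1 Yi_Y) }
next
  case (step i)
  { case 1
    then have "yy i * (yi i * Xi i) = Xi i" using step by (simp flip: mult.assoc)
    then show ?case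
      using 1 step by (simp add: yy_Suc yi_Suc mult.assoc X_Xi_cancel X_Xi) }
  { case 2
    then have "yi i * (yy i * X i) = X i" using step by (simp flip: mult.assoc)
    then show ?case
      using 2 step by (simp add: yy_Suc yi_Suc mult.assoc Xi_X_cancel Xi_X) }
qed

lemma Bs_yy: "1 \<le> i \<Longrightarrow> yy i \<in> Bs i" and Bs_yi: "1 \<le> i \<Longrightarrow> yi i \<in> Bs i"
  unfolding yy_def yi_def
  by (rule Bs_ev, auto simp: yw_def ywinv_def let_ok_def bmw_letter_def)+

lemma star_yy: "star (yy i) = yy i" and star_yi: "star (yi i) = yi i"
  by (simp_all add: yy_def yi_def star_ev yw_def ywinv_def rev_map)

lemma yi_yy_cancel: "1 \<le> i \<Longrightarrow> i \<le> n \<Longrightarrow> yi i * (yy i * z) = z"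
  by (simp_all add: mult.assoc[symmetric] yy_yi yi_yy)

text \<open>Here \<open>yy (Suc (Suc c))\<close> is \<open>yy c\<close> between two pairs of
  crossings. The first pair turns \<open>g c\<close> into \<open>g (Suc c)\<close>, which commutes
  with \<open>yy c\<close>, and the second pair turns it back.\<close>

lemma yy_comm_step:
  assumes c: "1 \<le> c" "Suc c < n" and g: "g = X \<or> g = e"
  shows "g c * yy (Suc (Suc c)) = yy (Suc (Suc c)) * g c"
proof -
  have a: "adj c (Suc c)" using c by (simp add: adj_def)
  have 1: "g c * (X (Suc c) * X c) = X (Suc c) * (X c * g (Suc c))"
    using g XXE_EXX[OF adj_sym[OF a]] braid_adj[OF a] by auto
  have 2: "g (Suc c) * (X c * X (Suc c)) = X c * (X (Suc c) * g c)"
    using g XXE_EXX[OF a] braid_adj[OF a] by auto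
  have 3: "g (Suc c) * yy c = yy c * g (Suc c)"
    using g X_Bs[OF Bs_yy, of c "Suc c"] e_Bs[OF Bs_yy, of c "Suc c"] c by auto
  have y: "yy (Suc (Suc c)) = X (Suc c) * (X c * (yy c * (X c * X (Suc c))))"
    using c by (simp add: yy_Suc mult.assoc)
  have "g c * yy (Suc (Suc c)) = (g c * (X (Suc c) * X c)) * (yy c * (X c * X (Suc c)))"
    by (simp add: y mult.assoc)
  also have "\<dots> = X (Suc c) * (X c * ((g (Suc c) * yy c) * (X c * X (Suc c))))"
    by (simp add: 1 mult.assoc)
  also have "\<dots> = X (Suc c) * (X c * (yy c * (g (Suc c) * (X c * X (Suc c)))))"
    by (simp add: 3 mult.assoc)
  also have "\<dots> = yy (Suc (Suc c)) * g c"
    by (simp add: 2 y mult.assoc)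
  finally show ?thesis .
qed

lemma yy_comm:
  assumes "1 \<le> c" "Suc c < i" "i \<le> n" and g: "g = X \<or> g = e"
  shows "g c * yy i = yy i * g c"
  using assms(1-3)
proof (induction i)
  case 0
  then show ?case by simp
next
  case (Suc i)
  show ?case
  proof (cases "Suc c = i")
    case True
    then show ?thesis using yy_comm_step[of c g] Suc g by simp
  next
    case False
    then have IH: "g c * yy i = yy i * g c" using Suc by simp
    have x: "g c * X i = X i * g c"
      using g XE_far[of i c] X_far[of c i] Suc False by auto
    have "g c * (X i * (yy i * X i)) = X i * (yy i * X i) * g c"
      by (metis IH x mult.assoc)
    then show ?thesis using Suc by (simp add: yy_Suc)
  qed
qed

lemma Y_yy: "1 \<le> i \<Longrightarrow> i \<le> n \<Longrightarrow> Y * yy i = yy i * Y"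
proof (induction i rule: dec_induct)
  case base
  then show ?case by (simp add: yy_1)
next
  case (step i)
  show ?case
  proof (cases "i = 1")
    case True
    then show ?thesis using step XYXY by (simp add: yy_Suc yy_1 mult.assoc)
  next
    case False
    then have "Y * X i = X i * Y" using step YX by simp
    then have "Y * (X i * (yy i * X i)) = X i * (yy i * X i) * Y"
      using step by (metis Suc_leD mult.assoc)
    then show ?thesis using step by (simp add: yy_Suc)
  qed
qed

lemma yy_Bs:
  assumes "z \<in> Bs d" "d < i" "i \<le> n"
  shows "yy i * z = z * yy i"
proof (rule Bs_commute[OF assms(1)])
  show "yy i * Y = Y * yy i" using Y_yy[of i] assms by simp
  show "yy i * X c = X c * yy i" if "1 \<le> c" "c < d" for c
    using yy_comm[of c i X] that assms by auto
  show "yy i * e c = e c * yy i" if "1 \<le> c" "c < d" for c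
    using yy_comm[of c i e] that assms by auto
qed (use assms in auto)

text \<open>The base is the relation \<open>YXYE\<close>. In the step a braid relation brings
  \<open>?z * (?x * (?z * ?f))\<close> together, which is \<open>lam\<close> times
  \<open>e i * ?f\<close>; the case \<open>i\<close> then applies in front of \<open>e i\<close>,
  and the remaining crossings cancel by \<open>XEE_adj\<close>.\<close>

lemma yy_yy_e: "1 \<le> i \<Longrightarrow> i < n \<Longrightarrow> yy i * (yy (Suc i) * e i) = e i"
proof (induction i rule: dec_induct)
  case base
  then have "Y * (X 1 * (Y * (X 1 * e 1))) = sc lam * (Y * (X 1 * (Y * e 1)))"
    using XE[of 1] by (simp add: mult_sc)
  also have "\<dots> = e 1" using YXYE base lam_lami(1)[of "e 1"] by simp
  finally show ?case by (simp add: yy_Suc yy_1 mult.assoc)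
next
  case (step i)
  let ?a = "yy i" and ?x = "X i" and ?z = "X (Suc i)" and ?f = "e (Suc i)"
  have a: "adj i (Suc i)" using step by (simp add: adj_def)
  have az: "?a * ?z = ?z * ?a" using X_Bs[OF Bs_yy, of i "Suc i"] step by simp
  have br: "?x * (?z * ?x) = ?z * (?x * ?z)" using braid_adj[OF a] .
  have zxz: "?z * (?x * (?z * ?f)) = sc lam * (e i * ?f)"
    using XE[of "Suc i"] XXEa[OF adj_sym[OF a]] step by (simp add: mult_sc)
  \<comment> \<open>The case \<open>i\<close> with its last crossing absorbed by \<open>e i\<close>;
    the factor \<open>lami\<close> compensates the \<open>lam\<close> produced by
    \<open>zxz\<close>.\<close>
  have axa: "?a * (?x * (?a * (e i * u))) = sc lami * (e i * u)" for u
  proof -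
    have "?a * (?x * (?a * (?x * e i))) = e i"
      using step by (simp add: yy_Suc mult.assoc)
    then have "?a * (?x * (?a * (?x * e i))) * u = e i * u"
      by simp
    then have "?a * (?x * (?a * (?x * e i * u))) = e i * u"
      by (simp only: mult.assoc)
    then have "sc lam * (?a * (?x * (?a * (e i * u)))) = e i * u"
      using XE[of i] step by (simp add: mult.assoc mult_sc)
    then have "sc lami * (sc lam * (?a * (?x * (?a * (e i * u))))) = sc lami * (e i * u)"
      by simp
    then show ?thesis by (simp only: lam_lami)
  qed
  have "yy (Suc i) * (yy (Suc (Suc i)) * ?f)
     = ?x * (?a * ((?x * (?z * ?x)) * (?a * (?x * (?z * ?f)))))"
    using step by (simp add: yy_Suc mult.assoc)
  also have "\<dots> = ?x * ((?a * ?z) * (?x * ((?z * ?a) * (?x * (?z * ?f)))))"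
    by (simp only: br mult.assoc)
  also have "\<dots> = ?x * ((?z * ?a) * (?x * ((?a * ?z) * (?x * (?z * ?f)))))"
    by (simp only: az)
  also have "\<dots> = ?x * (?z * (?a * (?x * (?a * (?z * (?x * (?z * ?f)))))))"
    by (simp only: mult.assoc)
  also have "\<dots> = ?x * (?z * (e i * ?f))"
    by (simp add: zxz gn_sc yy_sc axa lam_inv lami_lam)
  also have "\<dots> = ?f"
    using XEE_adj[OF adj_sym[OF a]] step by (simp add: X_Xi_cancel)
  finally show ?case .
qed

lemma yyS_e: "1 \<le> i \<Longrightarrow> i < n \<Longrightarrow> yy (Suc i) * e i = yi i * e i"
  by (metis yy_yy_e yi_yy_cancel less_imp_le)

lemma yiS_e: "1 \<le> i \<Longrightarrow> i < n \<Longrightarrow> yi (Suc i) * e i = yy i * e i"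
proof -
  assume i: "1 \<le> i" "i < n"
  have "yy (Suc i) * (yy i * e i) = e i"
    using yy_yy_e[OF i] yy_Bs[OF Bs_yy, of i "Suc i"] i by (metis Suc_leI lessI mult.assoc)
  then show ?thesis using yi_yy_cancel[of "Suc i" "yy i * e i"] i by simp
qed

section \<open>Integer powers of the elements \<open>Y'\<^sub>i\<close>\<close>

lemma ev_concat_replicate: "ev (concat (replicate m w)) = ev w ^ m"
  by (induction m) (simp_all add: ev_append)

lemma zp_nonneg: "zp i (int m) = yy i ^ m"
  by (simp add: zp_def ypow_def yy_def ev_concat_replicate)

lemma zp_neg: "zp i (- int m) = yi i ^ m"
  by (cases "m = 0") (auto simp: zp_def ypow_def yi_def ev_concat_replicate)

lemma zp_0 [simp]: "zp i 0 = 1"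
  using zp_nonneg[of i 0] by simp

lemma zp_1: "zp i 1 = yy i"
  using zp_nonneg[of i 1] by simp

lemma zp_m1: "zp i (-1) = yi i"
  using zp_neg[of i 1] by simp

lemma zp_add1: "1 \<le> i \<Longrightarrow> i \<le> n \<Longrightarrow> zp i (p + 1) = zp i p * yy i"
proof (cases p)
  case (nonneg m)
  then show ?thesis using zp_nonneg[of i m] zp_nonneg[of i "Suc m"]
    by (simp add: power_commutes add.commute)
next
  case (neg m)
  assume i: "1 \<le> i" "i \<le> n"
  have "yi i ^ Suc m * yy i = yi i ^ m"
    using yi_yy[OF i] by (simp add: power_Suc2 mult.assoc del: power_Suc)
  then show ?thesis using zp_neg[of i m] zp_neg[of i "Suc m"] neg by simp
qed

lemma zp_sub1: "1 \<le> i \<Longrightarrow> i \<le> n \<Longrightarrow> zp i (p - 1) = zp i p * yi i"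
  using zp_add1[of i "p - 1"] yy_yi[of i] by (simp add: mult.assoc)

lemma zp_add: "1 \<le> i \<Longrightarrow> i \<le> n \<Longrightarrow> zp i (p + r) = zp i p * zp i r"
proof (induction r rule: int_induct[where k = 0])
  case base
  then show ?case by simp
next
  case (step1 r)
  then show ?case using zp_add1[of i "p + r"] zp_add1[of i r] by (simp add: add.assoc mult.assoc)
next
  case (step2 r)
  then show ?case using zp_sub1[of i "p + r"] zp_sub1[of i r] by (simp add: add_diff_eq mult.assoc)
qed

lemma Bs_zp: "1 \<le> i \<Longrightarrow> zp i p \<in> Bs i"
  by (cases p rule: int_cases2) (simp_all add: zp_nonneg zp_neg Bs_pow Bs_yy Bs_yi)

lemma Bs_zp': "1 \<le> i \<Longrightarrow> i \<le> d \<Longrightarrow> zp i p \<in> Bs d"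
  using Bs_zp Bs_mono by blast

lemma star_zp: "star (zp i p) = zp i p"
proof -
  have "star (u ^ m) = star u ^ m" for u :: 'b and m
    by (induction m) (simp_all add: star_mult power_commutes)
  then show ?thesis
    by (cases p rule: int_cases2) (simp_all add: zp_nonneg zp_neg star_yy star_yi)
qed

text \<open>Two indices are allowed because this serves both for plain commutation
  (\<open>zp_Bs\<close>) and for the shift of a power by two strands past an arc
  (\<open>v_zp_shift\<close>).\<close>

lemma zp_intertwine:
  assumes "z * yy i = yy j * z" "1 \<le> i" "i \<le> n" "1 \<le> j" "j \<le> n"
  shows "z * zp i p = zp j p * z"
proof -
  have yi: "z * yi i = yi j * z"
  proof -
    have "yi j * (z * yy i) * yi i = yi j * z"
      using yy_yi[of i] assms(2,3) by (simp add: mult.assoc)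
    then show ?thesis
      unfolding assms(1) using assms by (simp add: mult.assoc yi_yy_cancel)
  qed
  show ?thesis
  proof (induction p rule: int_induct[where k = 0])
    case base
    then show ?case by simp
  next
    case (step1 r)
    then show ?case using zp_add1[of i r] zp_add1[of j r] assms by (metis mult.assoc)
  next
    case (step2 r)
    then show ?case using zp_sub1[of i r] zp_sub1[of j r] assms yi by (metis mult.assoc)
  qed
qed

lemma zp_Bs: "z \<in> Bs d \<Longrightarrow> d < i \<Longrightarrow> i \<le> n \<Longrightarrow> z * zp i p = zp i p * z"
  by (rule zp_intertwine) (auto simp: yy_Bs)

lemma zp_Xi: "1 \<le> i \<Longrightarrow> i < c \<Longrightarrow> c < n \<Longrightarrow> Xi c * zp i p = zp i p * Xi c"
  by (rule Xi_Bs[OF Bs_zp]) auto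

lemma zpS_e: "1 \<le> i \<Longrightarrow> i < n \<Longrightarrow> zp (Suc i) p * e i = zp i (- p) * e i"
proof (induction p rule: int_induct[where k = 0])
  case base
  then show ?case by simp
next
  case (step1 r)
  have "zp (Suc i) (r + 1) * e i = zp (Suc i) r * (yi i * e i)"
    using step1 zp_add1[of "Suc i" r] by (simp add: mult.assoc yyS_e)
  also have "\<dots> = (yi i * zp (Suc i) r) * e i"
    by (subst zp_Bs[OF Bs_yi, of i "Suc i" r])  (use step1 in \<open>simp_all add: mult.assoc\<close>)
  also have "\<dots> = yi i * (zp (Suc i) r * e i)"
    by (simp add: mult.assoc)
  also have "\<dots> = zp i (-1) * zp i (- r) * e i"
    using step1 by (simp add: zp_m1 mult.assoc)
  also have "zp i (-1) * zp i (- r) = zp i (- (r + 1))"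
    using zp_add[of i "-1" "- r"] step1 by (simp add: minus_diff_commute)
  finally show ?case .
next
  case (step2 r)
  have "zp (Suc i) (r - 1) * e i = zp (Suc i) r * (yy i * e i)"
    using step2 zp_sub1[of "Suc i" r] by (simp add: mult.assoc yiS_e)
  also have "\<dots> = (yy i * zp (Suc i) r) * e i"
    by (subst zp_Bs[OF Bs_yy, of i "Suc i" r])  (use step2 in \<open>simp_all add: mult.assoc\<close>)
  also have "\<dots> = yy i * (zp (Suc i) r * e i)"
    by (simp add: mult.assoc)
  also have "\<dots> = zp i 1 * zp i (- r) * e i"
    using step2 by (simp add: zp_1 mult.assoc)
  also have "zp i 1 * zp i (- r) = zp i (- (r - 1))"
    using zp_add[of i 1 "- r"] step2 by simp
  finally show ?case .
qed

lemma e_zpS: "1 \<le> i \<Longrightarrow> i < n \<Longrightarrow> e i * zp (Suc i) p = e i * zp i (- p)"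
  using star_eqD[OF zpS_e[of i p]] by (simp add: star_simps star_zp)

subsection \<open>Moving \<open>X\<^sub>i\<close> past powers of \<open>Y'\<^sub>i\<close> and \<open>Y'\<^sub>i\<^sub>+\<^sub>1\<close>\<close>

lemma comm_left: "z * w = w * z \<Longrightarrow> z * (w * u) = w * (z * u)" for z w u :: 'b
  by (metis mult.assoc)

lemmas nc = ring_distribs mult.assoc gn_sc yy_sc yi_sc zp_sc

definition btw :: "int \<Rightarrow> int \<Rightarrow> bool" where
  "btw p s \<longleftrightarrow> (0 \<le> s \<and> s \<le> p) \<or> (p \<le> s \<and> s \<le> 0)"

text \<open>Excluding \<open>s = 0\<close> for positive \<open>p\<close> and \<open>s = p\<close> for negative \<open>p\<close> makes \<open>p - s\<close>, and not only
  \<open>s\<close>, small: \<open>Pset k\<close> then contains both \<open>p - s\<close> and \<open>s - p\<close> for \<open>p \<in> Pset k\<close>.\<close>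

definition sbtw :: "int \<Rightarrow> int \<Rightarrow> bool" where
  "sbtw p s \<longleftrightarrow> (0 < s \<and> s \<le> p) \<or> (p < s \<and> s \<le> 0)"

lemma sbtw_btw: "sbtw p s \<Longrightarrow> btw p s"
  by (auto simp: sbtw_def btw_def)

lemma X_yyS:
  assumes "1 \<le> i" "i < n"
  shows "X i * yy (Suc i) = yy i * X i + sc dl * yy (Suc i) - sc dl * (e i * yy (Suc i))"
proof -
  have "Xi i * yy (Suc i) = yy i * X i"
    using assms by (simp add: yy_Suc Xi_X_cancel)
  moreover have "X i * yy (Suc i) = (Xi i + sc dl * 1 - sc dl * e i) * yy (Suc i)"
    using X_eq[OF assms] by simp
  ultimately show ?thesis
    by (simp add: nc)
qed

lemma X_yiS:
  assumes "1 \<le> i" "i < n"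
  shows "X i * yi (Suc i) = yi i * X i - sc dl * yi i + sc dl * (yi i * e i)"
proof -
  have "X i * yi (Suc i) = yi i * Xi i"
    using assms by (simp add: yi_Suc X_Xi_cancel)
  moreover have "yi i * Xi i = yi i * (X i - sc dl * 1 + sc dl * e i)"
    using Xi_eq[OF assms] by simp
  ultimately show ?thesis
    by (simp add: nc)
qed

text \<open>The correction terms in \<open>X_zpS\<close>: each use of the skein relation leaves one
  term with \<open>u = 1\<close> and one with \<open>u = e i\<close>.\<close>

definition mids :: "nat \<Rightarrow> int \<Rightarrow> 'b set" where
  "mids i p = {zp i (p - s) * u * zp (Suc i) s | s u. sbtw p s \<and> (u = 1 \<or> u = e i)}"

lemma midsI: "sbtw p s \<Longrightarrow> u = 1 \<or> u = e i \<Longrightarrow> p - s = r \<Longrightarrow> zp i r * u * zp (Suc i) s \<in> md.span (mids i p)"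
  unfolding mids_def by (rule md.span_base) blast

text \<open>The asymmetry of \<open>sbtw\<close> originates here. A new correction from
  \<open>X_yyS\<close> carries \<open>yy (Suc i)\<close> with exponent \<open>1\<close>, one from
  \<open>X_yiS\<close> with exponent \<open>0\<close>; later steps move these exponents up or down
  respectively.\<close>

lemma X_zpS:
  assumes i: "1 \<le> i" "i < n"
  shows "X i * zp (Suc i) p - zp i p * X i \<in> md.span (mids i p)"
proof (induction p rule: int_induct[where k = 0])
  case base
  then show ?case by (simp add: md.span_zero)
next
  case (step1 r)
  let ?D = "X i * zp (Suc i) r - zp i r * X i"
  have "X i * zp (Suc i) (r + 1) - zp i (r + 1) * X i
      = ?D * yy (Suc i) + zp i r * (X i * yy (Suc i) - yy i * X i)"
    using i by (simp add: zp_add1[of _ r] nc)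
  also have "\<dots> = ?D * yy (Suc i) + sc dl * (zp i r * 1 * zp (Suc i) 1)
      - sc dl * (zp i r * e i * zp (Suc i) 1)"
    using i by (simp add: X_yyS nc zp_1)
  also have "\<dots> \<in> md.span (mids i (r + 1))"
  proof (intro md.span_add md.span_diff md.span_scale midsI)
    show "?D * yy (Suc i) \<in> md.span (mids i (r + 1))"
    proof (rule span_multR[OF step1(2)])
      fix x assume "x \<in> mids i r"
      then obtain s u where x: "x = zp i (r - s) * u * zp (Suc i) s" "sbtw r s" "u = 1 \<or> u = e i"
        by (auto simp: mids_def)
      have "x * yy (Suc i) = zp i (r - s) * u * zp (Suc i) (s + 1)"
        using i by (simp add: x(1) zp_add1 mult.assoc)
      then show "x * yy (Suc i) \<in> md.span (mids i (r + 1))"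
        using x step1(1) by (auto simp: sbtw_def intro!: midsI)
    qed
  qed (use step1(1) in \<open>auto simp: sbtw_def\<close>)
  finally show ?case .
next
  case (step2 r)
  let ?D = "X i * zp (Suc i) r - zp i r * X i"
  have "X i * zp (Suc i) (r - 1) - zp i (r - 1) * X i
      = ?D * yi (Suc i) + zp i r * (X i * yi (Suc i) - yi i * X i)"
    using i by (simp add: zp_sub1[of _ r] nc)
  also have "\<dots> = ?D * yi (Suc i) - sc dl * (zp i (r - 1) * 1 * zp (Suc i) 0)
      + sc dl * (zp i (r - 1) * e i * zp (Suc i) 0)"
    using i by (simp add: X_yiS nc zp_sub1[of _ r])
  also have "\<dots> \<in> md.span (mids i (r - 1))"
  proof (intro md.span_add md.span_diff md.span_scale midsI)
    show "?D * yi (Suc i) \<in> md.span (mids i (r - 1))"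
    proof (rule span_multR[OF step2(2)])
      fix x assume "x \<in> mids i r"
      then obtain s u where x: "x = zp i (r - s) * u * zp (Suc i) s" "sbtw r s" "u = 1 \<or> u = e i"
        by (auto simp: mids_def)
      have "x * yi (Suc i) = zp i (r - s) * u * zp (Suc i) (s - 1)"
        using i by (simp add: x(1) zp_sub1 mult.assoc)
      then show "x * yi (Suc i) \<in> md.span (mids i (r - 1))"
        using x step2(1) by (auto simp: sbtw_def intro!: midsI)
    qed
  qed (use step2(1) in \<open>auto simp: sbtw_def\<close>)
  finally show ?case .
qed

definition mids' :: "nat \<Rightarrow> int \<Rightarrow> 'b set" where
  "mids' i p = {zp (Suc i) s * u * zp i (p - s) | s u. sbtw p s \<and> (u = 1 \<or> u = e i)}"

lemma zpS_X:
  assumes i: "1 \<le> i" "i < n"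
  shows "zp (Suc i) p * X i - X i * zp i p \<in> md.span (mids' i p)"
proof -
  have "star (X i * zp (Suc i) p - zp i p * X i) \<in> md.span (star ` mids i p)"
    by (rule span_star[OF X_zpS[OF i]])
  moreover have "star ` mids i p \<subseteq> mids' i p"
  proof (rule image_subsetI)
    fix x assume "x \<in> mids i p"
    then obtain s u where x: "x = zp i (p - s) * u * zp (Suc i) s" "sbtw p s" "u = 1 \<or> u = e i"
      by (auto simp: mids_def)
    have "star x = zp (Suc i) s * u * zp i (p - s)"
      using x(3) by (auto simp: x(1) star_simps star_zp mult.assoc)
    then show "star x \<in> mids' i p"
      using x unfolding mids'_def by blast
  qed
  ultimately show ?thesis
    using md.span_mono[of "star ` mids i p" "mids' i p"] by (auto simp: star_simps star_zp)
qed

subsection \<open>The elements \<open>e\<^sub>i Y'\<^sub>i\<^sup>p e\<^sub>i\<close> and \<open>X\<^sub>i Y'\<^sub>i\<^sup>p e\<^sub>i\<close>\<close>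

text \<open>A predicate, because the two lemmas on \<open>X i * (zp i p * e i)\<close> and its
  mirror image assume it at \<open>i\<close> and are in turn used to prove it at
  \<open>Suc i\<close>.\<close>

definition eYe :: "nat \<Rightarrow> bool" where
  "eYe i \<longleftrightarrow> (\<forall>r. \<exists>z \<in> Bs (i - 1). e i * (zp i r * e i) = z * e i)"

definition Ye :: "nat \<Rightarrow> int \<Rightarrow> 'b set" where
  "Ye i p = {zp i t * (z * e i) | t z. \<bar>t\<bar> \<le> \<bar>p\<bar> \<and> z \<in> Bs (i - 1)}"

lemma YeI: "\<bar>t\<bar> \<le> \<bar>p\<bar> \<Longrightarrow> z \<in> Bs (i - 1) \<Longrightarrow> zp i t * (z * e i) \<in> md.span (Ye i p)"
  unfolding Ye_def by (rule md.span_base) blast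

lemma zp_zpS: "1 \<le> i \<Longrightarrow> i < n \<Longrightarrow> zp i p * zp (Suc i) r = zp (Suc i) r * zp i p"
  using zp_Bs[OF Bs_zp, of i "Suc i" p r] by simp

lemma zp_zpS_e: "1 \<le> i \<Longrightarrow> i < n \<Longrightarrow> zp (Suc i) s * (zp i r * e i) = zp i (r - s) * e i"
proof -
  assume i: "1 \<le> i" "i < n"
  have "zp (Suc i) s * (zp i r * e i) = zp i r * (zp (Suc i) s * e i)"
    using zp_zpS[OF i, of r s] by (simp flip: mult.assoc)
  also have "\<dots> = (zp i r * zp i (- s)) * e i"
    by (simp only: zpS_e[OF i] mult.assoc)
  also have "zp i r * zp i (- s) = zp i (r - s)"
    using zp_add[of i r "- s"] i by simp
  finally show ?thesis .
qed

text \<open>After \<open>X i\<close> has passed the power, every \<open>zp (Suc i) s\<close> meets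
  \<open>e i\<close> and becomes \<open>zp i (- s)\<close>. Exponents such as
  \<open>p - 2 * s\<close> result, whose absolute value is at most that of \<open>p\<close> since
  \<open>s\<close> lies between \<open>0\<close> and \<open>p\<close>.\<close>

lemma X_zp_e_aux:
  assumes i: "1 \<le> i" "i < n" and C: "eYe i"
  shows "X i * (zp i p * e i) \<in> md.span (Ye i p)"
proof -
  let ?D = "zp (Suc i) p * X i - X i * zp i p"
  have "X i * (zp i p * e i) = sc lam * (zp i (- p) * (1 * e i)) - ?D * e i"
    using i by (simp add: nc XE zpS_e)
  moreover have "?D * e i \<in> md.span (Ye i p)"
  proof (rule span_multR[OF zpS_X[OF i]])
    fix x assume "x \<in> mids' i p"
    then obtain s u where x: "x = zp (Suc i) s * u * zp i (p - s)" "btw p s" "u = 1 \<or> u = e i"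
      by (auto simp: mids'_def dest: sbtw_btw)
    show "x * e i \<in> md.span (Ye i p)"
    proof (cases "u = 1")
      case True
      then have eq: "x * e i = zp i (p - s - s) * (1 * e i)"
        using i by (simp add: x(1) mult.assoc zp_zpS_e)
      show ?thesis
        unfolding eq using x(2) by (intro YeI Bs_1) (auto simp: btw_def)
    next
      case False
      then have u: "u = e i" using x by simp
      obtain z where z: "z \<in> Bs (i - 1)" "e i * (zp i (p - s) * e i) = z * e i"
        using C by (auto simp: eYe_def)
      have l: "i - 1 < Suc i" "i - 1 < i" using i by auto
      have "x * e i = zp (Suc i) s * (z * e i)"
        by (simp add: x(1) u z mult.assoc)
      also have "\<dots> = z * (zp (Suc i) s * e i)"
        using zp_Bs[OF z(1) l(1), of s] i by (metis comm_left Suc_leI)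
      also have "\<dots> = zp i (- s) * (z * e i)"
        unfolding zpS_e[OF i] using zp_Bs[OF z(1) l(2), of "- s"] i by (metis comm_left less_imp_le)
      finally show ?thesis
        using x z by (auto simp: btw_def intro!: YeI)
    qed
  qed
  ultimately show ?thesis
    using YeI[of "- p" p 1 i] Bs_1 by (simp add: md.span_diff md.span_scale)
qed

lemma e_zp_X_aux:
  assumes i: "1 \<le> i" "i < n" and C: "eYe i"
  shows "e i * (zp i p * X i) \<in> md.span {e i * (z * zp i t) | t z. \<bar>t\<bar> \<le> \<bar>p\<bar> \<and> z \<in> Bs (i - 1)}"
    (is "_ \<in> md.span ?S")
proof -
  have "star (X i * (zp i p * e i)) \<in> md.span (star ` Ye i p)"
    by (rule span_star[OF X_zp_e_aux[OF assms]])
  moreover have "star ` Ye i p \<subseteq> ?S"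
  proof (rule image_subsetI)
    fix x assume "x \<in> Ye i p"
    then obtain t z where x: "x = zp i t * (z * e i)" "\<bar>t\<bar> \<le> \<bar>p\<bar>" "z \<in> Bs (i - 1)"
      by (auto simp: Ye_def)
    have "star x = e i * (star z * zp i t)"
      by (simp add: x(1) star_simps star_zp mult.assoc)
    then show "star x \<in> ?S"
      using x star_Bs by blast
  qed
  ultimately show ?thesis
    using md.span_mono[of "star ` Ye i p" ?S] by (auto simp: star_simps star_zp mult.assoc)
qed

lemma subspace_sandwich: "md.subspace {x. \<exists>z \<in> Bs d. gn g * x * gn g = z * gn g}"
proof (rule md.subspaceI)
  show "0 \<in> {x. \<exists>z \<in> Bs d. gn g * x * gn g = z * gn g}"
    by (auto intro!: bexI[OF _ Bs_0])
next
  fix x y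
  assume "x \<in> {x. \<exists>z \<in> Bs d. gn g * x * gn g = z * gn g}"
    and "y \<in> {x. \<exists>z \<in> Bs d. gn g * x * gn g = z * gn g}"
  then obtain z z' where "z \<in> Bs d" "z' \<in> Bs d" "gn g * x * gn g = z * gn g" "gn g * y * gn g = z' * gn g"
    by blast
  then have "z + z' \<in> Bs d" "gn g * (x + y) * gn g = (z + z') * gn g"
    by (auto simp: ring_distribs intro: Bs_add)
  then show "x + y \<in> {x. \<exists>z \<in> Bs d. gn g * x * gn g = z * gn g}" by blast
next
  fix c x
  assume "x \<in> {x. \<exists>z \<in> Bs d. gn g * x * gn g = z * gn g}"
  then obtain z where "z \<in> Bs d" "gn g * x * gn g = z * gn g"
    by blast
  then have "sc c * z \<in> Bs d" "gn g * (sc c * x) * gn g = (sc c * z) * gn g"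
    by (auto simp: gn_sc mult.assoc intro: Bs_smult)
  then show "sc c * x \<in> {x. \<exists>z \<in> Bs d. gn g * x * gn g = z * gn g}" by blast
qed

text \<open>These elements form a bimodule over \<open>Bs i\<close> (\<open>absorbed_L\<close>,
  \<open>absorbed_R\<close>), and \<open>eYe (Suc i)\<close> says that it contains all powers of
  \<open>yy (Suc i)\<close>. Arguing with a bimodule avoids tracking the coefficient
  \<open>z\<close>.\<close>

definition absorbed :: "nat \<Rightarrow> 'b \<Rightarrow> bool" where
  "absorbed i x \<longleftrightarrow> (\<exists>z \<in> Bs i. e (Suc i) * x * e (Suc i) = z * e (Suc i))"

lemma absorbed_subspace: "md.subspace {x. absorbed i x}"
  unfolding absorbed_def by (rule subspace_sandwich)

lemma absorbed_smult: "absorbed i x \<Longrightarrow> absorbed i (sc c * x)"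
  using md.subspace_scale[OF absorbed_subspace] by blast

lemma absorbed_add: "absorbed i x \<Longrightarrow> absorbed i y \<Longrightarrow> absorbed i (x + y)"
  using md.subspace_add[OF absorbed_subspace] by blast

lemma absorbed_diff: "absorbed i x \<Longrightarrow> absorbed i y \<Longrightarrow> absorbed i (x - y)"
  using md.subspace_diff[OF absorbed_subspace] by blast

lemma absorbed_span: "x \<in> md.span S \<Longrightarrow> (\<And>s. s \<in> S \<Longrightarrow> absorbed i s) \<Longrightarrow> absorbed i x"
  using md.span_minimal[OF _ absorbed_subspace[of i], of S] by blast

lemma absorbed_L: "Suc i < n \<Longrightarrow> y \<in> Bs i \<Longrightarrow> absorbed i x \<Longrightarrow> absorbed i (y * x)"
  unfolding absorbed_def
proof (elim bexE)
  fix z assume a: "Suc i < n" "y \<in> Bs i" "z \<in> Bs i" "e (Suc i) * x * e (Suc i) = z * e (Suc i)"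
  have "e (Suc i) * (y * x) * e (Suc i) = e (Suc i) * y * x * e (Suc i)" by (simp add: mult.assoc)
  also have "\<dots> = y * (e (Suc i) * x * e (Suc i))" using e_Bs[OF a(2), of "Suc i"] a(1) by (simp add: mult.assoc)
  also have "\<dots> = (y * z) * e (Suc i)" unfolding a(4) by (simp add: mult.assoc)
  finally show "\<exists>z\<in>Bs i. e (Suc i) * (y * x) * e (Suc i) = z * e (Suc i)"
    using a by (blast intro: Bs_mult)
qed

lemma absorbed_R: "Suc i < n \<Longrightarrow> y \<in> Bs i \<Longrightarrow> absorbed i x \<Longrightarrow> absorbed i (x * y)"
  unfolding absorbed_def
proof (elim bexE)
  fix z assume a: "Suc i < n" "y \<in> Bs i" "z \<in> Bs i" "e (Suc i) * x * e (Suc i) = z * e (Suc i)"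
  have "e (Suc i) * (x * y) * e (Suc i) = e (Suc i) * x * (e (Suc i) * y)"
    using e_Bs[OF a(2), of "Suc i"] a by (simp add: mult.assoc)
  also have "\<dots> = z * (e (Suc i) * y)" using a by (simp flip: mult.assoc)
  also have "\<dots> = (z * y) * e (Suc i)" using e_Bs[OF a(2), of "Suc i"] a by (simp add: mult.assoc)
  finally show "\<exists>z\<in>Bs i. e (Suc i) * (x * y) * e (Suc i) = z * e (Suc i)"
    using a by (blast intro: Bs_mult)
qed

lemma absorbed_gens:
  assumes "1 \<le> i" "Suc i < n"
  shows "absorbed i 1" "absorbed i (X i)" "absorbed i (e i)"
proof -
  have a: "adj (Suc i) i" using assms by (simp add: adj_def)
  show "absorbed i 1" using EE[of "Suc i"] assms by (auto simp: absorbed_def intro: Bs_sc)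
  show "absorbed i (X i)" using EXE_adj[OF a] by (auto simp: absorbed_def mult.assoc intro: Bs_sc)
  show "absorbed i (e i)" using EEEa[OF a] by (auto simp: absorbed_def mult.assoc intro: bexI[OF _ Bs_1])
qed

text \<open>A power of \<open>yy (Suc i)\<close> is rewritten, up to powers of smaller absolute
  exponent, as \<open>X i * (zp i r * Xi i)\<close>, and this sandwich reduces to the one for
  \<open>e i\<close>.\<close>

lemma eYe_step:
  assumes i: "1 \<le> i" "Suc i < n" and C: "eYe i"
  shows "eYe (Suc i)"
proof -
  let ?f = "e (Suc i)"
  have a: "adj (Suc i) i" using i by (simp add: adj_def)
  have in': "i < n" using i by simp
  note g = absorbed_gens[OF i]
  note zB = Bs_zp[OF i(1)]
  have Bmono: "z \<in> Bs (i - 1) \<Longrightarrow> z \<in> Bs i" for z using Bs_mono by force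
  have zzeX: "absorbed i (e i * (zp i w * X i))" for w
    by (rule absorbed_span[OF e_zp_X_aux[OF i(1) in' C]]) (auto intro!: absorbed_R i g Bs_mult zB intro: Bmono)
  have zzXe: "absorbed i (X i * (zp i w * e i))" for w
    by (rule absorbed_span[OF X_zp_e_aux[OF i(1) in' C]]) (auto simp: Ye_def intro!: absorbed_L i g zB Bmono)
  have zzee: "absorbed i (e i * (zp i w * e i))" for w
  proof -
    obtain z where "z \<in> Bs (i - 1)" "e i * (zp i w * e i) = z * e i" using C by (auto simp: eYe_def)
    then show ?thesis by (auto intro!: absorbed_L i g Bmono)
  qed
  have zzeXi: "absorbed i (e i * (zp i w * Xi i))" for w
    using Xi_eq[OF i(1) in'] zzeX[of w] zzee[of w] absorbed_R[OF i(2) zB g(3), of w]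
    by (auto simp: nc intro!: absorbed_diff absorbed_add absorbed_smult)
  \<comment> \<open>Next to \<open>?f\<close> the two crossings turn into hooks \<open>e i\<close>
    together with \<open>Xi (Suc i)\<close> and \<open>X (Suc i)\<close>. The latter cancel across
    \<open>zp i r\<close>, leaving \<open>e i * (zp i r * e i)\<close>, to which
    \<open>eYe i\<close> applies.\<close>
  have XaXi: "absorbed i (X i * (zp i r * Xi i))" for r
  proof -
    obtain z where z: "z \<in> Bs (i - 1)" "e i * (zp i r * e i) = z * e i" using C by (auto simp: eYe_def)
    have c: "Xi (Suc i) * zp i r = zp i r * Xi (Suc i)" using zp_Xi[of i "Suc i"] i by simp
    have "?f * (X i * (zp i r * Xi i)) * ?f = (?f * X i) * (zp i r * (Xi i * ?f))"
      by (simp add: mult.assoc)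
    also have "\<dots> = ?f * (e i * ((Xi (Suc i) * zp i r) * (X (Suc i) * (e i * ?f))))"
      by (simp add: EX_adj[OF a] XiE_adj[OF a] mult.assoc)
    also have "\<dots> = ?f * ((e i * (zp i r * e i)) * ?f)"
      using i by (simp add: c mult.assoc Xi_X_cancel)
    also have "\<dots> = z * (?f * (e i * ?f))"
      using e_Bs[OF Bmono[OF z(1)], of "Suc i"] i by (simp add: z mult.assoc) (simp flip: mult.assoc)
    also have "\<dots> = z * ?f" by (simp add: EEEa[OF a])
    finally show ?thesis using Bmono[OF z(1)] by (auto simp: absorbed_def)
  qed
  have absorbed_zpX: "absorbed i (zp (Suc i) s * X i)" if IH: "\<And>t. \<bar>t\<bar> \<le> \<bar>s\<bar> \<Longrightarrow> absorbed i (zp (Suc i) t)" for s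
  proof -
    have "absorbed i (zp (Suc i) s * X i - X i * zp i s)"
    proof (rule absorbed_span[OF zpS_X[OF i(1) in']])
      fix x assume "x \<in> mids' i s"
      then obtain t u where x: "x = zp (Suc i) t * u * zp i (s - t)" "btw s t" "u = 1 \<or> u = e i"
        by (auto simp: mids'_def dest: sbtw_btw)
      have "absorbed i (zp (Suc i) t)" using IH x(2) by (auto simp: btw_def)
      moreover have "absorbed i (zp (Suc i) t * e i)"
        unfolding zpS_e[OF i(1) in'] by (rule absorbed_L[OF i(2) zB g(3)])
      ultimately have "absorbed i (zp (Suc i) t * u)" using x(3) by auto
      then show "absorbed i x" unfolding x(1) by (rule absorbed_R[OF i(2) zB])
    qed
    then have "absorbed i ((zp (Suc i) s * X i - X i * zp i s) + X i * zp i s)"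
      by (intro absorbed_add absorbed_R i zB g)
    then show ?thesis by simp
  qed
  have main: "absorbed i (zp (Suc i) s * u * zp i w * y)"
    if IH: "\<And>t. \<bar>t\<bar> \<le> \<bar>s\<bar> \<Longrightarrow> absorbed i (zp (Suc i) t)" and u: "u = 1 \<or> u = e i"
      and y: "y = X i \<or> y = Xi i" for s u w y
  proof (cases "u = 1")
    case True
    have zX: "absorbed i (zp i w * (zp (Suc i) s * X i))"
      by (intro absorbed_L i zB absorbed_zpX IH)
    have z1: "absorbed i (zp i w * (zp (Suc i) s))"
      by (intro absorbed_L i zB IH) simp
    have "absorbed i (zp i w * (zp (Suc i) s * e i))"
      unfolding zpS_e[OF i(1) in'] by (intro absorbed_L i zB g)
    then have "absorbed i (zp i w * (zp (Suc i) s * Xi i))"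
      using zX z1 Xi_eq[OF i(1) in'] by (auto simp: nc intro!: absorbed_diff absorbed_add absorbed_smult)
    then show ?thesis
      using True y zX zp_zpS[OF i(1) in', of w s] by (auto simp flip: mult.assoc)
  next
    case False
    then have "zp (Suc i) s * u * zp i w * y = zp i (- s) * (e i * (zp i w * y))"
      using u zpS_e[OF i(1) in', of s] by (simp add: mult.assoc[symmetric])
    moreover have "absorbed i (e i * (zp i w * y))" using y zzeX zzeXi by auto
    ultimately show ?thesis
      using absorbed_L[OF i(2) zB] by simp
  qed
  have zzD: "absorbed i ((zp (Suc i) s * X i - X i * zp i s) * (zp i w * y))"
    if IH: "\<And>t. \<bar>t\<bar> \<le> \<bar>s\<bar> \<Longrightarrow> absorbed i (zp (Suc i) t)" and y: "y = X i \<or> y = Xi i" for s w y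
  proof (rule absorbed_span[where S = "(\<lambda>x. x * (zp i w * y)) ` mids' i s"])
    show "(zp (Suc i) s * X i - X i * zp i s) * (zp i w * y) \<in> md.span ((\<lambda>x. x * (zp i w * y)) ` mids' i s)"
      by (rule span_multR[OF zpS_X[OF i(1) in']]) (auto intro: md.span_base)
    fix x assume "x \<in> (\<lambda>x. x * (zp i w * y)) ` mids' i s"
    then obtain t u where x: "x = zp (Suc i) t * u * zp i (s - t) * (zp i w * y)" "btw s t" "u = 1 \<or> u = e i"
      by (auto simp: mids'_def dest: sbtw_btw)
    have "x = zp (Suc i) t * u * zp i (s - t + w) * y"
      using zp_add[of i "s - t" w] i by (simp add: x(1) mult.assoc)
    then show "absorbed i x" using x y by (auto simp: btw_def intro!: main IH)
  qed
  \<comment> \<open>One factor is split off the power and opened. Moving a crossing across the rest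
    leaves \<open>XaXi\<close>, after the skein relation has adjusted one crossing, and corrections
    \<open>?D\<close> in which the exponents of \<open>yy (Suc i)\<close> are smaller in absolute
    value.\<close>
  have "absorbed i (zp (Suc i) r)" for r
  proof (induction "nat \<bar>r\<bar>" arbitrary: r rule: less_induct)
    case less
    have IH: "absorbed i (zp (Suc i) t)" if "\<bar>t\<bar> < \<bar>r\<bar>" for t using less[of t] that by simp
    consider "r = 0" | "r > 0" | "r < 0" by linarith
    then show ?case
    proof cases
      case 1
      then show ?thesis using g by simp
    next
      case 2
      let ?D = "zp (Suc i) (r - 1) * X i - X i * zp i (r - 1)"
      have "zp (Suc i) r = zp (Suc i) (r - 1) * (X i * (yy i * X i))"
        using zp_add1[of "Suc i" "r - 1"] i by (simp add: yy_Suc)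
      also have "\<dots> = ?D * (yy i * X i) + X i * (zp i (r - 1) * yy i) * X i"
        by (simp add: nc)
      also have "zp i (r - 1) * yy i = zp i r"
        using zp_add1[of i "r - 1"] i by simp
      also have "X i * zp i r * X i = X i * (zp i r * Xi i) + sc dl * (X i * zp i r) - sc dl * (X i * (zp i r * e i))"
        by (subst (2) X_eq[OF i(1) in']) (simp add: nc)
      finally have eq: "zp (Suc i) r = ?D * (yy i * X i) + \<dots>" .
      have "absorbed i (?D * (yy i * X i))"
        unfolding zp_1[symmetric] using 2 by (intro zzD IH) auto
      then show ?thesis
        unfolding eq using XaXi[of r] zzXe[of r] absorbed_R[OF i(2) zB g(2), of r]
        by (intro absorbed_add absorbed_diff absorbed_smult) (simp_all add: mult.assoc)
    next
      case 3
      let ?D = "zp (Suc i) (r + 1) * X i - X i * zp i (r + 1)"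
      have "zp (Suc i) r = zp (Suc i) (r + 1) * (Xi i * (yi i * Xi i))"
        using zp_sub1[of "Suc i" "r + 1"] i by (simp add: yi_Suc)
      also have "\<dots> = zp (Suc i) (r + 1) * (X i * (yi i * Xi i))
          - sc dl * (zp (Suc i) (r + 1) * (yi i * Xi i)) + sc dl * (zp (Suc i) (r + 1) * (e i * (yi i * Xi i)))"
        by (subst (1) Xi_eq[OF i(1) in']) (simp add: nc)
      also have "zp (Suc i) (r + 1) * (X i * (yi i * Xi i)) = ?D * (yi i * Xi i) + X i * (zp i (r + 1) * yi i * Xi i)"
        by (simp add: nc)
      also have "zp i (r + 1) * yi i = zp i r"
        using zp_sub1[of i "r + 1"] i by simp
      finally have eq: "zp (Suc i) r = ?D * (yi i * Xi i) + X i * (zp i r * Xi i)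
          - sc dl * (zp (Suc i) (r + 1) * 1 * zp i (-1) * Xi i) + sc dl * (zp (Suc i) (r + 1) * e i * zp i (-1) * Xi i)"
        by (simp add: zp_m1 mult.assoc)
      have "absorbed i (?D * (yi i * Xi i))"
        unfolding zp_m1[symmetric] using 3 by (intro zzD IH) auto
      then show ?thesis
        unfolding eq by (intro absorbed_add absorbed_diff absorbed_smult XaXi main IH) (use 3 in auto)
    qed
  qed
  then show ?thesis by (simp add: eYe_def absorbed_def mult.assoc)
qed

subsection \<open>Powers of \<open>Y\<close>\<close>

text \<open>The relation for \<open>Y ^ k\<close> pushes an exponent leaving the window at the top
  back into it. Since \<open>qs 0\<close> is a unit, it can also be solved for its lowest power,
  which handles the bottom. The window is arbitrary: it starts at \<open>0\<close> for
  \<open>eYe\<close> and at the minimum of \<open>Pset k\<close> later.\<close>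

lemma zp1_span:
  "zp (Suc 0) p \<in> md.span {zp (Suc 0) s | s. lo \<le> s \<and> s < lo + int k}" (is "_ \<in> md.span ?S")
  if "1 \<le> n"
proof -
  have zY: "zp (Suc 0) (p + int m) = zp (Suc 0) p * Y ^ m" for p m
    using zp_add[of "Suc 0" p "int m"] that by (simp add: zp_nonneg yy_1)
  have k0: "zp (Suc 0) (p + int k) = (\<Sum>i<k. sc (qs i) * zp (Suc 0) (p + int i))" for p
    by (simp add: zY Y_pow sum_distrib_left zp_sc)
  have sub: "md.subspace (md.span ?S)" by simp
  have "zp (Suc 0) p * Y \<in> md.span ?S \<and> zp (Suc 0) p * Yi \<in> md.span ?S"
    if p: "lo \<le> p" "p < lo + int k" for p
  proof
    have Yp: "zp (Suc 0) p * Y = zp (Suc 0) (p + 1)"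
      using zp_add1[of "Suc 0" p] \<open>1 \<le> n\<close> by (simp add: yy_1)
    show "zp (Suc 0) p * Y \<in> md.span ?S"
    proof (cases "p + 1 = lo + int k")
      case True
      have "(\<Sum>i<k. sc (qs i) * zp (Suc 0) (lo + int i)) \<in> md.span ?S"
        by (intro md.span_sum md.span_scale md.span_base) auto
      then show ?thesis using True k0[of lo] Yp by simp
    next
      case False
      then show ?thesis unfolding Yp using p by (intro md.span_base) auto
    qed
    have Yq: "zp (Suc 0) p * Yi = zp (Suc 0) (p - 1)"
      using zp_sub1[of "Suc 0" p] \<open>1 \<le> n\<close> by (simp add: yi_1)
    show "zp (Suc 0) p * Yi \<in> md.span ?S"
    proof (cases "p = lo")
      case True
      obtain k' where k': "k = Suc k'" using k_pos by (cases k) auto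
      have "zp (Suc 0) (lo + int k') = sc (qs 0) * zp (Suc 0) (lo - 1) + (\<Sum>i<k'. sc (qs (Suc i)) * zp (Suc 0) (lo + int i))"
        using k0[of "lo - 1"] by (simp add: k' sum.lessThan_Suc_shift del: sum.lessThan_Suc)
      then have "sc q0i * (sc (qs 0) * zp (Suc 0) (lo - 1)) = sc q0i * (zp (Suc 0) (lo + int k')
          - (\<Sum>i<k'. sc (qs (Suc i)) * zp (Suc 0) (lo + int i)))"
        by (simp add: algebra_simps)
      moreover have "sc q0i * (sc (qs 0) * x) = x" for x
        using q0_inv by (simp add: mult.commute)
      moreover have "zp (Suc 0) (lo + int k') - (\<Sum>i<k'. sc (qs (Suc i)) * zp (Suc 0) (lo + int i)) \<in> md.span ?S"
        by (intro md.span_diff md.span_sum md.span_scale md.span_base) (auto simp: k')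
      ultimately show ?thesis
        using True Yq by (simp add: md.span_scale)
    next
      case False
      then show ?thesis unfolding Yq using p by (intro md.span_base) auto
    qed
  qed
  then have step: "x * Y \<in> md.span ?S" "x * Yi \<in> md.span ?S" if "x \<in> md.span ?S" for x
    using that by (auto elim!: span_multR)
  show ?thesis
  proof (induction p rule: int_induct[where k = lo])
    case base
    then show ?case using k_pos by (auto intro!: md.span_base)
  next
    case (step1 p)
    then show ?case using step(1)[of "zp (Suc 0) p"] zp_add1[of "Suc 0" p] \<open>1 \<le> n\<close> by (simp add: yy_1)
  next
    case (step2 p)
    then show ?case using step(2)[of "zp (Suc 0) p"] zp_sub1[of "Suc 0" p] \<open>1 \<le> n\<close> by (simp add: yi_1)
  qed
qed

text \<open>For \<open>i = 1\<close> the window \<open>0, ..., k - 1\<close> is the range in which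
  \<open>EYE\<close> evaluates \<open>e 1 * Y ^ m * e 1\<close>.\<close>

lemma eYe: "1 \<le> i \<Longrightarrow> i < n \<Longrightarrow> eYe i"
proof (induction i rule: dec_induct)
  case base
  have "{zp (Suc 0) s | s. 0 \<le> s \<and> s < 0 + int k} \<subseteq> {x. \<exists>z\<in>Bs 0. e 1 * x * e 1 = z * e 1}"
  proof clarsimp
    fix s assume "0 \<le> s" "s < int k"
    then obtain m where m: "s = int m" "m < k" by (metis nonneg_int_cases of_nat_less_iff)
    then show "\<exists>z\<in>Bs 0. e (Suc 0) * zp (Suc 0) s * e (Suc 0) = z * e (Suc 0)"
      using EYE[of m] base by (auto simp: zp_nonneg yy_1 mult.assoc intro!: bexI[OF _ Bs_sc])
  qed
  from md.span_minimal[OF this subspace_sandwich] show ?case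
    using zp1_span[of _ 0] base by (auto simp: eYe_def mult.assoc)
next
  case (step i)
  then show ?case by (simp add: eYe_step)
qed

lemma e_zp_e: "1 \<le> i \<Longrightarrow> i < n \<Longrightarrow> \<exists>z \<in> Bs (i - 1). e i * (zp i r * e i) = z * e i"
  using eYe by (simp add: eYe_def)

lemma X_zp_e: "1 \<le> i \<Longrightarrow> i < n \<Longrightarrow> X i * (zp i p * e i) \<in> md.span (Ye i p)"
  using X_zp_e_aux eYe by blast

lemma e_zp_X: "1 \<le> i \<Longrightarrow> i < n \<Longrightarrow>
    e i * (zp i p * X i) \<in> md.span {e i * (z * zp i t) | t z. \<bar>t\<bar> \<le> \<bar>p\<bar> \<and> z \<in> Bs (i - 1)}"
  using e_zp_X_aux eYe by blast

subsection \<open>The words \<open>X\<^sub>i \<dots> X\<^sub>j\<^sub>-\<^sub>1 e\<^sub>j \<dots> e\<^sub>l\<close>\<close>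

definition xs :: "nat \<Rightarrow> nat \<Rightarrow> 'b" where "xs i j = ev (map Xp [i..<j])"
definition es :: "nat \<Rightarrow> nat \<Rightarrow> 'b" where "es i j = ev (map E [i..<j])"
definition v :: "nat \<Rightarrow> nat \<Rightarrow> nat \<Rightarrow> 'b" where "v i j l = xs i j * es j (Suc l)"

lemma ev_alpha: "ev (alpha_w i j l p) = zp i p * v i j l"
  by (simp add: alpha_w_def zp_def v_def xs_def es_def ev_append)

lemma xs_Nil [simp]: "j \<le> i \<Longrightarrow> xs i j = 1" and es_Nil [simp]: "j \<le> i \<Longrightarrow> es i j = 1"
  by (simp_all add: xs_def es_def)

lemma xs_Cons: "i < j \<Longrightarrow> xs i j = X i * xs (Suc i) j"
  and es_Cons: "i < j \<Longrightarrow> es i j = e i * es (Suc i) j"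
  by (simp_all add: xs_def es_def upt_conv_Cons)

lemma xs_split: "i \<le> m \<Longrightarrow> m \<le> j \<Longrightarrow> xs i j = xs i m * xs m j"
  and es_split: "i \<le> m \<Longrightarrow> m \<le> j \<Longrightarrow> es i j = es i m * es m j"
  using upt_add_eq_append[of i m "j - m"] by (simp_all add: xs_def es_def ev_append[symmetric])

lemma xs_snoc: "i \<le> j \<Longrightarrow> xs i (Suc j) = xs i j * X j"
  and es_snoc: "i \<le> j \<Longrightarrow> es i (Suc j) = es i j * e j"
  by (simp_all add: xs_def es_def ev_append)

lemma v_Cons: "i < j \<Longrightarrow> v i j l = X i * v (Suc i) j l"
  by (simp add: v_def xs_Cons mult.assoc)

lemma v_Cons_e: "i \<le> l \<Longrightarrow> v i i l = e i * es (Suc i) (Suc l)"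
  by (simp add: v_def es_Cons)

lemma v_split: "i \<le> m \<Longrightarrow> m \<le> j \<Longrightarrow> v i j l = xs i m * v m j l"
  by (simp add: v_def xs_split[of i m j] mult.assoc)

lemma Bs_xs: "1 \<le> i \<Longrightarrow> j \<le> d \<Longrightarrow> xs i j \<in> Bs d"
  and Bs_es: "1 \<le> i \<Longrightarrow> j \<le> d \<Longrightarrow> es i j \<in> Bs d"
  unfolding xs_def es_def by (rule Bs_ev, auto simp: let_ok_def bmw_letter_def)+

lemma Bs_v: "1 \<le> i \<Longrightarrow> i \<le> j \<Longrightarrow> j \<le> d \<Longrightarrow> Suc l \<le> d \<Longrightarrow> v i j l \<in> Bs d"
  unfolding v_def by (intro Bs_mult Bs_xs Bs_es) auto

lemma ev_commute: "(\<And>g. g \<in> set w \<Longrightarrow> gn g * z = z * gn g) \<Longrightarrow> ev w * z = z * ev w"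
  by (induction w) (simp_all add: mult.assoc, metis mult.assoc)

lemma xs_Bs: "z \<in> Bs d \<Longrightarrow> d < i \<Longrightarrow> j \<le> n \<Longrightarrow> xs i j * z = z * xs i j"
  unfolding xs_def by (rule ev_commute) (auto intro: X_Bs)

lemma es_Bs: "z \<in> Bs d \<Longrightarrow> d < i \<Longrightarrow> j \<le> n \<Longrightarrow> es i j * z = z * es i j"
  unfolding es_def by (rule ev_commute) (auto intro: e_Bs)

lemma v_Bs: "z \<in> Bs d \<Longrightarrow> d < i \<Longrightarrow> i \<le> j \<Longrightarrow> j \<le> n \<Longrightarrow> l < n \<Longrightarrow> v i j l * z = z * v i j l"
  unfolding v_def using xs_Bs[of z d i j] es_Bs[of z d j "Suc l"]
  by (simp add: mult.assoc) (metis mult.assoc)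

section \<open>Moving single generators through \<open>v i j l\<close>\<close>

definition X_or_e :: "(nat \<Rightarrow> 'b) \<Rightarrow> bool" where "X_or_e g \<longleftrightarrow> g = X \<or> g = e"

lemma Bs_X_or_e: "X_or_e g \<Longrightarrow> 1 \<le> c \<Longrightarrow> c < d \<Longrightarrow> g c \<in> Bs d"
  by (auto simp: X_or_e_def Bs_X Bs_e)

lemma X_or_e_Bs: "X_or_e g \<Longrightarrow> z \<in> Bs d \<Longrightarrow> d < c \<Longrightarrow> c < n \<Longrightarrow> g c * z = z * g c"
  using X_Bs e_Bs by (auto simp: X_or_e_def)

lemma XE_XX: "X_or_e g \<Longrightarrow> adj i j \<Longrightarrow> g j * (X i * X j) = X i * (X j * g i)"
  using XXE_EXX[of i j] braid_adj[of i j] by (auto simp: X_or_e_def)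

text \<open>For \<open>j \<le> l\<close> the tangle \<open>v i j l\<close> has an arc at the top
  with ends \<open>i\<close> and \<open>j + 1\<close>. Strands from the bottom positions
  \<open>i, ..., j - 1\<close> arrive between the two ends and are shifted by one; those from
  \<open>j, ..., l - 1\<close> arrive to the right of both and are shifted by two, which is
  \<open>shift2\<close>.\<close>

lemma shift1:
  assumes g: "X_or_e g" and c: "1 \<le> i" "i \<le> c" "Suc c < j" "j \<le> Suc l" "l < n"
  shows "g (Suc c) * v i j l = v i j l * g c"
proof -
  have a: "adj c (Suc c)" using c by (simp add: adj_def)
  have v: "v i j l = xs i c * (X c * (X (Suc c) * v (Suc (Suc c)) j l))"
    using c by (simp add: v_split[of i c j] v_Cons[of c] v_Cons[of "Suc c"])
  have 1: "g (Suc c) * xs i c = xs i c * g (Suc c)"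
    by (rule X_or_e_Bs[OF g Bs_xs[OF _ order_refl]]) (use c in auto)
  have 2: "v (Suc (Suc c)) j l * g c = g c * v (Suc (Suc c)) j l"
    by (rule v_Bs[OF Bs_X_or_e[OF g, of c "Suc c"]]) (use c in auto)
  have "g (Suc c) * v i j l = xs i c * ((g (Suc c) * (X c * X (Suc c))) * v (Suc (Suc c)) j l)"
    using comm_left[OF 1] by (simp add: v mult.assoc)
  also have "\<dots> = v i j l * g c"
    unfolding XE_XX[OF g a] by (simp add: v 2 mult.assoc)
  finally show ?thesis .
qed

lemma shift2:
  assumes g: "X_or_e g" and c: "1 \<le> i" "i \<le> j" "j \<le> c" "Suc (Suc c) \<le> l" "l < n"
  shows "g (Suc (Suc c)) * v i j l = v i j l * g c"
proof -
  let ?c = "Suc (Suc c)"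
  have a: "adj ?c (Suc c)" "adj c (Suc c)" using c by (auto simp: adj_def)
  let ?z = "xs i j * es j c" and ?w = "es (Suc ?c) (Suc l)"
  have v: "v i j l = ?z * (e c * (e (Suc c) * (e ?c * ?w)))"
    using c by (simp add: v_def es_split[of j c "Suc l"] es_Cons[of c "Suc l"] es_Cons[of "Suc c" "Suc l"] es_Cons[of ?c "Suc l"] mult.assoc)
  have "?z \<in> Bs c" by (intro Bs_mult Bs_xs Bs_es) (use c in auto)
  then have 1: "g ?c * ?z = ?z * g ?c"
    by (rule X_or_e_Bs[OF g]) (use c in auto)
  have 2: "?w * g c = g c * ?w"
    by (rule es_Bs[OF Bs_X_or_e[OF g, of c "Suc c"]]) (use c in auto)
  have ee: "e ?c * e c = e c * e ?c" using e_far c by auto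
  have 3: "g ?c * (e c * (e (Suc c) * e ?c)) = e c * (e (Suc c) * (e ?c * g c))"
    using g unfolding X_or_e_def
  proof
    assume g: "g = X"
    have "X ?c * (e c * (e (Suc c) * e ?c)) = e c * (X ?c * (e (Suc c) * e ?c))"
      by (rule comm_left) (use XE_far c in auto)
    also have "\<dots> = (e c * Xi (Suc c)) * e ?c"
      by (simp add: XEE_adj[OF a(1)] mult.assoc)
    also have "\<dots> = e c * (e (Suc c) * (X c * e ?c))"
      by (simp add: EXi_adj[OF a(2)] mult.assoc)
    also have "X c * e ?c = e ?c * X c" using XE_far c by auto
    finally show ?thesis by (simp add: g)
  next
    assume g: "g = e"
    have "e ?c * (e c * (e (Suc c) * e ?c)) = e c * e ?c"
      by (simp add: comm_left[OF ee] EEEa[OF a(1)])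
    moreover have "e c * (e (Suc c) * (e ?c * e c)) = e c * e ?c"
      by (simp add: ee EEEz[OF a(2)])
    ultimately show ?thesis by (simp add: g)
  qed
  have "g ?c * v i j l = ?z * ((g ?c * (e c * (e (Suc c) * e ?c))) * ?w)"
    using comm_left[OF 1] by (simp add: v mult.assoc)
  also have "\<dots> = v i j l * g c"
    unfolding 3 by (simp add: v 2 mult.assoc)
  finally show ?thesis .
qed

text \<open>The case between \<open>shift1\<close> and \<open>shift2\<close> in which the generator
  touches the right end of the arc and the strand on its left: the crossing cancels the last one of
  the arc.\<close>

lemma X_v_at:
  assumes c: "1 \<le> i" "i \<le> c" "Suc c \<le> l" "l < n"
  shows "X (Suc c) * v i (Suc c) l = v i c l"
    and "e (Suc c) * v i (Suc c) l = sc lami * (v (Suc c) (Suc c) l * xs i c)"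
proof -
  have a: "adj (Suc c) c" using c by (simp add: adj_def)
  have v: "v i (Suc c) l = xs i c * (X c * (e (Suc c) * es (Suc (Suc c)) (Suc l)))"
    using c by (simp add: v_def xs_snoc es_Cons mult.assoc)
  have B: "xs i c \<in> Bs c" using c by (intro Bs_xs) auto
  have 1: "X (Suc c) * xs i c = xs i c * X (Suc c)" "e (Suc c) * xs i c = xs i c * e (Suc c)"
    using X_Bs[OF B, of "Suc c"] e_Bs[OF B, of "Suc c"] c by auto
  have 2: "v (Suc c) (Suc c) l * xs i c = xs i c * v (Suc c) (Suc c) l"
    by (rule v_Bs[OF B]) (use c in auto)
  have "X (Suc c) * v i (Suc c) l = xs i c * ((X (Suc c) * (X c * e (Suc c))) * es (Suc (Suc c)) (Suc l))"
    using comm_left[OF 1(1)] by (simp add: v mult.assoc)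
  also have "\<dots> = v i c l"
    unfolding XXEa[OF a] using c by (simp add: v_def es_Cons mult.assoc)
  finally show "X (Suc c) * v i (Suc c) l = v i c l" .
  have "e (Suc c) * v i (Suc c) l = xs i c * ((e (Suc c) * (X c * e (Suc c))) * es (Suc (Suc c)) (Suc l))"
    using comm_left[OF 1(2)] by (simp add: v mult.assoc)
  also have "\<dots> = sc lami * (xs i c * v (Suc c) (Suc c) l)"
    unfolding EXE_adj[OF a] using c by (simp add: v_Cons_e mult.assoc mult_sc)
  finally show "e (Suc c) * v i (Suc c) l = sc lami * (v (Suc c) (Suc c) l * xs i c)"
    by (simp add: 2)
qed

text \<open>Here the generator touches the right end of the arc and the strand on its right.
  \<open>XEE_adj\<close> produces a crossing of the wrong sign, and the skein relation for it gives
  the three terms.\<close>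

lemma X_v_next:
  assumes c: "1 \<le> i" "i \<le> j" "Suc j \<le> l" "l < n"
  shows "X (Suc j) * v i j l = v i (Suc j) l - sc dl * (v (Suc j) (Suc j) l * xs i j) + sc dl * v i j l"
    and "e (Suc j) * v i j l = v (Suc j) (Suc j) l * xs i j"
proof -
  have a: "adj (Suc j) j" using c by (simp add: adj_def)
  have v: "v i j l = xs i j * (e j * (e (Suc j) * es (Suc (Suc j)) (Suc l)))"
    using c by (simp add: v_def es_Cons mult.assoc)
  have B: "xs i j \<in> Bs j" using c by (intro Bs_xs) auto
  have 1: "X (Suc j) * xs i j = xs i j * X (Suc j)" "e (Suc j) * xs i j = xs i j * e (Suc j)"
    using X_Bs[OF B, of "Suc j"] e_Bs[OF B, of "Suc j"] c by auto
  have 2: "v (Suc j) (Suc j) l * xs i j = xs i j * v (Suc j) (Suc j) l"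
    by (rule v_Bs[OF B]) (use c in auto)
  have "X (Suc j) * v i j l = xs i j * ((X (Suc j) * (e j * e (Suc j))) * es (Suc (Suc j)) (Suc l))"
    using comm_left[OF 1(1)] by (simp add: v mult.assoc)
  also have "\<dots> = xs i j * (Xi j * v (Suc j) (Suc j) l)"
    unfolding XEE_adj[OF a] using c by (simp add: v_Cons_e mult.assoc)
  also have "\<dots> = xs i j * ((X j - sc dl * 1 + sc dl * e j) * v (Suc j) (Suc j) l)"
    using Xi_eq[of j] c by simp
  also have "\<dots> = xs i j * (X j * v (Suc j) (Suc j) l) - sc dl * (xs i j * v (Suc j) (Suc j) l)
      + sc dl * (xs i j * (e j * v (Suc j) (Suc j) l))"
    by (simp add: ring_distribs mult.assoc mult_sc)
  also have "xs i j * (X j * v (Suc j) (Suc j) l) = v i (Suc j) l"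
    using c by (simp add: v_def xs_snoc mult.assoc)
  also have "xs i j * (e j * v (Suc j) (Suc j) l) = v i j l"
    using c by (simp add: v v_Cons_e)
  finally show "X (Suc j) * v i j l = v i (Suc j) l - sc dl * (v (Suc j) (Suc j) l * xs i j) + sc dl * v i j l"
    by (simp add: 2)
  have "e (Suc j) * v i j l = xs i j * ((e (Suc j) * (e j * e (Suc j))) * es (Suc (Suc j)) (Suc l))"
    using comm_left[OF 1(2)] by (simp add: v mult.assoc)
  also have "\<dots> = xs i j * v (Suc j) (Suc j) l"
    unfolding EEEa[OF a] using c by (simp add: v_Cons_e)
  finally show "e (Suc j) * v i j l = v (Suc j) (Suc j) l * xs i j"
    by (simp add: 2)
qed

text \<open>By \<open>EX_adj\<close> the first crossing of \<open>v (Suc i) j l\<close> becomes a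
  hook and an inverse crossing \<open>Xi i\<close>, which can be moved to the far right. The indices
  of these crossings are recorded because \<open>swap\<close> needs them bounded below by
  \<open>i\<close>.\<close>

lemma e_v:
  assumes "1 \<le> i" "Suc i \<le> j" "j \<le> Suc l" "l < n"
  shows "\<exists>cs. set cs \<subseteq> {i..<j - 1} \<and> e i * v (Suc i) j l = v i i l * ev (map Xm cs)"
  using assms
proof (induction "j - i" arbitrary: i)
  case 0
  then show ?case by simp
next
  case (Suc m)
  show ?case
  proof (cases "j = Suc i")
    case True
    then show ?thesis
      using Suc.prems by (intro exI[of _ "[]"]) (simp add: v_Cons_e v_def[of "Suc i"])
  next
    case False
    then have j: "Suc (Suc i) \<le> j" using Suc.prems by simp
    then have a: "adj i (Suc i)" using Suc.prems by (simp add: adj_def)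
    have "m = j - Suc i" using Suc.hyps(2) by linarith
    then obtain cs where cs: "set cs \<subseteq> {Suc i..<j - 1}"
      "e (Suc i) * v (Suc (Suc i)) j l = v (Suc i) (Suc i) l * ev (map Xm cs)"
      using Suc.hyps(1)[of "Suc i"] Suc.prems j by auto
    have c: "v (Suc (Suc i)) j l * Xi i = Xi i * v (Suc (Suc i)) j l"
      by (rule v_Bs[OF Bs_Xi[of i "Suc i"]]) (use j Suc.prems in auto)
    have "e i * v (Suc i) j l = e i * X (Suc i) * v (Suc (Suc i)) j l"
      using j by (simp add: v_Cons mult.assoc)
    also have "\<dots> = e i * (e (Suc i) * (v (Suc (Suc i)) j l * Xi i))"
      unfolding EX_adj[OF a] by (simp add: c mult.assoc)
    also have "\<dots> = e i * ((e (Suc i) * v (Suc (Suc i)) j l) * Xi i)"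
      by (simp add: mult.assoc)
    also have "\<dots> = v i i l * ev (map Xm (cs @ [i]))"
      unfolding cs(2) using j Suc.prems by (simp add: v_def es_Cons[of i] ev_append mult.assoc)
    finally show ?thesis
      using cs(1) j by (intro exI[of _ "cs @ [i]"]) auto
  qed
qed

lemma Bs_ev_Xm: "set cs \<subseteq> {i..<j} \<Longrightarrow> 1 \<le> i \<Longrightarrow> j \<le> d \<Longrightarrow> ev (map Xm cs) \<in> Bs d"
  by (rule Bs_ev) (auto simp: let_ok_def bmw_letter_def)

lemma e_v_Bs:
  assumes "1 \<le> i" "Suc i \<le> j" "j \<le> Suc l" "l < n"
  shows "\<exists>y \<in> Bs (j - 1). e i * v (Suc i) j l = v i i l * y"
  using e_v[OF assms] Bs_ev_Xm assms by (metis order_refl)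

subsection \<open>Left multiplication by generators\<close>

text \<open>The predicate \<open>A\<close> is a parameter so that statements can tell which first
  indices and exponents a multiplication produces; \<open>y\<close> plays the role of a right
  coefficient.\<close>

definition Sg :: "nat \<Rightarrow> nat \<Rightarrow> (nat \<Rightarrow> int \<Rightarrow> bool) \<Rightarrow> 'b set" where
  "Sg l d A = {zp i p * (v i j l * y) | i j p y. A i p \<and> 1 \<le> i \<and> i \<le> j \<and> j \<le> Suc d \<and> y \<in> Bs d}"

abbreviation "Sp l d A \<equiv> md.span (Sg l d A)"

lemma SpI: "A i p \<Longrightarrow> 1 \<le> i \<Longrightarrow> i \<le> j \<Longrightarrow> j \<le> Suc d \<Longrightarrow> y \<in> Bs d \<Longrightarrow> zp i p * (v i j l * y) \<in> Sp l d A"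
  unfolding Sg_def by (rule md.span_base) blast

lemma SpI0: "A i 0 \<Longrightarrow> 1 \<le> i \<Longrightarrow> i \<le> j \<Longrightarrow> j \<le> Suc d \<Longrightarrow> y \<in> Bs d \<Longrightarrow> v i j l * y \<in> Sp l d A"
  using SpI[of A i 0 j d y l] by simp

lemma Sp_mono: "x \<in> Sp l d A \<Longrightarrow> (\<And>i p. 1 \<le> i \<Longrightarrow> i \<le> Suc d \<Longrightarrow> A i p \<Longrightarrow> A' i p) \<Longrightarrow> x \<in> Sp l d A'"
proof (erule span_subsetI)
  fix s assume A: "\<And>i p. 1 \<le> i \<Longrightarrow> i \<le> Suc d \<Longrightarrow> A i p \<Longrightarrow> A' i p" and "s \<in> Sg l d A"
  then obtain i j p y where "s = zp i p * (v i j l * y)" "A i p" "1 \<le> i" "i \<le> j" "j \<le> Suc d" "y \<in> Bs d"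
    unfolding Sg_def by blast
  then show "s \<in> Sp l d A'" using A by (auto intro!: SpI)
qed

text \<open>The next four lemmas distinguish the position of \<open>c\<close> relative to \<open>i\<close>. The bounds on the
  exponents are what keeps them in \<open>Pset k\<close> later.\<close>

lemma gen_hi:
  assumes g: "X_or_e g" and c: "1 \<le> i" "i \<le> j" "j \<le> Suc d" "i < c" "c \<le> l" "l < n" "l \<le> Suc d" "d \<le> l"
    and y: "y \<in> Bs d"
  shows "g c * (zp i p * (v i j l * y)) \<in> Sp l d (\<lambda>i' p'. i' = i \<and> p' = p \<or> i' = c \<and> p' = 0)"
    (is "_ \<in> ?S")
proof -
  have z: "g c * zp i p = zp i p * g c"
    by (rule X_or_e_Bs[OF g Bs_zp]) (use c in auto)
  have eq: "g c * (zp i p * (v i j l * y)) = zp i p * ((g c * v i j l) * y)"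
    using comm_left[OF z] by (simp add: mult.assoc)
  have A: "zp i p * (v i j' l * u) \<in> ?S" if "i \<le> j'" "j' \<le> Suc d" "u \<in> Bs d" for j' u
    using that c by (intro SpI) auto
  have C: "zp i p * (v c c l * u) \<in> ?S" if "u \<in> Bs d" for u
  proof -
    have "v c c l * zp i p = zp i p * v c c l"
      by (rule v_Bs[OF Bs_zp]) (use c in auto)
    then have "zp i p * (v c c l * u) = v c c l * (zp i p * u)"
      by (simp flip: mult.assoc)
    moreover have "v c c l * (zp i p * u) \<in> ?S"
      using c that by (intro SpI0 Bs_mult Bs_zp') auto
    ultimately show ?thesis by simp
  qed
  consider (1) "c < j" | (2) "c = j" | (3) "c = Suc j" | (4) "Suc j < c" by linarith
  then show ?thesis
  proof cases
    case 1
    obtain c' where c': "c = Suc c'" using c by (cases c) auto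
    show ?thesis
    proof -
      have "g c * v i j l = v i j l * g c'" using shift1[OF g, of i c' j l] 1 c c' by simp
      moreover have "g c' \<in> Bs d" by (rule Bs_X_or_e[OF g]) (use c c' 1 in auto)
      ultimately show ?thesis
        unfolding eq using c y by (auto simp: mult.assoc intro!: A Bs_mult)
    qed
  next
    case 2
    obtain c' where c': "c = Suc c'" using c by (cases c) auto
    have "xs i c' \<in> Bs d" using c c' by (intro Bs_xs) auto
    then have "zp i p * (v c c l * (xs i c' * y)) \<in> ?S"
      using y by (intro C Bs_mult)
    then have "zp i p * ((sc lami * (v c c l * xs i c')) * y) \<in> ?S"
      using md.span_scale[of _ _ lami] by (simp add: nc)
    moreover have "zp i p * (v i c' l * y) \<in> ?S"
      using c c' 2 y by (intro A) auto
    moreover have "X c * v i j l = v i c' l" "e c * v i j l = sc lami * (v c c l * xs i c')"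
      using X_v_at[of i c' l] c c' 2 by auto
    ultimately show ?thesis
      using g unfolding eq X_or_e_def by auto
  next
    case 3
    have x: "xs i j \<in> Bs d" using c 3 by (intro Bs_xs) auto
    have "X c * v i j l = v i c l - sc dl * (v c c l * xs i j) + sc dl * v i j l"
      using X_v_next(1)[of i j l] c 3 by simp
    then have "zp i p * ((X c * v i j l) * y) = zp i p * (v i c l * y)
        - sc dl * (zp i p * (v c c l * (xs i j * y))) + sc dl * (zp i p * (v i j l * y))"
      by (simp add: nc)
    moreover have "zp i p * (v i c l * y) - sc dl * (zp i p * (v c c l * (xs i j * y)))
         + sc dl * (zp i p * (v i j l * y)) \<in> ?S"
      using c 3 x y by (intro md.span_add md.span_diff md.span_scale A C Bs_mult) auto
    moreover have "zp i p * ((e c * v i j l) * y) \<in> ?S"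
      using X_v_next(2)[of i j l] c 3 x y C[of "xs i j * y"] by (simp add: mult.assoc Bs_mult)
    ultimately show ?thesis
      using g unfolding eq X_or_e_def by auto
  next
    case 4
    have "c = Suc (Suc (c - 2))" using 4 by simp
    then obtain c' where c': "c = Suc (Suc c')" by blast
    have "g c * v i j l = v i j l * g c'"
      using shift2[OF g, of i j c' l] 4 c c' by simp
    moreover have "g c' \<in> Bs d"
      by (rule Bs_X_or_e[OF g]) (use c c' 4 in auto)
    ultimately show ?thesis
      unfolding eq using c y by (auto simp: mult.assoc intro!: A Bs_mult)
  qed
qed

lemma X_sq: "1 \<le> i \<Longrightarrow> i < n \<Longrightarrow> X i * (X i * u) = u + sc dl * (X i * u) - sc dl * (sc lam * (e i * u))"
proof -
  assume i: "1 \<le> i" "i < n"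
  have "X i * (X i * u) = (Xi i + sc dl * 1 - sc dl * e i) * (X i * u)"
    using X_eq[OF i] by simp
  also have "\<dots> = u + sc dl * (X i * u) - sc dl * ((e i * X i) * u)"
    using i by (simp add: ring_distribs mult.assoc Xi_X_cancel)
  finally show ?thesis using i by (simp add: EX mult.assoc)
qed

lemma gen_eq:
  assumes g: "X_or_e g" and c: "1 \<le> i" "i \<le> j" "j \<le> Suc d" "i \<le> l" "l < n" "l \<le> Suc d" "d \<le> l"
    and y: "y \<in> Bs d"
  shows "g i * (zp i p * (v i j l * y)) \<in>
    Sp l d (\<lambda>i' p'. i' = Suc i \<and> btw p p' \<or> i' = i \<and> \<bar>p'\<bar> \<le> \<bar>p\<bar>)" (is "_ \<in> ?S")
proof -
  have i: "1 \<le> i" "i < n" using c by auto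
  have Bm: "z \<in> Bs d" if "z \<in> Bs (i - 1)" for z using Bs_mono[OF that] c by simp
  have I: "zp i t * (v i j' l * u) \<in> ?S" if "\<bar>t\<bar> \<le> \<bar>p\<bar>" "i \<le> j'" "j' \<le> Suc d" "u \<in> Bs d" for t j' u
    using that c by (intro SpI) auto
  show ?thesis
  proof (cases "j = i")
    case True
    let ?w = "es (Suc i) (Suc l) * y"
    have vz: "v i i l * z = z * v i i l" if "z \<in> Bs (i - 1)" for z
      by (rule v_Bs[OF that]) (use c in auto)
    have ez: "zp i t * ((z * e i) * ?w) \<in> ?S" if "z \<in> Bs (i - 1)" "\<bar>t\<bar> \<le> \<bar>p\<bar>" for z t
    proof -
      have "(z * e i) * ?w = (z * v i i l) * y" using c by (simp add: v_Cons_e mult.assoc)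
      also have "\<dots> = v i i l * (z * y)" by (simp add: vz[OF that(1), symmetric] mult.assoc)
      finally show ?thesis using I[of t i "z * y"] that c y Bm by (simp add: Bs_mult)
    qed
    have eq: "g i * (zp i p * (v i j l * y)) = (g i * (zp i p * e i)) * ?w"
      using c True by (simp add: v_Cons_e mult.assoc)
    show ?thesis using g unfolding X_or_e_def
    proof
      assume g: "g = X"
      show ?thesis unfolding eq unfolding g
        by (rule span_multR[OF X_zp_e[OF i]]) (use ez in \<open>auto simp: Ye_def mult.assoc\<close>)
    next
      assume g: "g = e"
      obtain z where "z \<in> Bs (i - 1)" "e i * (zp i p * e i) = z * e i" using e_zp_e[OF i] by blast
      then show ?thesis unfolding eq unfolding g using ez[of z 0] by simp
    qed
  next
    case False
    then have j: "i < j" using c by simp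
    let ?w = "v (Suc i) j l"
    have v: "v i j l = X i * ?w" using j by (rule v_Cons)
    have wz: "?w * z = z * ?w" if "z \<in> Bs i" for z
      by (rule v_Bs[OF that]) (use c j in auto)
    have Bi: "z \<in> Bs d" if "z \<in> Bs i" for z using Bs_mono[OF that] c j by simp
    have i1: "z \<in> Bs i" if "z \<in> Bs (i - 1)" for z using Bs_mono[OF that] by simp
    have zB: "zp i t \<in> Bs i" for t using Bs_zp c by simp
    obtain y0 where y0: "y0 \<in> Bs (j - 1)" "e i * ?w = v i i l * y0"
      using e_v_Bs[of i j l] c j by auto
    then have y0d: "y0 \<in> Bs d" using Bs_mono[OF y0(1)] c by simp
    have ew: "zp i t * (e i * (?w * u)) \<in> ?S" if "\<bar>t\<bar> \<le> \<bar>p\<bar>" "u \<in> Bs d" for t u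
    proof -
      have "e i * (?w * u) = v i i l * (y0 * u)" using y0(2) by (simp flip: mult.assoc)
      then show ?thesis using I[of t i "y0 * u"] that c y0d by (simp add: Bs_mult)
    qed
    have ezw: "zp i t * (e i * (z * (?w * u))) \<in> ?S" if "\<bar>t\<bar> \<le> \<bar>p\<bar>" "z \<in> Bs i" "u \<in> Bs d" for t z u
      using ew[of t "z * u"] that Bi wz[of z] by (simp add: Bs_mult comm_left[of z ?w])
    have bw: "zp (Suc i) t * (?w * u) \<in> ?S" if "btw p t" "u \<in> Bs d" for t u
      using that c j by (intro SpI) auto
    have eX: "zp i t * (e i * (zp i r * (X i * (?w * u)))) \<in> ?S" if "\<bar>t\<bar> \<le> \<bar>p\<bar>" "u \<in> Bs d" for t r u
    proof -
      have "zp i t * (e i * (zp i r * X i)) * (?w * u) \<in> ?S"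
      proof (rule span_mult2[OF e_zp_X[OF i]])
        fix x assume "x \<in> {e i * (z * zp i t) |t z. \<bar>t\<bar> \<le> \<bar>r\<bar> \<and> z \<in> Bs (i - 1)}"
        then obtain s z where x: "x = e i * (z * zp i s)" "z \<in> Bs (i - 1)" by blast
        then have "z * zp i s \<in> Bs i" using i1 zB by (intro Bs_mult)
        then show "zp i t * x * (?w * u) \<in> ?S"
          using ezw[OF that(1) _ that(2), of "z * zp i s"] by (simp add: x(1) mult.assoc)
      qed
      then show ?thesis by (simp add: mult.assoc)
    qed
    \<comment> \<open>Brings \<open>X i\<close> back to the left of the powers, where it rebuilds
      \<open>v i j l\<close>. In the corrections \<open>e i\<close> turns
      \<open>zp (Suc i) t\<close> into \<open>zp i (- t)\<close>, so that the exponents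
      \<open>r - t\<close> of \<open>rt\<close> arise.\<close>
    have L3: "zp i r * (zp (Suc i) s * (X i * (?w * u))) \<in> ?S"
      if s: "btw p s" and r: "\<bar>r\<bar> \<le> \<bar>p\<bar>" and rt: "\<And>t. btw s t \<Longrightarrow> \<bar>r - t\<bar> \<le> \<bar>p\<bar>" and u: "u \<in> Bs d" for r s u
    proof -
      let ?D = "zp (Suc i) s * X i - X i * zp i s"
      have "zp i s * (?w * u) = ?w * (zp i s * u)"
        by (rule comm_left) (simp add: wz zB)
      then have eq: "zp i r * (zp (Suc i) s * (X i * (?w * u)))
          = zp i r * ?D * (?w * u) + zp i r * (v i j l * (zp i s * u))"
        by (simp add: ring_distribs mult.assoc v)
      have "zp i r * ?D * (?w * u) \<in> ?S"
      proof (rule span_mult2[OF zpS_X[OF i]])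
        fix x assume "x \<in> mids' i s"
        then obtain t m where x: "x = zp (Suc i) t * m * zp i (s - t)" "btw s t" "m = 1 \<or> m = e i"
          by (auto simp: mids'_def dest: sbtw_btw)
        have pt: "btw p t" using x(2) s by (auto simp: btw_def)
        show "zp i r * x * (?w * u) \<in> ?S"
        proof (cases "m = 1")
          case True
          have "zp i r * x * (?w * u) = (zp i r * zp (Suc i) t) * (zp i (s - t) * (?w * u))"
            by (simp add: x(1) True mult.assoc)
          also have "\<dots> = zp (Suc i) t * ((zp i r * zp i (s - t)) * (?w * u))"
            by (simp only: zp_zpS[OF i] mult.assoc)
          also have "(zp i r * zp i (s - t)) * (?w * u) = ?w * (zp i r * zp i (s - t) * u)"
            by (rule comm_left) (simp add: wz zB Bs_mult)
          finally show ?thesis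
            using bw[OF pt, of "zp i r * zp i (s - t) * u"] u by (simp add: Bs_mult Bi zB)
        next
          case False
          then have "zp i r * x * (?w * u) = zp i r * ((zp (Suc i) t * e i) * (zp i (s - t) * (?w * u)))"
            using x(3) by (simp add: x(1) mult.assoc)
          also have "\<dots> = (zp i r * zp i (- t)) * (e i * (zp i (s - t) * (?w * u)))"
            by (simp only: zpS_e[OF i] mult.assoc)
          also have "zp i r * zp i (- t) = zp i (r - t)"
            using zp_add[of i r "- t"] i by simp
          finally show ?thesis
            using ezw[OF rt[OF x(2)] zB u] by simp
        qed
      qed
      moreover have "zp i r * (v i j l * (zp i s * u)) \<in> ?S"
        using c by (intro I[OF r _ _ Bs_mult[OF Bi[OF zB] u]]) auto
      ultimately show ?thesis unfolding eq by (intro md.span_add)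
    qed
    show ?thesis using g unfolding X_or_e_def
    proof
      assume g: "g = e"
      show ?thesis
        using eX[of 0 y p] y by (simp add: g v mult.assoc)
    next
      assume g: "g = X"
      let ?D = "zp (Suc i) p * X i - X i * zp i p"
      let ?u = "X i * (?w * y)"
      \<comment> \<open>\<open>X i\<close> is carried past \<open>zp i p\<close>, so that it meets
        the crossing at the head of \<open>v i j l\<close> and \<open>X_sq\<close> removes the
        square.\<close>
      have "g i * (zp i p * (v i j l * y)) = zp (Suc i) p * (X i * (X i * (?w * y))) - ?D * (X i * (?w * y))"
        by (simp add: g v ring_distribs mult.assoc)
      also have "\<dots> = zp (Suc i) p * (?w * y) + sc dl * (zp i 0 * (zp (Suc i) p * ?u))
          - sc dl * (sc lam * ((zp (Suc i) p * e i) * (?w * y))) - ?D * ?u"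
        unfolding X_sq[OF i] by (simp add: ring_distribs zp_sc mult.assoc)
      also have "\<dots> \<in> ?S"
      proof (intro md.span_add md.span_diff md.span_scale)
        show "zp (Suc i) p * (?w * y) \<in> ?S" using y by (intro bw) (auto simp: btw_def)
        show "zp i 0 * (zp (Suc i) p * ?u) \<in> ?S"
          using y by (intro L3) (auto simp: btw_def)
        show "zp (Suc i) p * e i * (?w * y) \<in> ?S"
          unfolding zpS_e[OF i] using ew[of "- p" y] y by (simp add: mult.assoc)
        show "?D * ?u \<in> ?S"
        proof (rule span_multR[OF zpS_X[OF i]])
          fix x assume "x \<in> mids' i p"
          then obtain s m where x: "x = zp (Suc i) s * m * zp i (p - s)" "btw p s" "m = 1 \<or> m = e i"
            by (auto simp: mids'_def dest: sbtw_btw)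
          show "x * ?u \<in> ?S"
          proof (cases "m = 1")
            case True
            have "x * ?u = zp i (p - s) * (zp (Suc i) s * ?u)"
              using comm_left[OF zp_zpS[OF i]] by (simp add: x(1) True mult.assoc)
            also have "\<dots> \<in> ?S" using x(2) y by (intro L3) (auto simp: btw_def)
            finally show ?thesis .
          next
            case False
            then have "x * ?u = (zp (Suc i) s * e i) * (zp i (p - s) * ?u)"
              using x(3) by (simp add: x(1) mult.assoc)
            also have "\<dots> = zp i (- s) * (e i * (zp i (p - s) * ?u))"
              by (simp only: zpS_e[OF i] mult.assoc)
            also have "\<dots> \<in> ?S" using x(2) y by (intro eX) (auto simp: btw_def)
            finally show ?thesis .
          qed
        qed
      qed
      finally show ?thesis .
    qed
  qed
qed

lemma gen_lo:
  assumes g: "X_or_e g" and c: "1 \<le> i" "Suc i \<le> j" "j \<le> Suc d" "l < n" "d \<le> l"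
    and y: "y \<in> Bs d"
  shows "g i * (zp (Suc i) p * (v (Suc i) j l * y)) \<in>
    Sp l d (\<lambda>i' p'. i' = Suc i \<and> btw p p' \<or> i' = i \<and> \<bar>p'\<bar> \<le> \<bar>p\<bar>)" (is "_ \<in> ?S")
proof -
  have i: "1 \<le> i" "i < n" using c by auto
  let ?w = "v (Suc i) j l"
  have v: "v i j l = X i * ?w" using c by (intro v_Cons) auto
  have wz: "?w * z = z * ?w" if "z \<in> Bs i" for z
    by (rule v_Bs[OF that]) (use c in auto)
  have zB: "zp i t \<in> Bs i" "zp i t \<in> Bs d" for t using Bs_zp[of i] Bs_zp'[of i d] c by auto
  obtain y0 where y0: "y0 \<in> Bs (j - 1)" "e i * ?w = v i i l * y0"
    using e_v_Bs[of i j l] c by auto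
  then have y0d: "y0 \<in> Bs d" using Bs_mono[OF y0(1)] c by simp
  have ew: "zp i t * (e i * (zp i s * (?w * y))) \<in> ?S" if "\<bar>t\<bar> \<le> \<bar>p\<bar>" for t s
  proof -
    have "e i * (zp i s * (?w * y)) = (e i * ?w) * (zp i s * y)"
      using comm_left[OF wz[OF zB(1)], symmetric] by (simp add: mult.assoc)
    also have "\<dots> = v i i l * (y0 * (zp i s * y))" by (simp add: y0 mult.assoc)
    finally show ?thesis using that c y0d y zB by (auto intro!: SpI Bs_mult)
  qed
  show ?thesis using g unfolding X_or_e_def
  proof
    assume g: "g = e"
    have "e i * (zp (Suc i) p * (?w * y)) = zp i 0 * (e i * (zp i (- p) * (?w * y)))"
      using e_zpS[OF i, of p] by (simp flip: mult.assoc)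
    then show ?thesis using ew[of 0] by (simp add: g)
  next
    assume g: "g = X"
    let ?D = "X i * zp (Suc i) p - zp i p * X i"
    have eq: "g i * (zp (Suc i) p * (?w * y)) = ?D * (?w * y) + zp i p * (v i j l * y)"
      by (simp add: g v ring_distribs mult.assoc)
    have "?D * (?w * y) \<in> ?S"
    proof (rule span_multR[OF X_zpS[OF i]])
      fix x assume "x \<in> mids i p"
      then obtain s m where x: "x = zp i (p - s) * m * zp (Suc i) s" "btw p s" "m = 1 \<or> m = e i"
        by (auto simp: mids_def dest: sbtw_btw)
      show "x * (?w * y) \<in> ?S"
      proof (cases "m = 1")
        case True
        have "x * (?w * y) = zp (Suc i) s * (zp i (p - s) * (?w * y))"
          using comm_left[OF zp_zpS[OF i]] by (simp add: x(1) True mult.assoc)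
        also have "zp i (p - s) * (?w * y) = ?w * (zp i (p - s) * y)"
          by (rule comm_left) (simp add: wz zB)
        finally show ?thesis using x(2) c y zB by (auto intro!: SpI Bs_mult)
      next
        case False
        then have "x * (?w * y) = zp i (p - s) * ((e i * zp (Suc i) s) * (?w * y))"
          using x(3) by (simp add: x(1) mult.assoc)
        also have "\<dots> = zp i (p - s) * (e i * (zp i (- s) * (?w * y)))"
          by (simp only: e_zpS[OF i] mult.assoc)
        also have "\<dots> \<in> ?S" using x(2) by (intro ew) (auto simp: btw_def)
        finally show ?thesis .
      qed
    qed
    moreover have "zp i p * (v i j l * y) \<in> ?S" using c y by (auto intro!: SpI)
    ultimately show ?thesis unfolding eq by (rule md.span_add)
  qed
qed

lemma gen_far:
  assumes z: "z \<in> Bs c" and c: "c < i" "i \<le> j" "j \<le> Suc d" "l < n" "d \<le> l"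
    and y: "y \<in> Bs d" and A: "A i p"
  shows "z * (zp i p * (v i j l * y)) \<in> Sp l d A"
proof -
  have "z * (zp i p * (v i j l * y)) = zp i p * (z * (v i j l * y))"
    by (rule comm_left[OF zp_Bs[OF z]]) (use c in auto)
  also have "z * (v i j l * y) = v i j l * (z * y)"
    by (rule comm_left[OF v_Bs[OF z, symmetric]]) (use c in auto)
  finally show ?thesis
    using Bs_mono[OF z, of d] c y A by (auto intro!: SpI Bs_mult)
qed

subsection \<open>Spanning \<open>Bs (Suc l)\<close> over \<open>Bs l\<close>\<close>

lemma Pset_0: "0 \<in> Pset k"
  using k_pos by (auto simp: Pset_def)

lemma Pset_btw: "p \<in> Pset k \<Longrightarrow> btw p s \<Longrightarrow> s \<in> Pset k"
  using k_pos by (auto simp: Pset_def btw_def)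

lemma Pset_small: "\<bar>p\<bar> \<le> (int k - 1) div 2 \<Longrightarrow> p \<in> Pset k"
  using k_pos unfolding Pset_def by (auto simp: zdiv_int)

lemma Pset_sbtw: "p \<in> Pset k \<Longrightarrow> sbtw p s \<Longrightarrow> \<bar>p - s\<bar> \<le> (int k - 1) div 2"
  using k_pos unfolding Pset_def sbtw_def by (auto simp: zdiv_int)

lemma Bs_closed:
  assumes "z \<in> Bs D" "D \<le> n" and V: "md.subspace V"
    and Y: "\<And>x. 0 < D \<Longrightarrow> x \<in> V \<Longrightarrow> Y * x \<in> V" "\<And>x. 0 < D \<Longrightarrow> x \<in> V \<Longrightarrow> Yi * x \<in> V"
    and XE: "\<And>g c x. X_or_e g \<Longrightarrow> 1 \<le> c \<Longrightarrow> c < D \<Longrightarrow> x \<in> V \<Longrightarrow> g c * x \<in> V"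
    and x: "x \<in> V"
  shows "z * x \<in> V"
  using assms(1) x
proof (induction arbitrary: x rule: Bs.induct)
  case (Bs_sc c)
  then show ?case by (rule md.subspace_scale[OF V])
next
  case (Bs_gn g)
  have X: "X c * x \<in> V" "e c * x \<in> V" if "1 \<le> c" "c < D" for c
    using XE[of X c x] XE[of e c x] that Bs_gn by (auto simp: X_or_e_def)
  have Xi: "Xi c * x \<in> V" if "1 \<le> c" "c < D" for c
  proof -
    have "Xi c * x = (X c - sc dl * 1 + sc dl * e c) * x"
      using Xi_eq[of c] that assms(2) by simp
    also have "\<dots> = X c * x - sc dl * x + sc dl * (e c * x)"
      by (simp add: ring_distribs mult.assoc)
    also have "\<dots> \<in> V"
      using X[OF that] Bs_gn(2)
      by (intro md.subspace_add[OF V] md.subspace_diff[OF V] md.subspace_scale[OF V])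
    finally show ?thesis .
  qed
  show ?case
    using Bs_gn Y X Xi by (cases g) (auto simp: let_ok_def bmw_letter_def)
next
  case (Bs_add a b)
  then show ?case by (simp add: distrib_right md.subspace_add[OF V])
next
  case (Bs_mult a b)
  then show ?case by (simp add: mult.assoc)
qed

text \<open>Merges the cases by position; the hypotheses on \<open>A\<close> list precisely what
  each case may produce, so that closure under generators becomes a check on pairs of index and
  exponent.\<close>

lemma gen_all:
  assumes g: "X_or_e g" and c: "1 \<le> i" "i \<le> j" "j \<le> Suc d" "1 \<le> c" "c \<le> l" "l < n" "l \<le> Suc d" "d \<le> l"
    and y: "y \<in> Bs d"
    and hi: "i < c \<Longrightarrow> A i p" "i < c \<Longrightarrow> A c 0"
    and eq: "\<And>p'. i = c \<Longrightarrow> \<bar>p'\<bar> \<le> \<bar>p\<bar> \<Longrightarrow> A c p'" "\<And>p'. i = c \<Longrightarrow> i \<le> d \<Longrightarrow> btw p p' \<Longrightarrow> A (Suc c) p'"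
    and lo: "\<And>p'. i = Suc c \<Longrightarrow> btw p p' \<Longrightarrow> A i p'" "\<And>p'. i = Suc c \<Longrightarrow> \<bar>p'\<bar> \<le> \<bar>p\<bar> \<Longrightarrow> A c p'"
    and far: "Suc c < i \<Longrightarrow> A i p"
  shows "g c * (zp i p * (v i j l * y)) \<in> Sp l d A"
proof -
  consider "i < c" | "i = c" | "i = Suc c" | "Suc c < i" by linarith
  then show ?thesis
  proof cases
    case 1
    show ?thesis
      by (rule Sp_mono[OF gen_hi[OF g c(1-3) 1 c(5-8) y]]) (use hi 1 in auto)
  next
    case 2
    have "g c * (zp i p * (v i j l * y)) \<in>
      Sp l d (\<lambda>i' p'. i' = Suc i \<and> btw p p' \<or> i' = i \<and> \<bar>p'\<bar> \<le> \<bar>p\<bar>)"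
      using gen_eq[OF g c(1-3) _ c(6-8) y, of p] c 2 by simp
    then show ?thesis
      by (rule Sp_mono) (use eq 2 in auto)
  next
    case 3
    have "g c * (zp i p * (v i j l * y)) \<in>
      Sp l d (\<lambda>i' p'. i' = Suc c \<and> btw p p' \<or> i' = c \<and> \<bar>p'\<bar> \<le> \<bar>p\<bar>)"
      using gen_lo[OF g c(4) _ c(3,6,8) y, of p] c(2) 3 by simp
    then show ?thesis
      by (rule Sp_mono) (use lo 3 in auto)
  next
    case 4
    have "g c \<in> Bs (Suc c)" by (rule Bs_X_or_e[OF g]) (use c in auto)
    then show ?thesis
      using gen_far[of "g c" "Suc c" i j d l y A p] c 4 far y by simp
  qed
qed

lemma Y_gen_far:
  assumes "1 < i" "i \<le> j" "j \<le> Suc d" "l < n" "d \<le> l" "y \<in> Bs d" "A i p"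
  shows "Y * (zp i p * (v i j l * y)) \<in> Sp l d A" "Yi * (zp i p * (v i j l * y)) \<in> Sp l d A"
  using gen_far[of Y 1 i j d l y A p] gen_far[of Yi 1 i j d l y A p] Bs_Y[of 1] Bs_Yi[of 1] assms by auto

lemma Y_zp1: "1 \<le> n \<Longrightarrow> Y * (zp (Suc 0) p * u) = zp (Suc 0) (p + 1) * u"
  and Yi_zp1: "1 \<le> n \<Longrightarrow> Yi * (zp (Suc 0) p * u) = zp (Suc 0) (p - 1) * u"
  using zp_add[of "Suc 0" 1 p] zp_add[of "Suc 0" "-1" p]
  by (simp_all add: zp_1 zp_m1 yy_1 yi_1 add.commute flip: mult.assoc)

text \<open>One generator may lead from \<open>A\<close> to the weaker condition \<open>A'\<close>,
  in which exponents have left the wanted range; \<open>sub\<close> then repairs them. The letters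
  of \<open>Bs D\<close> have \<open>c < D\<close>, which limits the first indices at which this
  happens.\<close>

lemma Sp_closed_gen:
  assumes l: "l < n" "d \<le> l" "l \<le> Suc d" and D: "D \<le> Suc l" and z: "z \<in> Bs D" and x: "x \<in> Sp l d A"
    and sub: "\<And>x. x \<in> Sp l d A' \<Longrightarrow> x \<in> Sp l d A"
    and A: "\<And>i p. A i p \<Longrightarrow> A' i p"
      "\<And>i p c. A i p \<Longrightarrow> c < D \<Longrightarrow> i < c \<Longrightarrow> A' c 0"
      "\<And>c p p'. A c p \<Longrightarrow> c < D \<Longrightarrow> \<bar>p'\<bar> \<le> \<bar>p\<bar> \<Longrightarrow> A' c p'"
      "\<And>c p p'. A c p \<Longrightarrow> c < D \<Longrightarrow> btw p p' \<Longrightarrow> A' (Suc c) p'"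
      "\<And>c p p'. A (Suc c) p \<Longrightarrow> c < D \<Longrightarrow> btw p p' \<Longrightarrow> A' (Suc c) p'"
      "\<And>c p p'. A (Suc c) p \<Longrightarrow> c < D \<Longrightarrow> \<bar>p'\<bar> \<le> \<bar>p\<bar> \<Longrightarrow> A' c p'"
      "\<And>p p'. 0 < D \<Longrightarrow> A 1 p \<Longrightarrow> A' 1 p'"
  shows "z * x \<in> Sp l d A"
proof (rule Bs_closed[OF z _ md.subspace_span _ _ _ x])
  show "D \<le> n" using l D by simp
next
  have gens: "w * x \<in> Sp l d A"
    if "\<And>i j p y. A i p \<Longrightarrow> 1 \<le> i \<Longrightarrow> i \<le> j \<Longrightarrow> j \<le> Suc d \<Longrightarrow> y \<in> Bs d
      \<Longrightarrow> w * (zp i p * (v i j l * y)) \<in> Sp l d A'" "x \<in> Sp l d A" for w x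
    by (rule span_multL[OF that(2)]) (use that(1) sub in \<open>unfold Sg_def, blast\<close>)
  {
    fix x assume D0: "0 < D" and x: "x \<in> Sp l d A"
    have "Y * (zp i p * (v i j l * y)) \<in> Sp l d A' \<and> Yi * (zp i p * (v i j l * y)) \<in> Sp l d A'"
      if a: "A i p" "1 \<le> i" "i \<le> j" "j \<le> Suc d" "y \<in> Bs d" for i j p y
    proof (cases "i = 1")
      case True
      then show ?thesis
        using Y_zp1[of p] Yi_zp1[of p] a A(7)[OF D0, of p] l by (auto intro!: SpI)
    next
      case False
      then show ?thesis
        using Y_gen_far[of i j d l y _ p] a l A(1) by simp
    qed
    then show "Y * x \<in> Sp l d A" "Yi * x \<in> Sp l d A" using x gens by blast+
  next
    fix g c x assume g: "X_or_e g" "1 \<le> c" "c < D" and x: "x \<in> Sp l d A"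
    show "g c * x \<in> Sp l d A"
      by (rule gens[OF _ x], rule gen_all) (use g l D A in auto)
  }
qed

text \<open>At first index \<open>Suc i\<close> the letters of \<open>Bs (Suc i)\<close> only move
  an exponent towards \<open>0\<close>, so it stays in \<open>Pset k\<close>. Sign changes occur at
  first indices up to \<open>i\<close>, where \<open>IH\<close> applies.\<close>

lemma Sp_le_closed:
  assumes l: "l < n" "d \<le> l" "l \<le> Suc d" and i: "1 \<le> i" "i \<le> d"
    and IH: "\<And>x. x \<in> Sp l d (\<lambda>i' p. i' \<le> i) \<Longrightarrow> x \<in> Sp l d (\<lambda>i' p. i' \<le> i \<and> p \<in> Pset k)"
    and z: "z \<in> Bs (Suc i)" and x: "x \<in> Sp l d (\<lambda>i' p. i' \<le> Suc i \<and> p \<in> Pset k)"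
  shows "z * x \<in> Sp l d (\<lambda>i' p. i' \<le> Suc i \<and> p \<in> Pset k)" (is "_ \<in> ?V")
proof -
  have V: "x \<in> ?V" if "x \<in> Sp l d (\<lambda>i' p. i' \<le> Suc i \<and> p \<in> Pset k \<or> i' \<le> i)" for x
    using that
  proof (rule span_subsetI)
    fix s assume "s \<in> Sg l d (\<lambda>i' p. i' \<le> Suc i \<and> p \<in> Pset k \<or> i' \<le> i)"
    then obtain i' j p y where s: "s = zp i' p * (v i' j l * y)" "i' \<le> Suc i \<and> p \<in> Pset k \<or> i' \<le> i"
      "1 \<le> i'" "i' \<le> j" "j \<le> Suc d" "y \<in> Bs d"
      unfolding Sg_def by blast
    from s(2) show "s \<in> ?V"
    proof
      assume "i' \<le> i"
      then have "s \<in> Sp l d (\<lambda>i' p. i' \<le> i)" using s by (auto intro!: SpI)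
      from IH[OF this] show ?thesis by (rule Sp_mono) auto
    qed (use s in \<open>auto intro!: SpI\<close>)
  qed
  show ?thesis
    by (rule Sp_closed_gen[OF l _ z x, where A' = "\<lambda>i' p. i' \<le> Suc i \<and> p \<in> Pset k \<or> i' \<le> i"])
      (use l i V Pset_btw Pset_0 in auto)
qed

text \<open>At first index \<open>1\<close> this is \<open>zp1_span\<close>. In the step
  \<open>zp (Suc i) p\<close> is regarded not as part of a generator but as an element of
  \<open>Bs (Suc i)\<close> acting on \<open>v (Suc i) j l * y\<close>, which has exponent
  \<open>0\<close>.\<close>

lemma Sp_le_Pset:
  assumes l: "l < n" "d \<le> l" "l \<le> Suc d" and i: "1 \<le> i" "i \<le> Suc d"
    and x: "x \<in> Sp l d (\<lambda>i' p. i' \<le> i)"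
  shows "x \<in> Sp l d (\<lambda>i' p. i' \<le> i \<and> p \<in> Pset k)"
  using i x
proof (induction i arbitrary: x rule: dec_induct)
  case base
  from base(2) show ?case
  proof (rule span_subsetI)
    fix s assume "s \<in> Sg l d (\<lambda>i' p. i' \<le> 1)"
    then obtain i' j p y where s: "s = zp i' p * (v i' j l * y)" "i' \<le> 1"
      "1 \<le> i'" "i' \<le> j" "j \<le> Suc d" "y \<in> Bs d"
      unfolding Sg_def by blast
    then have "i' = Suc 0" by simp
    note s = s[unfolded this]
    let ?lo = "int (k div 2) - (int k - 1)"
    have "zp (Suc 0) p * (v (Suc 0) j l * y) \<in> Sp l d (\<lambda>i' p. i' \<le> 1 \<and> p \<in> Pset k)"
    proof (rule span_multR[OF zp1_span[of p ?lo]])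
      fix u assume "u \<in> {zp (Suc 0) s |s. ?lo \<le> s \<and> s < ?lo + int k}"
      then obtain t where "u = zp (Suc 0) t" "t \<in> Pset k" by (auto simp: Pset_def)
      then show "u * (v (Suc 0) j l * y) \<in> Sp l d (\<lambda>i' p. i' \<le> 1 \<and> p \<in> Pset k)"
        using s by (auto intro!: SpI)
    qed (use l in auto)
    then show "s \<in> Sp l d (\<lambda>i' p. i' \<le> 1 \<and> p \<in> Pset k)" using s(1) by simp
  qed
next
  case (step i)
  let ?V = "Sp l d (\<lambda>i' p. i' \<le> Suc i \<and> p \<in> Pset k)"
  have IH: "x \<in> Sp l d (\<lambda>i' p. i' \<le> i \<and> p \<in> Pset k)" if "x \<in> Sp l d (\<lambda>i' p. i' \<le> i)" for x
    using step.IH[OF _ that] step.prems by simp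
  from step.prems(2) show ?case
  proof (rule span_subsetI)
    fix s assume "s \<in> Sg l d (\<lambda>i' p. i' \<le> Suc i)"
    then obtain i' j p y where s: "s = zp i' p * (v i' j l * y)" "i' \<le> Suc i"
      "1 \<le> i'" "i' \<le> j" "j \<le> Suc d" "y \<in> Bs d"
      unfolding Sg_def by blast
    show "s \<in> ?V"
    proof (cases "i' = Suc i")
      case True
      have "v i' j l * y \<in> ?V" using s True Pset_0 by (auto intro!: SpI0)
      then show ?thesis
        unfolding s(1) using Sp_le_closed[OF l, of i "zp i' p"] step IH True Bs_zp[of "Suc i" p] by auto
    next
      case False
      then have "s \<in> Sp l d (\<lambda>i' p. i' \<le> i)" using s by (auto intro!: SpI)
      from IH[OF this] show ?thesis by (rule Sp_mono) auto
    qed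
  qed
qed

lemma Sp_closed:
  assumes l: "l < n" "d \<le> l" "l \<le> Suc d"
    and z: "z \<in> Bs (Suc l)" and x: "x \<in> Sp l d (\<lambda>i p. p \<in> Pset k)"
  shows "z * x \<in> Sp l d (\<lambda>i p. p \<in> Pset k)"
proof -
  have "x \<in> Sp l d (\<lambda>i p. True)" by (rule Sp_mono[OF x]) auto
  then have "z * x \<in> Sp l d (\<lambda>i p. True)"
    by (rule Sp_closed_gen[OF l order_refl z, where A' = "\<lambda>i p. True"]) auto
  then have "z * x \<in> Sp l d (\<lambda>i p. i \<le> Suc d)" by (rule Sp_mono) auto
  then have "z * x \<in> Sp l d (\<lambda>i p. i \<le> Suc d \<and> p \<in> Pset k)"
    using Sp_le_Pset[OF l] by simp
  then show ?thesis by (rule Sp_mono) auto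
qed

lemma Bs_e_span: "1 \<le> l \<Longrightarrow> l < n \<Longrightarrow> x \<in> Bs (Suc l) \<Longrightarrow> x * e l \<in> Sp l (l - 1) (\<lambda>i p. p \<in> Pset k)"
  using Sp_closed[of l "l - 1" x "e l"] SpI0[of "\<lambda>i p. p \<in> Pset k" l l "l - 1" 1 l] Pset_0 Bs_1
  by (simp add: v_Cons_e)

text \<open>Without \<open>Y\<close> and with letters of index at least \<open>m\<close>, neither
  the lower bound on the first index nor the bound on absolute exponents is lost. This is for
  \<open>swap\<close>, where the first index must not drop.\<close>

lemma Sp_ge_closed:
  assumes l: "l < n" "d \<le> l" "l \<le> Suc d" and g: "X_or_e g" and m: "1 \<le> m" "m \<le> c" "c \<le> l"
    and x: "x \<in> Sp l d (\<lambda>i p. m \<le> i \<and> \<bar>p\<bar> \<le> q)" and q: "0 \<le> q"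
  shows "g c * x \<in> Sp l d (\<lambda>i p. m \<le> i \<and> \<bar>p\<bar> \<le> q)" (is "_ \<in> ?V")
proof (rule span_multL[OF x])
  fix s assume "s \<in> Sg l d (\<lambda>i p. m \<le> i \<and> \<bar>p\<bar> \<le> q)"
  then obtain i j p y where s: "s = zp i p * (v i j l * y)" "m \<le> i" "\<bar>p\<bar> \<le> q"
      "1 \<le> i" "i \<le> j" "j \<le> Suc d" "y \<in> Bs d"
    unfolding Sg_def by blast
  show "g c * s \<in> ?V"
    unfolding s(1) by (rule gen_all[OF g]) (use s l m q in \<open>auto simp: btw_def\<close>)
qed

lemma Sp_ge_closed_Xi:
  assumes l: "l < n" "d \<le> l" "l \<le> Suc d" and m: "1 \<le> m" "m \<le> c" "c \<le> l"
    and x: "x \<in> Sp l d (\<lambda>i p. m \<le> i \<and> \<bar>p\<bar> \<le> q)" and q: "0 \<le> q"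
  shows "Xi c * x \<in> Sp l d (\<lambda>i p. m \<le> i \<and> \<bar>p\<bar> \<le> q)" (is "_ \<in> ?V")
proof -
  have "Xi c * x = (X c - sc dl * 1 + sc dl * e c) * x"
    using Xi_eq[of c] l m by simp
  also have "\<dots> = X c * x - sc dl * x + sc dl * (e c * x)"
    by (simp add: ring_distribs mult.assoc)
  also have "\<dots> \<in> ?V"
    using Sp_ge_closed[OF l, of X m c x q] Sp_ge_closed[OF l, of e m c x q] m x q
    by (intro md.span_add md.span_diff md.span_scale) (auto simp: X_or_e_def)
  finally show ?thesis .
qed

lemma Sp_ge_closed_Xm:
  assumes l: "l < n" "d \<le> l" "l \<le> Suc d" and m: "1 \<le> m" "set cs \<subseteq> {m..l}"
    and x: "x \<in> Sp l d (\<lambda>i p. m \<le> i \<and> \<bar>p\<bar> \<le> q)" and q: "0 \<le> q"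
  shows "ev (map Xm cs) * x \<in> Sp l d (\<lambda>i p. m \<le> i \<and> \<bar>p\<bar> \<le> q)"
  using m(2) by (induction cs) (auto simp: mult.assoc x intro!: Sp_ge_closed_Xi[OF l m(1) _ _ _ q])

subsection \<open>Exchanging two arcs\<close>

lemma shift_word:
  assumes "\<And>c. a \<le> c \<Longrightarrow> c < b \<Longrightarrow> w * gn (g c) = gn (g (c + d)) * w"
  shows "w * ev (map g [a..<b]) = ev (map g [a + d..<b + d]) * w"
  using assms
proof (induction b)
  case 0
  then show ?case by simp
next
  case (Suc b)
  show ?case
  proof (cases "a \<le> b")
    case True
    have "w * ev (map g [a..<Suc b]) = (w * ev (map g [a..<b])) * gn (g b)"
      using True by (simp add: ev_append mult.assoc)
    also have "w * ev (map g [a..<b]) = ev (map g [a + d..<b + d]) * w"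
      using Suc by simp
    finally show ?thesis using True Suc.prems[of b] by (simp add: ev_append mult.assoc)
  qed simp
qed

lemma v_shift2:
  assumes "1 \<le> i" "i \<le> j" "j \<le> a" "Suc b \<le> l" "l < n"
  shows "v i j l * xs a b = xs (Suc (Suc a)) (Suc (Suc b)) * v i j l"
    and "v i j l * es a b = es (Suc (Suc a)) (Suc (Suc b)) * v i j l"
  using shift_word[of a b "v i j l" Xp 2] shift_word[of a b "v i j l" E 2]
    shift2[of X i j _ l] shift2[of e i j _ l] assms
  by (auto simp: xs_def es_def X_or_e_def)

lemma v_shift1:
  assumes "1 \<le> i" "i \<le> a" "Suc b \<le> j" "j \<le> Suc l" "l < n"
  shows "v i j l * xs a b = xs (Suc a) (Suc b) * v i j l"
    and "v i j l * es a b = es (Suc a) (Suc b) * v i j l"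
  using shift_word[of a b "v i j l" Xp 1] shift_word[of a b "v i j l" E 1]
    shift1[of X i _ j l] shift1[of e i _ j l] assms
  by (auto simp: xs_def es_def X_or_e_def)

lemma v_end: "i \<le> j \<Longrightarrow> j \<le> m \<Longrightarrow> v i j m = (xs i j * es j m) * e m"
  by (simp add: v_def es_snoc mult.assoc)

text \<open>For \<open>g = j\<close> the crossings by which \<open>yy (Suc (Suc j))\<close> differs
  from \<open>yy j\<close> are absorbed by the hooks of the arc. Larger \<open>g\<close> follow by
  adding the crossing \<open>X g\<close>, which \<open>shift2\<close> moves by two.\<close>

lemma v_yy_shift:
  assumes "1 \<le> i" "i \<le> j" "j \<le> g" "Suc g \<le> l" "l < n"
  shows "v i j l * yy g = yy (Suc (Suc g)) * v i j l"
proof -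
  have j: "v j j l * yy g = yy (Suc (Suc g)) * v j j l"
    using assms(3,4)
  proof (induction g rule: dec_induct)
    case base
    have a: "adj j (Suc j)" using base assms by (simp add: adj_def)
    let ?w = "es (Suc (Suc j)) (Suc l)"
    have w: "v j j l = e j * (e (Suc j) * ?w)"
      using base assms by (simp add: v_Cons_e es_Cons)
    have wy: "?w * yy j = yy j * ?w"
      by (rule es_Bs[OF Bs_yy]) (use assms in auto)
    have ey: "e (Suc j) * yy j = yy j * e (Suc j)"
      by (rule e_Bs[OF Bs_yy]) (use base assms in auto)
    have "yy (Suc (Suc j)) * v j j l = X (Suc j) * (X j * (yy j * ((X j * (X (Suc j) * e j)) * (e (Suc j) * ?w))))"
      using assms by (simp add: yy_Suc w mult.assoc)
    also have "\<dots> = X (Suc j) * (X j * (yy j * (e (Suc j) * (e j * (e (Suc j) * ?w)))))"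
      unfolding XXEa[OF a] by (simp add: mult.assoc)
    also have "\<dots> = (X (Suc j) * (X j * e (Suc j))) * (yy j * ?w)"
      unfolding EEEz[OF adj_sym[OF a]] by (simp add: comm_left[OF ey, symmetric] mult.assoc)
    also have "\<dots> = v j j l * yy j"
      unfolding XXEa[OF adj_sym[OF a]] by (simp add: w wy mult.assoc)
    finally show ?case by simp
  next
    case (step g)
    have x: "v j j l * X g = X (Suc (Suc g)) * v j j l"
      using shift2[of X j j g l] assms step by (simp add: X_or_e_def)
    have "v j j l * yy (Suc g) = (v j j l * X g) * (yy g * X g)"
      using step assms by (simp add: yy_Suc mult.assoc)
    also have "\<dots> = X (Suc (Suc g)) * ((v j j l * yy g) * X g)"
      by (simp add: x mult.assoc)
    also have "\<dots> = X (Suc (Suc g)) * (yy (Suc (Suc g)) * (v j j l * X g))"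
      using step by (simp add: mult.assoc)
    also have "\<dots> = yy (Suc (Suc (Suc g))) * v j j l"
      by (simp add: x yy_Suc mult.assoc)
    finally show ?case .
  qed
  have x: "yy (Suc (Suc g)) * xs i j = xs i j * yy (Suc (Suc g))"
    by (rule yy_Bs[OF Bs_xs[OF _ order_refl]]) (use assms in auto)
  have v: "v i j l = xs i j * v j j l" using assms by (simp add: v_def)
  show ?thesis
    by (simp add: v mult.assoc j comm_left[OF x])
qed

lemma v_zp_shift:
  assumes "1 \<le> i" "i \<le> j" "j \<le> g" "Suc g \<le> l" "l < n"
  shows "v i j l * zp g r = zp (Suc (Suc g)) r * v i j l"
  by (rule zp_intertwine[OF v_yy_shift[OF assms]]) (use assms in auto)

text \<open>The second arc lies to the right of the first. The relation
  \<open>e ?l * (e (Suc m) * e ?l) = e ?l\<close> removes the last two hooks of the first arc, which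
  then ends at \<open>m\<close>.\<close>

lemma v_v_shift2:
  assumes "1 \<le> i" "i \<le> j" "j \<le> g" "g \<le> h" "h \<le> m" "Suc (Suc m) < n"
  shows "v i j (Suc (Suc m)) * v g h m = v (Suc (Suc g)) (Suc (Suc h)) (Suc (Suc m)) * v i j m"
proof -
  let ?l = "Suc (Suc m)"
  let ?W = "xs (Suc (Suc g)) (Suc (Suc h)) * es (Suc (Suc h)) ?l" and ?z = "xs i j * es j m"
  have a: "adj ?l (Suc m)" using assms by (simp add: adj_def)
  have vm: "v i j m = ?z * e m" using assms by (intro v_end) auto
  have vl: "v i j ?l = v i j m * (e (Suc m) * e ?l)"
    using assms by (simp add: v_def es_snoc mult.assoc)
  have B: "v i j m \<in> Bs (Suc m)" using assms by (intro Bs_v) auto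
  have c: "e ?l * v i j m = v i j m * e ?l" by (rule e_Bs[OF B]) (use assms in auto)
  have "v i j ?l * v g h m = xs (Suc (Suc g)) (Suc (Suc h)) * (v i j ?l * es h (Suc m))"
    using v_shift2(1)[of i j g h ?l] assms by (simp add: v_def[of g] flip: mult.assoc)
  also have "v i j ?l * es h (Suc m) = es (Suc (Suc h)) (Suc ?l) * v i j ?l"
    using assms by (intro v_shift2(2)) auto
  also have "xs (Suc (Suc g)) (Suc (Suc h)) * \<dots> = ?W * (e ?l * v i j ?l)"
    using assms by (simp add: es_snoc[of _ ?l] mult.assoc)
  also have "e ?l * v i j ?l = v i j m * e ?l"
    unfolding vl by (simp add: comm_left[OF c] EEEa[OF a])
  also have "\<dots> = e ?l * v i j m" by (simp add: c)
  also have "?W * (e ?l * v i j m) = v (Suc (Suc g)) (Suc (Suc h)) ?l * v i j m"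
    using assms by (simp add: v_def[of "Suc (Suc g)"] es_snoc[of _ ?l] mult.assoc)
  finally show ?thesis .
qed

text \<open>Read as a tangle, \<open>v i j l\<close> has an arc with left end \<open>i\<close>. If the second arc of a product
  starts to the right of \<open>i\<close>, it can be moved in front of the first one, which raises the first
  index: \<open>higher m i\<close> collects the products with first index above \<open>i\<close>.\<close>

definition higher :: "nat \<Rightarrow> nat \<Rightarrow> 'b set" where
  "higher m i = {zp i' p * (v i' j (Suc (Suc m)) * (y * e m)) | i' p j y.
     i < i' \<and> i' \<le> j \<and> j \<le> Suc (Suc m) \<and> p \<in> Pset k \<and> y \<in> Bs (Suc m)}"

lemma higherI: "i < i' \<Longrightarrow> i' \<le> j \<Longrightarrow> j \<le> Suc (Suc m) \<Longrightarrow> p \<in> Pset k \<Longrightarrow> y \<in> Bs (Suc m)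
  \<Longrightarrow> zp i' p * (v i' j (Suc (Suc m)) * (y * e m)) \<in> md.span (higher m i)"
  unfolding higher_def by (rule md.span_base) blast

lemma higherI_v:
  assumes "i < i'" "i' \<le> j" "j \<le> Suc (Suc m)" "p \<in> Pset k" "y \<in> Bs (Suc m)" "1 \<le> g" "g \<le> h" "h \<le> m"
  shows "zp i' p * (v i' j (Suc (Suc m)) * (y * v g h m)) \<in> md.span (higher m i)"
proof -
  have B: "xs g h * es h m \<in> Bs (Suc m)" using assms by (intro Bs_mult Bs_xs Bs_es) auto
  have "zp i' p * (v i' j (Suc (Suc m)) * ((y * (xs g h * es h m)) * e m)) \<in> md.span (higher m i)"
    using assms by (intro higherI Bs_mult[OF _ B]) auto
  then show ?thesis using assms by (simp add: v_end[of g h m] mult.assoc)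
qed

text \<open>The nested case: seen from the top the second arc has ends \<open>g + 1\<close> and
  \<open>h + 2\<close>, both between the ends \<open>i\<close> and \<open>j' + 3\<close> of the
  first, so the inner arc can be put in front without any correction.\<close>

lemma v_v_inner:
  assumes "1 \<le> i" "i \<le> g" "g \<le> h" "h \<le> j'" "j' \<le> m" "Suc (Suc m) < n"
  shows "v i (Suc (Suc j')) (Suc (Suc m)) * v g h m = v (Suc g) (Suc h) (Suc (Suc m)) * v i j' m"
proof -
  let ?l = "Suc (Suc m)" and ?j = "Suc (Suc j')"
  have a: "adj (Suc j') j'" using assms by (simp add: adj_def)
  have B: "xs i j' * e j' \<in> Bs (Suc j')" using assms by (intro Bs_mult Bs_xs Bs_e) auto
  have B': "xs i j' \<in> Bs j'" using assms by (intro Bs_xs) auto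
  have c: "e (Suc j') * xs i j' = xs i j' * e (Suc j')"
    by (rule e_Bs[OF B']) (use assms in auto)
  have d: "es ?j (Suc ?l) * (xs i j' * e j') = (xs i j' * e j') * es ?j (Suc ?l)"
    by (rule es_Bs[OF B]) (use assms in auto)
  have ev: "e (Suc j') * v i ?j ?l = e (Suc j') * (es ?j (Suc ?l) * (xs i j' * e j'))"
  proof -
    have "e (Suc j') * v i ?j ?l = xs i j' * ((e (Suc j') * (X j' * X (Suc j'))) * es ?j (Suc ?l))"
      using assms by (simp add: v_def xs_snoc comm_left[OF c] mult.assoc)
    also have "\<dots> = e (Suc j') * ((xs i j' * e j') * es ?j (Suc ?l))"
      unfolding EXX[OF a] by (simp add: comm_left[OF c] mult.assoc)
    finally show ?thesis by (simp only: d)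
  qed
  have "v i ?j ?l * v g h m = (v i ?j ?l * xs g h) * (es h (Suc j') * es (Suc j') (Suc m))"
    using assms es_split[of h "Suc j'" "Suc m"] by (simp add: v_def[of g] mult.assoc)
  also have "v i ?j ?l * xs g h = xs (Suc g) (Suc h) * v i ?j ?l"
    using assms by (intro v_shift1(1)) auto
  also have "\<dots> * (es h (Suc j') * es (Suc j') (Suc m))
      = xs (Suc g) (Suc h) * ((v i ?j ?l * es h (Suc j')) * es (Suc j') (Suc m))"
    by (simp add: mult.assoc)
  also have "v i ?j ?l * es h (Suc j') = es (Suc h) (Suc (Suc j')) * v i ?j ?l"
    using assms by (intro v_shift1(2)) auto
  also have "\<dots> = es (Suc h) (Suc j') * (e (Suc j') * v i ?j ?l)"
    using assms by (simp add: es_snoc mult.assoc)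
  also have "\<dots> = es (Suc h) (Suc ?l) * (xs i j' * e j')"
    unfolding ev using assms es_split[of "Suc h" "Suc j'" "Suc ?l"] es_Cons[of "Suc j'" "Suc ?l"]
    by (simp add: mult.assoc)
  also have "xs (Suc g) (Suc h) * (\<dots> * es (Suc j') (Suc m)) = v (Suc g) (Suc h) ?l * v i j' m"
    using assms by (simp add: v_def es_Cons[of j' "Suc m"] mult.assoc)
  finally show ?thesis .
qed

text \<open>The interlaced case: the ends \<open>i\<close> and \<open>j' + 2\<close> of the first
  arc alternate with the ends \<open>g + 1\<close> and \<open>h + 3\<close> of the second. The arcs
  cross, and an inverse crossing remains after the exchange.\<close>

lemma v_v_cross:
  assumes "1 \<le> i" "i \<le> g" "g \<le> j'" "j' \<le> h" "h \<le> m" "Suc (Suc m) < n"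
  shows "v i (Suc j') (Suc (Suc m)) * v g h m
    = xs (Suc g) (Suc j') * (Xi (Suc j') * (v (Suc (Suc j')) (Suc (Suc h)) (Suc (Suc m)) * v i j' m))"
proof -
  let ?l = "Suc (Suc m)"
  have "v i (Suc j') ?l * v g h m = (v i (Suc j') ?l * xs g j') * v j' h m"
    using assms by (simp add: v_split[of g j' h] mult.assoc)
  also have "v i (Suc j') ?l * xs g j' = xs (Suc g) (Suc j') * v i (Suc j') ?l"
    using assms by (intro v_shift1(1)) auto
  also have "\<dots> * v j' h m = xs (Suc g) (Suc j') * ((Xi (Suc j') * v i j' ?l) * v j' h m)"
    using X_v_at(1)[of i j' ?l] assms by (simp add: Xi_X_cancel mult.assoc flip: X_v_at(1)[of i j' ?l])
  also have "\<dots> = xs (Suc g) (Suc j') * (Xi (Suc j') * (v i j' ?l * v j' h m))"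
    by (simp add: mult.assoc)
  also have "v i j' ?l * v j' h m = v (Suc (Suc j')) (Suc (Suc h)) ?l * v i j' m"
    using assms by (intro v_v_shift2) auto
  finally show ?thesis .
qed

text \<open>The power of the second arc already stands in front, with index \<open>Suc g\<close>
  because its left end \<open>g\<close> is shifted by one below the first arc. The nested and the
  interlaced case remain.\<close>

lemma swap_main:
  assumes i: "1 \<le> i" "i \<le> g" "g < j" "j \<le> Suc (Suc m)" "g \<le> h" "h \<le> m" "Suc (Suc m) < n"
    and r: "r \<in> Pset k"
  shows "zp i p * (zp (Suc g) r * (v i j (Suc (Suc m)) * v g h m)) \<in> md.span (higher m i)" (is "_ \<in> ?T")
proof -
  let ?l = "Suc (Suc m)"
  have zpi: "zp i p \<in> Bs (Suc m)" "zp i p \<in> Bs g" using i by (auto intro: Bs_zp')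
  have c1: "zp i p * zp (Suc g) r = zp (Suc g) r * zp i p"
    by (rule zp_Bs[OF zpi(2)]) (use i in auto)
  have c2: "zp i p * v i' j ?l = v i' j ?l * zp i p" if "g < i'" "i' \<le> j" "j \<le> ?l" for i' j
    using v_Bs[OF zpi(2), of i' j ?l] that i by simp
  show ?thesis
  proof (cases "Suc (Suc h) \<le> j")
    case True
    define j' where "j' = j - 2"
    have j: "j = Suc (Suc j')" "h \<le> j'" using True by (auto simp: j'_def)
    have "zp i p * (zp (Suc g) r * (v i j ?l * v g h m))
        = zp (Suc g) r * (zp i p * (v (Suc g) (Suc h) ?l * v i j' m))"
      unfolding j using i j by (simp add: v_v_inner comm_left[OF c1])
    also have "zp i p * (v (Suc g) (Suc h) ?l * v i j' m) = v (Suc g) (Suc h) ?l * (zp i p * v i j' m)"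
      by (rule comm_left[OF c2]) (use i in auto)
    also have "zp (Suc g) r * \<dots> \<in> ?T"
      using i j zpi r by (intro higherI_v) auto
    finally show ?thesis .
  next
    case False
    define j' where "j' = j - 1"
    have j: "j = Suc j'" "j' \<le> h" "g \<le> j'" using False i by (auto simp: j'_def)
    let ?u = "v i j' m" and ?w = "v (Suc j) (Suc (Suc h)) ?l"
    have xsB: "xs (Suc g) j \<in> Bs j" using i by (intro Bs_xs) auto
    obtain y0 where y0: "y0 \<in> Bs (Suc h)" "e j * ?w = v j j ?l * y0"
      using e_v_Bs[of j "Suc (Suc h)" ?l] i j by auto
    have y0': "y0 \<in> Bs (Suc m)" using Bs_mono[OF y0(1)] i by simp
    have t1: "xs (Suc g) j * (X j * (?w * ?u)) = v (Suc g) (Suc (Suc h)) ?l * ?u"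
    proof -
      have "v (Suc g) (Suc (Suc h)) ?l = xs (Suc g) j * (X j * ?w)"
        using i j v_split[of "Suc g" j "Suc (Suc h)" ?l] v_Cons[of j "Suc (Suc h)" ?l] by simp
      then show ?thesis by (simp add: mult.assoc)
    qed
    have t2: "xs (Suc g) j * (?w * ?u) = ?w * (xs (Suc g) j * ?u)"
      by (rule comm_left[OF v_Bs[OF xsB, symmetric]]) (use i j in auto)
    have t3: "xs (Suc g) j * (e j * (?w * ?u)) = v (Suc g) j ?l * (y0 * ?u)"
    proof -
      have "xs (Suc g) j * (e j * (?w * ?u)) = xs (Suc g) j * ((e j * ?w) * ?u)"
        by (simp add: mult.assoc)
      also have "\<dots> = xs (Suc g) j * (v j j ?l * (y0 * ?u))"
        unfolding y0(2) by (simp add: mult.assoc)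
      finally show ?thesis
        using i by (simp add: v_def mult.assoc)
    qed
    \<comment> \<open>The skein relation resolves the remaining inverse crossing. The three terms
      have first indices \<open>Suc g\<close>, \<open>Suc j\<close> (with exponent \<open>0\<close>)
      and \<open>Suc g\<close>, all above \<open>i\<close>.\<close>
    have "v i j ?l * v g h m = xs (Suc g) j * ((X j - sc dl * 1 + sc dl * e j) * (?w * ?u))"
      using v_v_cross[of i g j' h m] i j Xi_eq[of j] by simp
    also have "\<dots> = xs (Suc g) j * (X j * (?w * ?u)) - sc dl * (xs (Suc g) j * (?w * ?u))
        + sc dl * (xs (Suc g) j * (e j * (?w * ?u)))"
      by (simp add: ring_distribs mult.assoc mult_sc[of "xs (Suc g) j"])
    also have "\<dots> = v (Suc g) (Suc (Suc h)) ?l * ?u - sc dl * (?w * (xs (Suc g) j * ?u))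
        + sc dl * (v (Suc g) j ?l * (y0 * ?u))"
      by (simp only: t1 t2 t3)
    finally have "zp i p * (zp (Suc g) r * (v i j ?l * v g h m))
        = zp i p * (zp (Suc g) r * (v (Suc g) (Suc (Suc h)) ?l * ?u))
          - sc dl * (zp i p * (zp (Suc g) r * (?w * (xs (Suc g) j * ?u))))
        + sc dl * (zp i p * (zp (Suc g) r * (v (Suc g) j ?l * (y0 * ?u))))"
      by (simp add: ring_distribs zp_sc)
    also have "\<dots> \<in> ?T"
    proof (intro md.span_add md.span_diff md.span_scale)
      have "zp i p * (zp (Suc g) r * (v (Suc g) (Suc (Suc h)) ?l * ?u))
        = zp (Suc g) r * (zp i p * (v (Suc g) (Suc (Suc h)) ?l * ?u))"
        by (rule comm_left[OF c1])
      also have "zp i p * (v (Suc g) (Suc (Suc h)) ?l * ?u) = v (Suc g) (Suc (Suc h)) ?l * (zp i p * ?u)"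
        by (rule comm_left[OF c2]) (use i in auto)
      also have "zp (Suc g) r * \<dots> \<in> ?T"
        using i j zpi r by (intro higherI_v) auto
      finally show "zp i p * (zp (Suc g) r * (v (Suc g) (Suc (Suc h)) ?l * ?u)) \<in> ?T" .
    next
      let ?z = "zp i p * zp (Suc g) r"
      have z: "?z \<in> Bs j" "?z * xs (Suc g) j \<in> Bs (Suc m)"
        using i j by (auto intro!: Bs_mult Bs_zp' Bs_xs)
      have "zp i p * (zp (Suc g) r * (?w * (xs (Suc g) j * ?u))) = ?z * (?w * (xs (Suc g) j * ?u))"
        by (simp add: mult.assoc)
      also have "\<dots> = ?w * (?z * (xs (Suc g) j * ?u))"
        by (rule comm_left[OF v_Bs[OF z(1), symmetric]]) (use i j in auto)
      also have "\<dots> = zp (Suc j) 0 * (?w * ((?z * xs (Suc g) j) * ?u))"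
        by (simp add: mult.assoc)
      also have "\<dots> \<in> ?T"
        using i j z Pset_0 by (intro higherI_v) auto
      finally show "zp i p * (zp (Suc g) r * (?w * (xs (Suc g) j * ?u))) \<in> ?T" .
    next
      have "zp i p * (zp (Suc g) r * (v (Suc g) j ?l * (y0 * ?u)))
        = zp (Suc g) r * (zp i p * (v (Suc g) j ?l * (y0 * ?u)))"
        by (rule comm_left[OF c1])
      also have "zp i p * (v (Suc g) j ?l * (y0 * ?u)) = v (Suc g) j ?l * (zp i p * (y0 * ?u))"
        by (rule comm_left[OF c2]) (use i in auto)
      also have "zp (Suc g) r * \<dots> = zp (Suc g) r * (v (Suc g) j ?l * ((zp i p * y0) * ?u))"
        by (simp add: mult.assoc)
      also have "\<dots> \<in> ?T"
        using i j zpi y0' r by (intro higherI_v Bs_mult) auto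
      finally show "zp i p * (zp (Suc g) r * (v (Suc g) j ?l * (y0 * ?u))) \<in> ?T" .
    qed
    finally show ?thesis .
  qed
qed

text \<open>If \<open>j \<le> g\<close>, the arcs are disjoint and nothing has to be corrected.
  Otherwise the left end of the second arc passes the crossing \<open>X g\<close> of the first, and
  its power must be taken across this crossing.\<close>

lemma swap:
  assumes i: "1 \<le> i" "i \<le> j" "j \<le> Suc (Suc m)" "i \<le> g" "g \<le> h" "h \<le> m" "Suc (Suc m) < n"
    and r: "r \<in> Pset k"
  shows "zp i p * (v i j (Suc (Suc m)) * (zp g r * v g h m)) \<in> md.span (higher m i)" (is "_ \<in> ?T")
proof (cases "j \<le> g")
  case True
  let ?l = "Suc (Suc m)"
  have zpi: "zp i p \<in> Bs (Suc m)" "zp i p \<in> Bs g" using i by (auto intro: Bs_zp')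
  have "zp i p * (v i j ?l * (zp g r * v g h m)) = zp i p * ((v i j ?l * zp g r) * v g h m)"
    by (simp add: mult.assoc)
  also have "v i j ?l * zp g r = zp (Suc (Suc g)) r * v i j ?l"
    using True i by (intro v_zp_shift) auto
  also have "\<dots> * v g h m = zp (Suc (Suc g)) r * (v i j ?l * v g h m)"
    by (simp add: mult.assoc)
  also have "v i j ?l * v g h m = v (Suc (Suc g)) (Suc (Suc h)) ?l * v i j m"
    using True i by (intro v_v_shift2) auto
  also have "zp i p * (zp (Suc (Suc g)) r * \<dots>) = zp (Suc (Suc g)) r * (zp i p * \<dots>)"
    by (rule comm_left[OF zp_Bs[OF zpi(2)]]) (use i in auto)
  also have "zp i p * (v (Suc (Suc g)) (Suc (Suc h)) ?l * v i j m)
      = v (Suc (Suc g)) (Suc (Suc h)) ?l * (zp i p * v i j m)"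
    by (rule comm_left[OF v_Bs[OF zpi(2), symmetric]]) (use i in auto)
  also have "zp (Suc (Suc g)) r * \<dots> \<in> ?T"
    using i True r zpi by (intro higherI_v) auto
  finally show ?thesis .
next
  case False
  then have gj: "g < j" by simp
  let ?l = "Suc (Suc m)"
  have gn: "1 \<le> g" "g < n" using i by auto
  let ?w = "v (Suc g) j ?l"
  let ?D = "zp (Suc g) r * X g - X g * zp g r"
  let ?c = "zp i p * xs i g"
  have cB: "?c \<in> Bs g" using i by (intro Bs_mult Bs_zp' Bs_xs) auto
  have cBm: "?c \<in> Bs (Suc m)" using Bs_mono[OF cB] i by simp
  have wz: "?w * z = z * ?w" if "z \<in> Bs g" for z
    by (rule v_Bs[OF that]) (use i gj in auto)
  have zgB: "zp g t \<in> Bs g" "zp g t \<in> Bs (Suc m)" for t using i by (auto intro!: Bs_zp')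
  have vi: "v i j ?l = xs i g * (X g * ?w)"
    using i gj by (simp add: v_split[of i g j] v_Cons[of g])
  have c3: "zp (Suc g) t * ?c = ?c * zp (Suc g) t" for t
    using zp_Bs[OF cB, of "Suc g" t] i by simp
  have "zp i p * (v i j ?l * (zp g r * v g h m)) = ?c * (X g * (?w * (zp g r * v g h m)))"
    by (simp add: vi mult.assoc)
  also have "?w * (zp g r * v g h m) = zp g r * (?w * v g h m)"
    by (rule comm_left[OF wz[OF zgB(1)]])
  \<comment> \<open>The power crosses \<open>X g\<close> and becomes \<open>zp (Suc g) r\<close>.
    The first term is the subject of \<open>swap_main\<close>; \<open>?D\<close> is expanded by
    \<open>zpS_X\<close>.\<close>
  also have "?c * (X g * \<dots>) = (?c * zp (Suc g) r) * (X g * (?w * v g h m)) - ?c * ?D * (?w * v g h m)"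
    by (simp add: ring_distribs mult.assoc)
  also have "(?c * zp (Suc g) r) * (X g * (?w * v g h m)) = zp i p * (zp (Suc g) r * (v i j ?l * v g h m))"
  proof -
    have "zp (Suc g) r * xs i g = xs i g * zp (Suc g) r"
      using zp_Bs[OF Bs_xs[of i g g], of "Suc g" r] i by simp
    from comm_left[OF this] show ?thesis by (simp add: vi mult.assoc)
  qed
  also have "\<dots> - ?c * ?D * (?w * v g h m) \<in> ?T"
  proof (rule md.span_diff)
    show "zp i p * (zp (Suc g) r * (v i j ?l * v g h m)) \<in> ?T"
      using swap_main[of i g j m h r p] i gj r by simp
    show "?c * ?D * (?w * v g h m) \<in> ?T"
    proof (rule span_mult2[OF zpS_X[OF gn]])
      fix x assume "x \<in> mids' g r"
      then obtain s u where x: "x = zp (Suc g) s * u * zp g (r - s)" "sbtw r s" "u = 1 \<or> u = e g"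
        by (auto simp: mids'_def)
      let ?t = "r - s"
      show "?c * x * (?w * v g h m) \<in> ?T"
      proof (cases "u = 1")
        case True
        have sP: "s \<in> Pset k" using Pset_btw[OF r sbtw_btw[OF x(2)]] .
        have "?c * x * (?w * v g h m) = (?c * zp (Suc g) s) * (zp g ?t * (?w * v g h m))"
          by (simp add: x(1) True mult.assoc)
        also have "zp g ?t * (?w * v g h m) = ?w * (zp g ?t * v g h m)"
          by (rule comm_left[OF wz[OF zgB(1), symmetric]])
        also have "(?c * zp (Suc g) s) * \<dots> = zp (Suc g) s * (?c * (?w * (zp g ?t * v g h m)))"
          by (simp only: c3[symmetric] mult.assoc[of "zp (Suc g) s"])
        also have "?c * (?w * (zp g ?t * v g h m)) = ?w * (?c * (zp g ?t * v g h m))"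
          by (rule comm_left[OF wz[OF cB, symmetric]])
        also have "zp (Suc g) s * \<dots> = zp (Suc g) s * (?w * ((?c * zp g ?t) * v g h m))"
          by (simp add: mult.assoc)
        also have "\<dots> \<in> ?T"
          using i gj sP by (intro higherI_v Bs_mult[OF cBm zgB(2)]) auto
        finally show ?thesis .
      next
        case False
        \<comment> \<open>\<open>?q\<close> is the largest radius of an interval around
          \<open>0\<close> inside \<open>Pset k\<close>, and \<open>Pset_sbtw\<close> bounds
          \<open>?t\<close> by it. The inverse crossings from \<open>e_v\<close> act on the second
          arc without lowering its first index below \<open>g\<close>; the hook left behind is the
          arc \<open>v g g ?l\<close>, and every arc starting at \<open>g\<close> or later is
          disjoint from it.\<close>
        let ?q = "(int k - 1) div 2"
        let ?z = "?c * zp g (- s)"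
        have zB: "?z \<in> Bs g" "?z \<in> Bs (Suc m)" using cB cBm zgB by (auto intro!: Bs_mult)
        have q: "0 \<le> ?q" using k_pos by simp
        obtain cs where cs: "set cs \<subseteq> {g..<j - 1}" "e g * ?w = v g g ?l * ev (map Xm cs)"
          using e_v[of g j ?l] i gj by auto
        have "v g h m * 1 \<in> Bs (Suc m)" using i by (auto intro!: Bs_v)
        have "zp g ?t * (v g h m * 1) \<in> Sp m (m - 1) (\<lambda>i p. g \<le> i \<and> \<bar>p\<bar> \<le> ?q)"
          using i Pset_sbtw[OF r x(2)] by (intro SpI Bs_1) auto
        then have M: "ev (map Xm cs) * (zp g ?t * (v g h m * 1)) \<in> Sp m (m - 1) (\<lambda>i p. g \<le> i \<and> \<bar>p\<bar> \<le> ?q)"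
        proof (intro Sp_ge_closed_Xm)
          have "{g..<j - 1} \<subseteq> {g..m}" using i by auto
          then show "set cs \<subseteq> {g..m}" using cs(1) by blast
        qed (use i q in auto)
        have "?c * x * (?w * v g h m) = ?c * ((zp (Suc g) s * e g) * (zp g ?t * (?w * v g h m)))"
          using False x(3) by (simp add: x(1) mult.assoc)
        also have "zp (Suc g) s * e g = zp g (- s) * e g"
          by (rule zpS_e[OF gn])
        also have "zp g ?t * (?w * v g h m) = ?w * (zp g ?t * v g h m)"
          by (rule comm_left[OF wz[OF zgB(1), symmetric]])
        also have "?c * ((zp g (- s) * e g) * \<dots>) = ?z * ((e g * ?w) * (zp g ?t * (v g h m * 1)))"
          by (simp add: mult.assoc)
        also have "\<dots> = (?z * v g g ?l) * (ev (map Xm cs) * (zp g ?t * (v g h m * 1)))"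
          unfolding cs(2) by (simp add: mult.assoc)
        also have "\<dots> \<in> ?T"
        proof (rule span_multL[OF M])
          fix a assume "a \<in> Sg m (m - 1) (\<lambda>i p. g \<le> i \<and> \<bar>p\<bar> \<le> ?q)"
          then obtain i' j' t' y where a: "a = zp i' t' * (v i' j' m * y)" "g \<le> i'" "\<bar>t'\<bar> \<le> ?q"
            "i' \<le> j'" "j' \<le> Suc (m - 1)" "y \<in> Bs (m - 1)"
            unfolding Sg_def by blast
          have j': "j' \<le> m" using a i by simp
          have y: "y \<in> Bs (Suc m)" using Bs_mono[OF a(6)] by simp
          have ey: "e m * y = y * e m" by (rule e_Bs[OF a(6)]) (use i in auto)
          let ?u = "v (Suc (Suc i')) (Suc (Suc j')) ?l"
          have "(?z * v g g ?l) * a = ?z * ((v g g ?l * zp i' t') * (v i' j' m * y))"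
            by (simp add: a(1) mult.assoc)
          also have "v g g ?l * zp i' t' = zp (Suc (Suc i')) t' * v g g ?l"
            using i a j' by (intro v_zp_shift) auto
          also have "\<dots> * (v i' j' m * y) = zp (Suc (Suc i')) t' * ((v g g ?l * v i' j' m) * y)"
            by (simp add: mult.assoc)
          also have "v g g ?l * v i' j' m = ?u * v g g m"
            using i a j' by (intro v_v_shift2) auto
          also have "?z * (zp (Suc (Suc i')) t' * (?u * v g g m * y))
              = zp (Suc (Suc i')) t' * (?z * (?u * v g g m * y))"
            by (rule comm_left[OF zp_Bs[OF zB(1)]]) (use i a j' in auto)
          also have "?z * (?u * v g g m * y) = ?u * (?z * (v g g m * y))"
            using comm_left[OF v_Bs[OF zB(1), symmetric], of "Suc (Suc i')" "Suc (Suc j')" ?l] i a j'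
            by (simp add: mult.assoc)
          also have "v g g m * y = (es g m * y) * e m"
            using i by (simp add: v_end ey mult.assoc)
          also have "zp (Suc (Suc i')) t' * (?u * (?z * (es g m * y * e m)))
              = zp (Suc (Suc i')) t' * (?u * ((?z * (es g m * y)) * e m))"
            by (simp add: mult.assoc)
          also have "\<dots> \<in> ?T"
            using i a j' y zB Pset_small[OF a(3)] by (intro higherI Bs_mult[OF zB(2)] Bs_mult[OF Bs_es]) auto
          finally show "(?z * v g g ?l) * a \<in> ?T" .
        qed
        finally show ?thesis .
      qed
    qed
  qed
  finally show ?thesis .
qed

end

subsection \<open>Ordered products\<close>

text \<open>In \<open>ordw k N m c u u'\<close> the word \<open>u\<close> is a product of \<open>m\<close> words \<open>alpha\<close> with decreasing
  first indices below \<open>c\<close>, and \<open>u'\<close> is the same product with all upper indices lowered by one.\<close>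

inductive ordw :: "nat \<Rightarrow> nat \<Rightarrow> nat \<Rightarrow> nat \<Rightarrow> bgen list \<Rightarrow> bgen list \<Rightarrow> bool" for k where
  ordw_0: "ordw k N 0 c [] []"
| ordw_Suc: "1 \<le> i \<Longrightarrow> i < c \<Longrightarrow> i \<le> j \<Longrightarrow> j \<le> Suc N \<Longrightarrow> s \<in> Pset k \<Longrightarrow> ordw k N m i u u'
    \<Longrightarrow> ordw k (Suc (Suc N)) (Suc m) c (alpha_w i j (Suc N) s @ u) (alpha_w i j N s @ u')"

context cyc_bmw begin

fun EP :: "nat \<Rightarrow> nat \<Rightarrow> 'b" where
  "EP N 0 = 1"
| "EP N (Suc m) = e (N - 1) * EP (N - 2) m"

lemma EP_Bs: "2 * m \<le> N \<Longrightarrow> EP N m \<in> Bs N"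
proof (induction m arbitrary: N)
  case 0
  then show ?case by (simp add: Bs_1)
next
  case (Suc m)
  then have "EP (N - 2) m \<in> Bs (N - 2)" by simp
  from Bs_mono[OF this, of N] show ?case using Suc by (auto intro!: Bs_mult Bs_e)
qed

lemma EP_comm: "2 * m \<le> N \<Longrightarrow> N \<le> n \<Longrightarrow> z \<in> Bs (N - 2 * m) \<Longrightarrow> EP N m * z = z * EP N m"
proof (induction m arbitrary: N)
  case 0
  then show ?case by simp
next
  case (Suc m)
  have "N - 2 * Suc m = N - 2 - 2 * m" by simp
  then have 1: "EP (N - 2) m * z = z * EP (N - 2) m" using Suc by simp
  have 2: "e (N - 1) * z = z * e (N - 1)" by (rule e_Bs[OF Suc.prems(3)]) (use Suc in auto)
  show ?case by (simp add: 1 mult.assoc comm_left[OF 2[simplified]])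
qed

lemma star_EP: "2 * m \<le> N \<Longrightarrow> N \<le> n \<Longrightarrow> star (EP N m) = EP N m"
proof (induction m arbitrary: N)
  case 0
  then show ?case by simp
next
  case (Suc m)
  then have "EP (N - 2) m \<in> Bs (N - 2)" by (intro EP_Bs) auto
  from e_Bs[OF this, of "N - 1"] Suc show ?case by (simp add: star_mult)
qed

lemma EP_e: "2 * Suc m \<le> N \<Longrightarrow> EP N m * e (N - 2 * m - 1) = EP N (Suc m)"
proof (induction m arbitrary: N)
  case 0
  then show ?case by simp
next
  case (Suc m)
  have "N - 2 * Suc m - 1 = N - 2 - 2 * m - 1" by simp
  moreover have "EP (N - 2) m * e (N - 2 - 2 * m - 1) = EP (N - 2) (Suc m)"
    by (rule Suc.IH) (use Suc.prems in simp)
  ultimately show ?case by (simp only: EP.simps mult.assoc)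
qed

text \<open>The last hook of each arc commutes with all later factors of \<open>u'\<close>, so the
  last hooks collect at the right as \<open>EP N m\<close>. As this middle product is needed only
  once, the starred factors of the theorem have upper indices lower by one.\<close>

lemma ordw_ev:
  assumes "ordw k N m c u u'" "N \<le> n"
  shows "ev u' \<in> Bs (N - 1) \<and> ev u = ev u' * EP N m"
  using assms
proof (induction rule: ordw.induct)
  case (ordw_0 N c)
  then show ?case by (simp add: Bs_1)
next
  case (ordw_Suc i c j N s m u u')
  then have IH: "ev u' \<in> Bs (N - 1)" "ev u = ev u' * EP N m" by auto
  have c: "e (Suc N) * ev u' = ev u' * e (Suc N)"
    by (rule e_Bs[OF IH(1)]) (use ordw_Suc in auto)
  have v: "v i j (Suc N) = v i j N * e (Suc N)"
    using ordw_Suc by (simp add: v_def es_snoc[of j "Suc N"] mult.assoc)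
  have "zp i s * v i j N * ev u' \<in> Bs (Suc N)"
    using ordw_Suc Bs_mono[OF IH(1), of "Suc N"] by (intro Bs_mult Bs_zp' Bs_v) auto
  then show ?case
    by (simp add: ev_append ev_alpha IH(2) v mult.assoc comm_left[OF c])
qed

definition ordered_prods :: "nat \<Rightarrow> nat \<Rightarrow> 'b set" where
  "ordered_prods N m = {ev u * y | u u' y. ordw k N m N u u' \<and> y \<in> Bs (N - 2 * m)}"

lemma Bs_EP_span:
  "2 * m \<le> N \<Longrightarrow> N \<le> n \<Longrightarrow> x \<in> Bs N \<Longrightarrow> x * EP N m \<in> md.span (ordered_prods N m)"
proof (induction m arbitrary: N x)
  case 0
  then show ?case
    unfolding ordered_prods_def by (intro md.span_base) (auto intro!: exI[of _ "[]"] ordw_0)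
next
  case (Suc m)
  define M where "M = N - 2"
  let ?l = "Suc M"
  let ?O = "md.span (ordered_prods N (Suc m))"
  have N: "N = Suc ?l" "2 * m \<le> M" "?l < n" using Suc.prems by (auto simp: M_def)
  have IHm: "y * EP M m \<in> md.span (ordered_prods M m)" if "y \<in> Bs M" for y
    using Suc.IH[of M y] that N by simp
  have main: "zp i p * (v i j ?l * (y * EP M m)) \<in> ?O"
    if "1 \<le> i" "i \<le> j" "j \<le> ?l" "p \<in> Pset k" "y \<in> Bs M" for i j p y
    using that
  proof (induction "?l - i" arbitrary: i j p y rule: less_induct)
    case less
    have "(zp i p * v i j ?l) * (y * EP M m) \<in> ?O"
    proof (rule span_multL[OF IHm[OF less.prems(5)]])
      fix s assume "s \<in> ordered_prods M m"
      then obtain u u' y' where s: "s = ev u * y'" "ordw k M m M u u'" "y' \<in> Bs (M - 2 * m)"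
        by (auto simp: ordered_prods_def)
      have inO: "(zp i p * v i j ?l) * s \<in> ?O" if "ordw k M m i u u'"
      proof -
        have "ordw k N (Suc m) N (alpha_w i j ?l p @ u) (alpha_w i j M p @ u')"
          unfolding N(1) using less.prems that by (intro ordw_Suc) auto
        then have "ev (alpha_w i j ?l p @ u) * y' \<in> ?O"
          unfolding ordered_prods_def using s(3) N(1) by (intro md.span_base) auto
        then show ?thesis by (simp add: s(1) ev_append ev_alpha mult.assoc)
      qed
      from s(2) show "(zp i p * v i j ?l) * s \<in> ?O"
      proof cases
        case ordw_0
        then show ?thesis using inO ordw.ordw_0 by simp
      next
        case (ordw_Suc g h L r m2 u2 u2')
        show ?thesis
        proof (cases "g < i")
          case True
          then have "ordw k M m i u u'" using ordw_Suc by (auto intro: ordw.ordw_Suc)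
          then show ?thesis by (rule inO)
        next
          case False
          let ?m' = "Suc L"
          have u2: "ev u2' \<in> Bs (L - 1)" "ev u2 = ev u2' * EP L m2"
            using ordw_ev[of L m2 g u2 u2'] ordw_Suc N by auto
          have u2B: "ev u2' \<in> Bs L" using Bs_mono[OF u2(1)] by simp
          have c: "e ?m' * ev u2' = ev u2' * e ?m'"
            by (rule e_Bs[OF u2B]) (use ordw_Suc N in auto)
          have y'B: "y' \<in> Bs M" using Bs_mono[OF s(3)] by simp
          \<comment> \<open>Terms of \<open>higher\<close> end in \<open>e ?m'\<close>. Together
            with the last hooks of the remaining arcs it restores \<open>EP M m\<close>, the shape
            to which the induction on the first index applies.\<close>
          have eu: "e ?m' * (ev u2 * y') = (ev u2' * y') * EP M m"
          proof -
            have "e ?m' * (ev u2 * y') = ev u2' * ((e ?m' * EP L m2) * y')"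
              by (simp add: u2(2) mult.assoc comm_left[OF c])
            also have "e ?m' * EP L m2 = EP M m" using ordw_Suc by simp
            also have "\<dots> * y' = y' * EP M m"
              using EP_comm[of m M y'] s(3) N by simp
            finally show ?thesis by (simp add: mult.assoc)
          qed
          have "(zp i p * v i j ?l) * s = zp i p * (v i j ?l * (zp g r * v g h ?m')) * (ev u2 * y')"
            using ordw_Suc by (simp add: s(1) ev_append ev_alpha mult.assoc)
          also have "\<dots> \<in> ?O"
          proof (rule span_multR[where S = "higher ?m' i"])
            show "zp i p * (v i j ?l * (zp g r * v g h ?m')) \<in> md.span (higher ?m' i)"
              using swap[of i j ?m' g h r p] ordw_Suc False less.prems N by simp
          next
            fix a assume "a \<in> higher ?m' i"
            then obtain i' p' j' z where a: "a = zp i' p' * (v i' j' ?l * (z * e ?m'))"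
              "i < i'" "i' \<le> j'" "j' \<le> ?l" "p' \<in> Pset k" "z \<in> Bs M"
              unfolding higher_def using ordw_Suc(1) by auto
            have "a * (ev u2 * y') = zp i' p' * (v i' j' ?l * ((z * (ev u2' * y')) * EP M m))"
              by (simp add: a(1) eu mult.assoc)
            also have "\<dots> \<in> ?O"
              using a less.prems y'B Bs_mono[OF u2B, of M] ordw_Suc(1)
              by (intro less.hyps Bs_mult) auto
            finally show "a * (ev u2 * y') \<in> ?O" .
          qed
          finally show ?thesis .
        qed
      qed
    qed
    then show ?case by (simp add: mult.assoc)
  qed
  have "x * e ?l \<in> Sp ?l M (\<lambda>i p. p \<in> Pset k)"
    using Bs_e_span[of ?l x] Suc.prems N by simp
  then have "(x * e ?l) * EP M m \<in> ?O"
  proof (rule span_multR)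
    fix s assume "s \<in> Sg ?l M (\<lambda>i p. p \<in> Pset k)"
    then obtain i j p y where "s = zp i p * (v i j ?l * y)" "p \<in> Pset k" "1 \<le> i" "i \<le> j" "j \<le> ?l" "y \<in> Bs M"
      unfolding Sg_def by blast
    then show "s * EP M m \<in> ?O" using main[of i j p y] by (simp add: mult.assoc)
  qed
  then show ?case by (simp add: N(1) mult.assoc)
qed

text \<open>Inserting \<open>e i = e i * (e (Suc i) * e i)\<close> repeatedly reaches
  \<open>e (L - 1)\<close>. Hence an element of \<open>e_ideal (N - 2 * m)\<close> next to
  \<open>EP N m\<close> contains the hook that extends it to \<open>EP N (Suc m)\<close>.\<close>

lemma e_via_last: "1 \<le> i \<Longrightarrow> i < L \<Longrightarrow> L \<le> n \<Longrightarrow> \<exists>a \<in> Bs L. \<exists>b \<in> Bs L. e i = a * e (L - 1) * b"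
proof (induction "L - i" arbitrary: i)
  case 0
  then show ?case by simp
next
  case (Suc d)
  show ?case
  proof (cases "Suc i = L")
    case True
    then show ?thesis using Bs_1 by (intro bexI[of _ 1]) auto
  next
    case False
    then have a: "adj i (Suc i)" using Suc.prems by (simp add: adj_def)
    obtain a b where ab: "a \<in> Bs L" "b \<in> Bs L" "e (Suc i) = a * e (L - 1) * b"
      using Suc.hyps(1)[of "Suc i"] Suc.hyps(2) Suc.prems False by fastforce
    have "e i = e i * (e (Suc i) * e i)" using EEEa[OF a] by simp
    also have "\<dots> = (e i * a) * e (L - 1) * (b * e i)" by (simp add: ab(3) mult.assoc)
    finally show ?thesis using ab Bs_e Suc.prems by (blast intro: Bs_mult)
  qed
qed

definition e_ideal :: "nat \<Rightarrow> 'b set" where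
  "e_ideal l = {x * e i * y | x i y. 1 \<le> i \<and> i < l \<and> x \<in> Bs l \<and> y \<in> Bs l}"

text \<open>\<open>C l\<close> plays the role of the chosen lift of a basis of the Ariki--Koike algebra.\<close>

definition spanners :: "nat \<Rightarrow> (nat \<Rightarrow> 'b set) \<Rightarrow> 'b set" where
  "spanners N C = {ev u * z * ev (rev w') | m u u' z w w'.
     ordw k N m N u u' \<and> ordw k N m N w w' \<and> z \<in> C (N - 2 * m)}"

text \<open>Ordered products on the left and, by \<open>star\<close>, on the right leave a middle
  factor in \<open>Bs (N - 2 * m)\<close>. Its part in \<open>e_ideal\<close> raises
  \<open>m\<close> by one; the induction ends because this ideal has no generators once
  \<open>N - 2 * m \<le> 1\<close>.\<close>

lemma Bs_EP_Bs_span: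
  assumes C: "\<And>l z. l \<le> N \<Longrightarrow> z \<in> Bs l \<Longrightarrow> z \<in> md.span (C l \<union> e_ideal l)"
    and N: "N \<le> n" and m: "2 * m \<le> N" and xy: "x \<in> Bs N" "y \<in> Bs N"
  shows "x * EP N m * y \<in> md.span (spanners N C)" (is "_ \<in> ?T")
  using m xy
proof (induction "N - m" arbitrary: m x y rule: less_induct)
  case less
  let ?L = "N - 2 * m"
  have right: "star (star y * EP N m) \<in> md.span (star ` ordered_prods N m)"
    by (intro span_star Bs_EP_span star_Bs less.prems N)
  have right': "EP N m * y \<in> md.span (star ` ordered_prods N m)"
    using right less.prems N by (simp add: star_mult star_EP)
  have comm: "EP N m * z = z * EP N m" if "z \<in> Bs ?L" for z
    using EP_comm that less.prems N by simp
  show ?case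
  proof (rule span_multR[OF Bs_EP_span[OF less.prems(1) N less.prems(2)]])
    fix s assume "s \<in> ordered_prods N m"
    then obtain u u' z where s: "s = ev u * z" "ordw k N m N u u'" "z \<in> Bs ?L"
      by (auto simp: ordered_prods_def)
    note u = ordw_ev[OF s(2) N]
    have "(ev u' * z) * (EP N m * y) \<in> ?T"
    proof (rule span_multL[OF right'])
      fix t assume "t \<in> star ` ordered_prods N m"
      then obtain w w' z' where t: "t = star (ev w * z')" "ordw k N m N w w'" "z' \<in> Bs ?L"
        by (auto simp: ordered_prods_def)
      note w = ordw_ev[OF t(2) N]
      have B: "ev u' \<in> Bs N" "ev (rev w') \<in> Bs N" "\<And>z. z \<in> Bs ?L \<Longrightarrow> z \<in> Bs N"
        using u w star_Bs[of "ev w'" "N - 1"] Bs_mono[of _ "N - 1" N] Bs_mono[of _ ?L N]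
        by (auto simp: star_ev)
      have zz: "z * star z' \<in> Bs ?L" using s t star_Bs Bs_mult by blast
      have "(ev u' * z) * t = ev u' * ((z * star z') * EP N m) * ev (rev w')"
        using w less.prems N by (simp add: t(1) star_mult star_EP mult.assoc flip: star_ev)
      also have "\<dots> = ev u * (z * star z') * ev (rev w')"
        unfolding comm[OF zz, symmetric] using u by (simp add: mult.assoc)
      also have "\<dots> \<in> ?T"
      proof (rule span_mult2[OF C[OF _ zz]])
        fix a assume "a \<in> C ?L \<union> e_ideal ?L"
        then show "ev u * a * ev (rev w') \<in> ?T"
        proof
          assume "a \<in> C ?L"
          then show ?thesis
            unfolding spanners_def using s(2) t(2) by (intro md.span_base) blast
        next
          assume "a \<in> e_ideal ?L"
          then obtain x1 i y1 where a: "a = x1 * e i * y1" "1 \<le> i" "i < ?L" "x1 \<in> Bs ?L" "y1 \<in> Bs ?L"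
            by (auto simp: e_ideal_def)
          obtain a1 b1 where ab: "a1 \<in> Bs ?L" "b1 \<in> Bs ?L" "e i = a1 * e (?L - 1) * b1"
            using e_via_last[OF a(2,3) le_trans[OF diff_le_self N]] by auto
          have c: "EP N m * (x1 * a1) = (x1 * a1) * EP N m"
            by (intro comm Bs_mult a ab)
          have "ev u * a * ev (rev w')
            = ev u' * ((EP N m * (x1 * a1)) * (e (?L - 1) * (b1 * (y1 * ev (rev w')))))"
            using u by (simp add: a(1) ab(3) mult.assoc)
          also have "\<dots> = (ev u' * (x1 * a1)) * (EP N m * e (?L - 1)) * (b1 * (y1 * ev (rev w')))"
            unfolding c by (simp add: mult.assoc)
          also have "EP N m * e (?L - 1) = EP N (Suc m)"
            using a by (intro EP_e) auto
          also have "(ev u' * (x1 * a1)) * EP N (Suc m) * (b1 * (y1 * ev (rev w'))) \<in> ?T"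
            using a ab B by (intro less.hyps Bs_mult) auto
          finally show ?thesis .
        qed
      qed simp
      finally show "(ev u' * z) * t \<in> ?T" .
    qed
    moreover have "s * y = (ev u' * z) * (EP N m * y)"
    proof -
      have "s * y = ev u' * ((EP N m * z) * y)" using u by (simp add: s(1) mult.assoc)
      then show ?thesis by (simp add: comm[OF s(3)] mult.assoc)
    qed
    ultimately show "s * y \<in> ?T" by simp
  qed
qed

theorem Bs_span_spanners:
  assumes "\<And>l z. l \<le> N \<Longrightarrow> z \<in> Bs l \<Longrightarrow> z \<in> md.span (C l \<union> e_ideal l)"
    and "N \<le> n" "x \<in> Bs N"
  shows "x \<in> md.span (spanners N C)"
  using Bs_EP_Bs_span[of N C 0 x 1] assms Bs_1 by simp

end

subsection \<open>From ordered words to \<open>bmw_span_set\<close>\<close>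

text \<open>\<open>bmw_span_set\<close> depends on the indexed families only through their ranges, so that it may be
  indexed by the elements themselves.\<close>

abbreviation bmw_spanning :: "nat \<Rightarrow> nat \<Rightarrow> (nat \<Rightarrow> (bgen list \<Rightarrow> 'a::comm_ring_1) set) \<Rightarrow> (bgen list \<Rightarrow> 'a) set" where
  "bmw_spanning n k Xs \<equiv> bmw_span_set n k Xs (\<lambda>l x. x)"

lemma bmw_span_set_eq: "bmw_span_set n k Ix xb = bmw_spanning n k (\<lambda>l. xb l ` Ix l)"
  by (simp add: bmw_span_set_def chiset_def)

lemma ordw_functions:
  assumes "ordw k N m c u u'"
  shows "\<exists>i j s. (\<forall>f. 1 \<le> f \<and> f < m \<longrightarrow> i (Suc f) < i f) \<and> (1 \<le> m \<longrightarrow> i (Suc 0) < c) \<and> 2 * m \<le> N \<and>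
    (\<forall>f. 1 \<le> f \<and> f \<le> m \<longrightarrow> 1 \<le> i f \<and> i f \<le> j f \<and> j f \<le> N - 2 * f + 1 \<and> s f \<in> Pset k) \<and>
    u = concat (map (\<lambda>f. alpha_w (i f) (j f) (N - 2 * f + 1) (s f)) [1..<m + 1]) \<and>
    u' = concat (map (\<lambda>f. alpha_w (i f) (j f) (N - 2 * f) (s f)) [1..<m + 1])"
  using assms
proof (induction rule: ordw.induct)
  case (ordw_0 N c)
  then show ?case by simp
next
  case (ordw_Suc i0 c j0 N s0 m u u')
  then obtain i j s where IH:
    "\<And>f. 1 \<le> f \<and> f < m \<Longrightarrow> i (Suc f) < i f" "1 \<le> m \<Longrightarrow> i (Suc 0) < i0" "2 * m \<le> N"
    "\<And>f. 1 \<le> f \<and> f \<le> m \<Longrightarrow> 1 \<le> i f \<and> i f \<le> j f \<and> j f \<le> N - 2 * f + 1 \<and> s f \<in> Pset k"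
    "u = concat (map (\<lambda>f. alpha_w (i f) (j f) (N - 2 * f + 1) (s f)) [1..<m + 1])"
    "u' = concat (map (\<lambda>f. alpha_w (i f) (j f) (N - 2 * f) (s f)) [1..<m + 1])"
    by blast
  define i' where "i' f = (if f = Suc 0 then i0 else i (f - 1))" for f
  define j' where "j' f = (if f = Suc 0 then j0 else j (f - 1))" for f
  define s' where "s' f = (if f = Suc 0 then s0 else s (f - 1))" for f
  have list: "[1..<Suc m + 1] = 1 # map Suc [1..<m + 1]"
    by (simp add: map_Suc_upt upt_conv_Cons del: upt_Suc)
  have cong: "concat (map F [1..<m + 1]) = concat (map G [1..<m + 1])"
    if "\<And>f. 1 \<le> f \<Longrightarrow> F f = G f" for F G :: "nat \<Rightarrow> bgen list"
    using that by (intro arg_cong[where f = concat] map_cong) auto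
  have A: "i' (Suc f) < i' f" if f: "1 \<le> f \<and> f < Suc m" for f
  proof (cases "f = 1")
    case True
    then show ?thesis using IH(2) f by (simp add: i'_def)
  next
    case False
    then obtain f' where "f = Suc f'" "1 \<le> f'" using f by (cases f) auto
    then show ?thesis using IH(1)[of f'] f by (simp add: i'_def)
  qed
  have B: "1 \<le> i' f \<and> i' f \<le> j' f \<and> j' f \<le> Suc (Suc N) - 2 * f + 1 \<and> s' f \<in> Pset k"
    if f: "1 \<le> f \<and> f \<le> Suc m" for f
  proof (cases "f = 1")
    case True
    then show ?thesis using ordw_Suc by (simp add: i'_def j'_def s'_def)
  next
    case False
    then obtain f' where "f = Suc f'" "1 \<le> f'" using f by (cases f) auto
    then show ?thesis using IH(4)[of f'] f by (simp add: i'_def j'_def s'_def)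
  qed
  have "alpha_w i0 j0 (Suc N) s0 @ u =
    concat (map (\<lambda>f. alpha_w (i' f) (j' f) (Suc (Suc N) - 2 * f + 1) (s' f)) [1..<Suc m + 1])"
    unfolding list IH(5) using cong[of "\<lambda>f. alpha_w (i f) (j f) (N - 2 * f + 1) (s f)"
      "\<lambda>f. alpha_w (i' (Suc f)) (j' (Suc f)) (Suc (Suc N) - 2 * Suc f + 1) (s' (Suc f))"]
    by (simp add: i'_def j'_def s'_def o_def)
  moreover have "alpha_w i0 j0 N s0 @ u' =
    concat (map (\<lambda>f. alpha_w (i' f) (j' f) (Suc (Suc N) - 2 * f) (s' f)) [1..<Suc m + 1])"
    unfolding list IH(6) using cong[of "\<lambda>f. alpha_w (i f) (j f) (N - 2 * f) (s f)"
      "\<lambda>f. alpha_w (i' (Suc f)) (j' (Suc f)) (Suc (Suc N) - 2 * Suc f) (s' (Suc f))"]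
    by (simp add: i'_def j'_def s'_def o_def)
  moreover have "1 \<le> Suc m \<longrightarrow> i' (Suc 0) < c" "2 * Suc m \<le> Suc (Suc N)"
    using IH(3) ordw_Suc by (auto simp: i'_def)
  moreover have "\<forall>f. 1 \<le> f \<and> f < Suc m \<longrightarrow> i' (Suc f) < i' f"
    using A by blast
  moreover have "\<forall>f. 1 \<le> f \<and> f \<le> Suc m \<longrightarrow>
      1 \<le> i' f \<and> i' f \<le> j' f \<and> j' f \<le> Suc (Suc N) - 2 * f + 1 \<and> s' f \<in> Pset k"
    using B by blast
  ultimately show ?case
    by (intro exI[of _ i'] exI[of _ j'] exI[of _ s'] conjI)
qed

lemma ordw_bmw_spanning:
  assumes u: "ordw k n m n u u'" and w: "ordw k n m n w w'"
    and chi: "chi \<in> chiset (n - 2 * m) (Xs (n - 2 * m)) (\<lambda>x. x)"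
  shows "fa_mult (fa_mult (fa_mono u) chi) (fa_mono (rev w')) \<in> bmw_spanning n k Xs"
proof -
  obtain i j s where 1: "\<forall>f. 1 \<le> f \<and> f < m \<longrightarrow> i (Suc f) < i f" "2 * m \<le> n"
    "\<forall>f. 1 \<le> f \<and> f \<le> m \<longrightarrow> 1 \<le> i f \<and> i f \<le> j f \<and> j f \<le> n - 2 * f + 1 \<and> s f \<in> Pset k"
    "u = concat (map (\<lambda>f. alpha_w (i f) (j f) (n - 2 * f + 1) (s f)) [1..<m + 1])"
    using ordw_functions[OF u] by blast
  obtain g h t where 2: "\<forall>f. 1 \<le> f \<and> f < m \<longrightarrow> g (Suc f) < g f"
    "\<forall>f. 1 \<le> f \<and> f \<le> m \<longrightarrow> 1 \<le> g f \<and> g f \<le> h f \<and> h f \<le> n - 2 * f + 1 \<and> t f \<in> Pset k"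
    "w' = concat (map (\<lambda>f. alpha_w (g f) (h f) (n - 2 * f) (t f)) [1..<m + 1])"
    using ordw_functions[OF w] by blast
  have r: "rev w' = concat (map (\<lambda>f. rev (alpha_w (g f) (h f) (n - 2 * f) (t f))) (rev [1..<m + 1]))"
    unfolding 2(3) by (simp add: rev_concat rev_map o_def del: upt_Suc)
  have "m \<le> n div 2" using 1(2) by simp
  moreover have "\<forall>f. 1 \<le> f \<and> f < m \<longrightarrow> i (Suc f) < i f \<and> g (Suc f) < g f"
    using 1(1) 2(1) by blast
  moreover have "\<forall>f. 1 \<le> f \<and> f \<le> m \<longrightarrow> 1 \<le> i f \<and> i f \<le> j f \<and> j f \<le> n - 2 * f + 1 \<and>
      1 \<le> g f \<and> g f \<le> h f \<and> h f \<le> n - 2 * f + 1 \<and> s f \<in> Pset k \<and> t f \<in> Pset k"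
    using 1(3) 2(2) by blast
  ultimately show ?thesis
    unfolding bmw_span_set_def r 1(4) using chi by blast
qed

context cyc_bmw begin

subsection \<open>The Ariki--Koike quotient\<close>

lemma pe_ev: "pe w = ev w"
  by (simp add: ev_def)

text \<open>A section of \<open>pi\<close>: its values satisfy the Ariki--Koike relations only
  modulo the ideal of the \<open>e i\<close>. Words in \<open>ideal_gens\<close> may contain letters
  that are not admissible for \<open>l\<close>; these go to \<open>0\<close>, so that every value
  lies in \<open>Bs l\<close>.\<close>

definition tg :: "'a \<Rightarrow> 'a \<Rightarrow> nat \<Rightarrow> tgen \<Rightarrow> 'b" where
  "tg q qi l g = (if ak_letter l g then
     (case g of T0p \<Rightarrow> Y | T0m \<Rightarrow> Yi | Tp i \<Rightarrow> sc q * X i | Tm i \<Rightarrow> sc qi * Xi i) else 0)"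

sublocale th: fa_eval sc "tg q qi l" for q qi l
  by unfold_locales (rule sc_add sc_mult sc_one sc_central)+

abbreviation EI :: "nat \<Rightarrow> 'b set" where "EI l \<equiv> md.span (e_ideal l)"

lemma EI_mult: "z \<in> EI l \<Longrightarrow> x \<in> Bs l \<Longrightarrow> y \<in> Bs l \<Longrightarrow> x * z * y \<in> EI l"
proof (erule span_mult2)
  fix s assume xy: "x \<in> Bs l" "y \<in> Bs l" and "s \<in> e_ideal l"
  then obtain x' i y' where s: "s = x' * e i * y'" "1 \<le> i" "i < l" "x' \<in> Bs l" "y' \<in> Bs l"
    by (auto simp: e_ideal_def)
  have "x * s * y = (x * x') * e i * (y' * y)" by (simp add: s(1) mult.assoc)
  then show "x * s * y \<in> EI l"
    using s xy unfolding e_ideal_def by (intro md.span_base) (auto intro: Bs_mult)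
qed

lemma EI_L: "z \<in> EI l \<Longrightarrow> x \<in> Bs l \<Longrightarrow> x * z \<in> EI l"
  using EI_mult[of z l x 1] Bs_1 by simp

lemma EI_e: "1 \<le> i \<Longrightarrow> i < l \<Longrightarrow> y \<in> Bs l \<Longrightarrow> e i * y \<in> EI l"
  unfolding e_ideal_def using Bs_1 by (intro md.span_base) force

lemma tg_Bs: "1 \<le> l \<Longrightarrow> tg q qi l g \<in> Bs l"
  by (auto simp: tg_def ak_letter_def Bs_0 split: tgen.splits
      intro!: Bs_Y Bs_Yi Bs_smult Bs_X Bs_Xi)

lemma prod_list_Bs: "(\<And>x. x \<in> set ys \<Longrightarrow> x \<in> Bs l) \<Longrightarrow> prod_list ys \<in> Bs l"
  by (induction ys) (auto intro: Bs_1 Bs_mult)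

lemma th_pe_Bs: "1 \<le> l \<Longrightarrow> th.pe q qi l w \<in> Bs l"
  by (rule prod_list_Bs) (auto intro: tg_Bs)

lemma Ev_Bs:
  assumes "1 \<le> l" "fa_elem (bmw_letter l) f"
  shows "Ev f \<in> Bs l"
  unfolding Ev_def
proof (rule md.subspace_sum[OF subspace_Bs])
  fix w assume "w \<in> fa_supp f"
  then show "sc (f w) * pe w \<in> Bs l"
    unfolding pe_ev using assms by (intro Bs_smult Bs_ev) (auto simp: fa_elem_def let_ok_def)
qed

lemma fin_pi_gen: "fin (pi_gen q qi g)"
  by (auto simp: pi_gen_def split: bgen.splits)

lemma fin_pi_word: "fin (pi_word q qi w)"
  unfolding pi_word_def by (induction w) (auto simp: fin_pi_gen)

lemma fin_pi_elem: "fin (pi_elem q qi f)"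
  unfolding pi_elem_def by (intro fin_sum fin_smult fin_pi_word)

lemma fa_elem_pi_gen: "bmw_letter l g \<Longrightarrow> 1 \<le> l \<Longrightarrow> fa_elem (ak_letter l) (pi_gen q qi g)"
  by (auto simp: pi_gen_def bmw_letter_def ak_letter_def split: bgen.splits
      intro!: fa_elem_mono fa_elem_smult)

lemma fa_elem_pi_word:
  "(\<And>g. g \<in> set w \<Longrightarrow> bmw_letter l g) \<Longrightarrow> 1 \<le> l \<Longrightarrow> fa_elem (ak_letter l) (pi_word q qi w)"
  unfolding pi_word_def
  by (induction w) (auto intro!: fa_elem_mult fa_elem_pi_gen fa_elem_mono)

lemma th_pi_gen:
  assumes "q * qi = 1" "1 \<le> l" "bmw_letter l g"
  shows "th.Ev q qi l (pi_gen q qi g) = (case g of E i \<Rightarrow> 0 | _ \<Rightarrow> gn g)"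
proof -
  have "qi * q = 1" using assms by (simp add: mult.commute)
  then show ?thesis
    using assms
    by (cases g) (auto simp: pi_gen_def th.Ev_smult tg_def ak_letter_def bmw_letter_def)
qed

text \<open>Applying \<open>pi\<close> and evaluating back fixes \<open>Y\<close>,
  \<open>X i\<close> and their inverses and kills \<open>e i\<close>, hence changes a word only by
  an element of the ideal.\<close>

lemma th_pi_word:
  assumes q: "q * qi = 1" and l: "1 \<le> l"
    and w: "\<And>g. g \<in> set w \<Longrightarrow> bmw_letter l g"
  shows "ev w - th.Ev q qi l (pi_word q qi w) \<in> EI l"
  using w
proof (induction w)
  case Nil
  then show ?case by (simp add: pi_word_def md.span_zero)
next
  case (Cons g w)
  let ?T = "th.Ev q qi l"
  have g: "bmw_letter l g" and IH: "ev w - ?T (pi_word q qi w) \<in> EI l" using Cons by auto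
  have gB: "gn g \<in> Bs l" using g l by (intro Bs_gn) (simp add: let_ok_def)
  have eq: "?T (pi_word q qi (g # w)) = ?T (pi_gen q qi g) * ?T (pi_word q qi w)"
    using th.Ev_mult[OF fin_pi_gen fin_pi_word] by (simp add: pi_word_def)
  show ?case
  proof (cases "\<exists>i. g = E i")
    case True
    then obtain i where i: "g = E i" by blast
    have "ev w \<in> Bs l" using Cons.prems l by (intro Bs_ev) (auto simp: let_ok_def)
    then have "e i * ev w \<in> EI l" using g i by (intro EI_e) (auto simp: bmw_letter_def)
    then show ?thesis
      using th_pi_gen[OF q l g] by (simp add: eq[unfolded i] i)
  next
    case False
    then have "?T (pi_gen q qi g) = gn g"
      using th_pi_gen[OF q l g] by (auto split: bgen.splits)
    then have "ev (g # w) - ?T (pi_word q qi (g # w)) = gn g * (ev w - ?T (pi_word q qi w))"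
      by (simp add: eq right_diff_distrib)
    then show ?thesis using EI_L[OF IH gB] by simp
  qed
qed

lemma th_pi_elem:
  assumes q: "q * qi = 1" and l: "1 \<le> l" and f: "fa_elem (bmw_letter l) f"
  shows "Ev f - th.Ev q qi l (pi_elem q qi f) \<in> EI l"
proof -
  let ?T = "th.Ev q qi l"
  have "?T (pi_elem q qi f) = (\<Sum>w\<in>fa_supp f. sc (f w) * ?T (pi_word q qi w))"
    unfolding pi_elem_def by (simp add: th.Ev_sum th.Ev_smult fin_pi_word)
  then have "Ev f - ?T (pi_elem q qi f) = (\<Sum>w\<in>fa_supp f. sc (f w) * (ev w - ?T (pi_word q qi w)))"
    by (simp add: Ev_def pe_ev right_diff_distrib sum_subtractf)
  also have "\<dots> \<in> EI l"
    using f by (intro md.span_sum md.span_scale th_pi_word q l) (auto simp: fa_elem_def)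
  finally show ?thesis .
qed

lemma ak_rels_fin: "(a, b) \<in> ak_rels q qs k l \<Longrightarrow> fin a \<and> fin b"
  unfolding ak_rels_def Let_def by (elim UnE) (auto split: if_splits)

text \<open>This is \<open>X_sq\<close> scaled by \<open>q^2\<close>. The identity
  \<open>q^2 * (q - qi) = (q^2 - 1) * q\<close> matches the linear terms, and only the multiple of
  \<open>e i\<close> is left over.\<close>

lemma ak_quadratic:
  assumes q: "q * qi = 1" "dl = q - qi" and i: "1 \<le> i" "i < n"
  shows "sc q * X i * (sc q * X i) - (sc (q^2 - 1) * (sc q * X i) + sc (q^2) * 1)
    = - (sc (q^2 * dl * lam) * (e i * 1))"
proof -
  have d: "q^2 * dl = (q^2 - 1) * q"
    unfolding q(2) using q(1) by (simp add: power2_eq_square algebra_simps)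
  have "sc q * X i * (sc q * X i) = sc (q^2) * (X i * (X i * 1))"
    by (simp add: mult.assoc gn_sc power2_eq_square)
  also have "\<dots> = sc (q^2) * 1 + sc (q^2 * dl) * X i - sc (q^2 * dl * lam) * e i"
    unfolding X_sq[OF i, of 1] by (simp add: ring_distribs mult.assoc)
  finally show ?thesis
    by (simp add: d)
qed

lemma tg_simps:
  "0 < l \<Longrightarrow> tg q qi l T0p = Y" "0 < l \<Longrightarrow> tg q qi l T0m = Yi"
  "1 \<le> i \<Longrightarrow> i < l \<Longrightarrow> tg q qi l (Tp i) = sc q * X i"
  "1 \<le> i \<Longrightarrow> i < l \<Longrightarrow> tg q qi l (Tm i) = sc qi * Xi i"
  by (auto simp: tg_def ak_letter_def)

text \<open>All relations except the quadratic one hold exactly; the quadratic one fails by a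
  multiple of \<open>e i\<close>.\<close>

lemma th_ak_rels:
  assumes q: "q * qi = 1" "dl = q - qi" and l: "1 \<le> l" "l \<le> n"
    and r: "(a, b) \<in> ak_rels q qs k l"
  shows "th.Ev q qi l a - th.Ev q qi l b \<in> EI l"
proof -
  let ?T = "th.Ev q qi l" and ?M = "fa_mono :: tgen list \<Rightarrow> tgen list \<Rightarrow> 'a"
  have q': "sc q * sc qi = 1" "sc qi * sc q = 1"
    using q by (simp_all add: mult.commute flip: sc_mult)
  consider
      (1) "(a, b) \<in> {(?M [T0p, T0m], ?M []), (?M [T0m, T0p], ?M [])}"
    | (2) i where "1 \<le> i" "i < l" "a = ?M [Tp i, Tm i] \<or> a = ?M [Tm i, Tp i]" "b = ?M []"
    | (3) "1 < l" "a = ?M [T0p, Tp 1, T0p, Tp 1]" "b = ?M [Tp 1, T0p, Tp 1, T0p]"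
    | (4) i where "1 \<le> i" "Suc i < l" "a = ?M [Tp i, Tp (i+1), Tp i]" "b = ?M [Tp (i+1), Tp i, Tp (i+1)]"
    | (5) i j where "i < l" "j < l" "i + 2 \<le> j \<or> j + 2 \<le> i" "a = ?M [tT i, tT j]" "b = ?M [tT j, tT i]"
    | (6) "a = ?M (replicate k T0p)" "b = (\<Sum>i<k. fa_smult (qs i) (?M (replicate i T0p)))"
    | (7) i where "1 \<le> i" "i < l" "a = ?M [Tp i, Tp i]"
        "b = fa_smult (q^2 - 1) (?M [Tp i]) + fa_smult (q^2) (?M [])"
    using r unfolding ak_rels_def Let_def by (auto split: if_splits)
  then show ?thesis
  proof cases
    case 1
    then show ?thesis using l by (auto simp: tg_simps Y_Yi Yi_Y md.span_zero)
  next
    case 2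
    then show ?thesis
      using l q q' by (auto simp: tg_simps mult.assoc gn_sc X_Xi Xi_X md.span_zero)
  next
    case 3
    then show ?thesis
      using l XYXY by (auto simp: tg_simps mult.assoc gn_sc md.span_zero)
  next
    case 4
    then show ?thesis
      using l braid[of i] by (auto simp: tg_simps mult.assoc gn_sc md.span_zero)
  next
    case 5
    have YX': "Y * X j = X j * Y" if "2 \<le> j" "j < l" for j using YX[of j] that l by simp
    have "?T a = ?T b"
    proof (cases "i = 0 \<or> j = 0")
      case True
      then show ?thesis using 5 l YX' by (auto simp: tT_def tg_simps mult.assoc gn_sc)
    next
      case False
      then have "X i * X j = X j * X i" using 5 l by (intro X_far) auto
      then show ?thesis using 5 False by (simp add: tT_def tg_simps mult.assoc gn_sc mult.commute)
    qed
    then show ?thesis by (simp add: md.span_zero)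
  next
    case 6
    have p: "prod_list (replicate m Y) = Y ^ m" for m by (induction m) auto
    have "?T a = Y ^ k" using 6 l by (simp add: tg_simps p)
    moreover have "?T b = (\<Sum>i<k. sc (qs i) * Y ^ i)"
      using 6 l by (simp add: th.Ev_sum th.Ev_smult tg_simps p)
    ultimately show ?thesis by (simp add: Y_pow md.span_zero)
  next
    case 7
    have "?T a - ?T b = - (sc (q^2 * dl * lam) * (e i * 1))"
      using ak_quadratic[OF q, of i] 7 l
      by (simp add: th.Ev_add th.Ev_smult tg_simps mult.assoc)
    also have "\<dots> \<in> EI l"
      using 7 Bs_1 by (intro md.span_neg md.span_scale EI_e) auto
    finally show ?thesis .
  qed
qed

lemma th_ideal_gens:
  assumes q: "q * qi = 1" "dl = q - qi" and l: "1 \<le> l" "l \<le> n"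
    and h: "h \<in> ideal_gens (ak_rels q qs k l)"
  shows "fin h \<and> th.Ev q qi l h \<in> EI l"
proof -
  obtain u w a b where h: "h = fa_mult (fa_mult (fa_mono u) (a - b)) (fa_mono w)"
    and r: "(a, b) \<in> ak_rels q qs k l"
    using h by (auto simp: ideal_gens_def fun_diff_def)
  have ab: "fin a" "fin b" using ak_rels_fin[OF r] by auto
  have "th.Ev q qi l h = th.pe q qi l u * (th.Ev q qi l a - th.Ev q qi l b) * th.pe q qi l w"
    using ab by (simp add: h th.Ev_mult th.Ev_diff)
  then show ?thesis
    using ab EI_mult[OF th_ak_rels[OF q l r]] th_pe_Bs[OF l(1)] by (simp add: h)
qed

lemma Bs_words:
  assumes "x \<in> Bs l"
  shows "x \<in> md.span {ev w | w. \<forall>g\<in>set w. let_ok l g}" (is "_ \<in> md.span ?W")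
  using assms
proof (induction rule: Bs.induct)
  case (Bs_sc c)
  have "1 \<in> md.span ?W" by (rule md.span_base) (auto intro: exI[of _ "[]"])
  then show ?case using md.span_scale[of 1 ?W c] by simp
next
  case (Bs_gn g)
  then show ?case by (intro md.span_base) (auto intro!: exI[of _ "[g]"])
next
  case (Bs_add x y)
  then show ?case by (simp add: md.span_add)
next
  case (Bs_mult x y)
  show ?case
  proof (rule span_multR[OF Bs_mult.IH(1)], rule span_multL[OF Bs_mult.IH(2)])
    fix s t assume "s \<in> ?W" "t \<in> ?W"
    then obtain w w' where "s = ev w" "t = ev w'" "\<forall>g\<in>set w. let_ok l g" "\<forall>g\<in>set w'. let_ok l g"
      by blast
    then show "s * t \<in> md.span ?W"
      by (intro md.span_base) (auto intro!: exI[of _ "w @ w'"] simp: ev_append)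
  qed
qed

text \<open>The spanning hypothesis is applied to the image under \<open>pi\<close> of a word, and
  the result is evaluated back. Modulo the ideal this returns the word on one side, and on the other
  the lifts themselves, while the Ariki--Koike relations vanish.\<close>

lemma Bs_AK_span:
  assumes q: "q * qi = 1" "dl = q - qi" and l: "1 \<le> l" "l \<le> n"
    and Xs: "\<And>f. f \<in> Xs \<Longrightarrow> fa_elem (bmw_letter l) f"
    and AK: "\<And>h. fa_elem (ak_letter l) h \<Longrightarrow> h \<in> lspan (pi_elem q qi ` Xs \<union> ideal_gens (ak_rels q qs k l))"
    and z: "z \<in> Bs l"
  shows "z \<in> md.span (Ev ` Xs \<union> e_ideal l)" (is "_ \<in> ?V")
proof (rule span_subsetI[OF Bs_words[OF z]])
  fix s assume "s \<in> {ev w | w. \<forall>g\<in>set w. let_ok l g}"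
  then obtain w where w: "s = ev w" "\<And>g. g \<in> set w \<Longrightarrow> bmw_letter l g"
    by (auto simp: let_ok_def)
  let ?T = "th.Ev q qi l"
  have EI: "x \<in> ?V" if "x \<in> EI l" for x
    using that md.span_mono[of "e_ideal l" "Ev ` Xs \<union> e_ideal l"] by blast
  have "?T (pi_word q qi w) \<in> ?V"
  proof (rule th.Ev_lspan[OF _ _ _ _ _ AK[OF fa_elem_pi_word[OF w(2) l(1)]]])
    fix h assume "h \<in> pi_elem q qi ` Xs \<union> ideal_gens (ak_rels q qs k l)"
    then show "?T h \<in> ?V"
    proof
      assume "h \<in> pi_elem q qi ` Xs"
      then obtain f where f: "f \<in> Xs" "h = pi_elem q qi f" by blast
      have "Ev f - ?T h \<in> ?V"
        unfolding f(2) by (rule EI[OF th_pi_elem[OF q(1) l(1) Xs[OF f(1)]]])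
      moreover have "Ev f \<in> ?V" using f(1) by (intro md.span_base) auto
      ultimately show ?thesis using md.span_diff[of "Ev f" _ "Ev f - ?T h"] by simp
    next
      assume "h \<in> ideal_gens (ak_rels q qs k l)"
      then show ?thesis using th_ideal_gens[OF q l] EI by blast
    qed
    show "fin h"
      using \<open>h \<in> _\<close> th_ideal_gens[OF q l] by (auto simp: fin_pi_elem)
  qed (auto intro: md.span_zero md.span_add md.span_scale)
  moreover have "ev w - ?T (pi_word q qi w) \<in> ?V"
    by (intro EI th_pi_word q l w)
  ultimately have "ev w - ?T (pi_word q qi w) + ?T (pi_word q qi w) \<in> ?V"
    by (intro md.span_add)
  then show "s \<in> ?V" by (simp add: w)
qed

lemma Bs_0_scalar: "x \<in> Bs 0 \<Longrightarrow> \<exists>c. x = sc c"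
  by (induction rule: Bs.induct) (auto simp: let_ok_def sc_add[symmetric] sc_mult[symmetric])

lemma span_Ev:
  assumes S: "\<And>s. s \<in> S \<Longrightarrow> fin s" and x: "x \<in> md.span (Ev ` S)"
  shows "\<exists>g \<in> lspan S. Ev g = x"
  using x
proof (induction rule: md.span_induct_alt)
  case base
  then show ?case using lspan.zero[of S] by force
next
  case (step c y z)
  then obtain g s where g: "g \<in> lspan S" "Ev g = z" "s \<in> S" "y = Ev s" by blast
  have "fa_smult c s + g \<in> lspan S" using g(1) lspan_base[OF g(3)] by (intro lspan_add lspan_smult)
  moreover have "Ev (fa_smult c s + g) = sc c * y + z"
    using g S fin_lspan[OF g(1) S] by (simp add: Ev_add Ev_smult)
  ultimately show ?case by blast
qed

text \<open>Inside the ring, \<open>Ev f\<close> is a combination of values of the claimed spanning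
  elements. The same combination \<open>g\<close> in the free algebra has the value of
  \<open>f\<close>, and \<open>faithful\<close> places \<open>f - g\<close> in the span of
  \<open>I\<close>.\<close>

theorem bmw_spanned:
  assumes q: "q * qi = 1" "dl = q - qi" and n: "1 \<le> n"
    and faithful: "\<And>f. fin f \<Longrightarrow> Ev f = 0 \<Longrightarrow> f \<in> lspan I"
    and Xs: "\<And>l f. 1 \<le> l \<Longrightarrow> l \<le> n \<Longrightarrow> f \<in> Xs l \<Longrightarrow> fa_elem (bmw_letter l) f"
    and AK: "\<And>l h. 1 \<le> l \<Longrightarrow> l \<le> n \<Longrightarrow> fa_elem (ak_letter l) h \<Longrightarrow>
      h \<in> lspan (pi_elem q qi ` Xs l \<union> ideal_gens (ak_rels q qs k l))"
    and f: "fa_elem (bmw_letter n) f"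
  shows "f \<in> lspan (bmw_spanning n k Xs \<union> I)"
proof -
  let ?chi = "\<lambda>l. chiset l (Xs l) (\<lambda>x. x)"
  let ?S = "{fa_mult (fa_mult (fa_mono u) chi) (fa_mono (rev w')) | m u u' chi w w'.
     ordw k n m n u u' \<and> ordw k n m n w w' \<and> chi \<in> ?chi (n - 2 * m)}"
  define C where "C l = Ev ` ?chi l" for l
  have chi_fin: "fin chi" if "chi \<in> ?chi l" "l \<le> n" for chi l
    using that Xs[of l chi] by (cases "l = 0") (auto simp: chiset_def fa_elem_def)
  have C: "z \<in> md.span (C l \<union> e_ideal l)" if l: "l \<le> n" and zB: "z \<in> Bs l" for l z
  proof (cases "l = 0")
    case True
    then obtain c where z: "z = sc c" using zB Bs_0_scalar by blast
    have "1 \<in> md.span (C l \<union> e_ideal l)"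
      using True by (intro md.span_base) (simp add: C_def chiset_def)
    from md.span_scale[OF this, of c] show ?thesis by (simp add: z)
  next
    case False
    then show ?thesis
      using Bs_AK_span[OF q, of l "Xs l" z] l zB Xs AK by (simp add: C_def chiset_def)
  qed
  have "Ev f \<in> md.span (spanners n C)"
    using Bs_span_spanners[of n C] C Ev_Bs[OF n f] by blast
  moreover have "spanners n C \<subseteq> Ev ` ?S"
  proof
    fix s assume "s \<in> spanners n C"
    then obtain m u u' chi w w' where s: "s = ev u * Ev chi * ev (rev w')"
      "ordw k n m n u u'" "ordw k n m n w w'" "chi \<in> ?chi (n - 2 * m)"
      unfolding spanners_def C_def by blast
    have "fin chi" using chi_fin s(4) by simp
    then have "s = Ev (fa_mult (fa_mult (fa_mono u) chi) (fa_mono (rev w')))"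
      by (simp add: s(1) Ev_mult pe_ev)
    then show "s \<in> Ev ` ?S" using s(2-4) by blast
  qed
  ultimately have "Ev f \<in> md.span (Ev ` ?S)"
    using md.span_mono by blast
  moreover have S: "fin s" if "s \<in> ?S" for s
    using that chi_fin by auto
  ultimately obtain g where g: "g \<in> lspan ?S" "Ev g = Ev f"
    using span_Ev[of ?S "Ev f"] by blast
  have "fin g" by (rule fin_lspan[OF g(1) S])
  then have "f - g \<in> lspan I"
    using faithful[of "f - g"] fa_elem_fin[OF f] g(2) by (simp add: Ev_diff)
  moreover have "?S \<subseteq> bmw_spanning n k Xs"
    using ordw_bmw_spanning by blast
  then have "g \<in> lspan (bmw_spanning n k Xs \<union> I)"
    by (intro lspan_mono[OF g(1)]) blast
  ultimately have "g + (f - g) \<in> lspan (bmw_spanning n k Xs \<union> I)"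
    by (intro lspan_add) (auto elim: lspan_mono)
  then show ?thesis by simp
qed

end

subsection \<open>The free algebra as a ring type\<close>

text \<open>With concatenation as addition of words, \<open>poly_mapping\<close> provides the free algebra.\<close>

instantiation list :: (type) monoid_add
begin
definition plus_list_def: "u + w = u @ w"
definition zero_list_def: "0 = []"
instance by intro_classes (simp_all add: plus_list_def zero_list_def)
end

type_synonym 'a bmw_free = "bgen list \<Rightarrow>\<^sub>0 'a"

abbreviation wrd :: "bgen list \<Rightarrow> 'a::comm_ring_1 bmw_free" where
  "wrd u \<equiv> Poly_Mapping.single u 1"

lemma single_mult_list: "Poly_Mapping.single u c * Poly_Mapping.single w d = Poly_Mapping.single (u @ w) (c * d)"
  for c d :: "'a::comm_ring_1"
  by (simp add: mult_single plus_list_def)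

lemma single_Nil_1: "wrd [] = 1"
  unfolding zero_list_def[symmetric] by (rule single_one)

lemma poly_mapping_single_induct [case_names single sum]:
  fixes x :: "'k \<Rightarrow>\<^sub>0 'c::comm_monoid_add"
  assumes single: "\<And>u c. P (Poly_Mapping.single u c)" and sum: "\<And>f g. P f \<Longrightarrow> P g \<Longrightarrow> P (f + g)"
  shows "P x"
proof -
  have "P (\<Sum>w\<in>A. Poly_Mapping.single w (Poly_Mapping.lookup x w))" if "finite A" for A
    using that single[of _ 0] by (induction A rule: finite_induct) (auto intro: single sum)
  moreover have "(\<Sum>w\<in>Poly_Mapping.keys x. Poly_Mapping.single w (Poly_Mapping.lookup x w)) = x"
    by (rule poly_mapping_eqI) (auto simp: lookup_sum lookup_single when_def in_keys_iff)
  ultimately show ?thesis using finite_keys[of x] by metis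
qed

lemma single_Nil_central: "Poly_Mapping.single [] c * x = x * Poly_Mapping.single [] c"
  for x :: "'a::comm_ring_1 bmw_free"
proof (induction x rule: poly_mapping_single_induct)
  case (single k v)
  then show ?case by (simp add: single_mult_list mult.commute)
next
  case (sum f g)
  then show ?case by (simp add: algebra_simps)
qed

interpretation fq: fa_eval "Poly_Mapping.single [] :: 'a::comm_ring_1 \<Rightarrow> 'a bmw_free" "\<lambda>g. wrd [g]"
proof
  show "Poly_Mapping.single [] c * x = x * Poly_Mapping.single [] c" for c and x :: "'a bmw_free"
    by (rule single_Nil_central)
qed (simp_all add: single_add single_mult_list single_Nil_1)

lemma fq_pe: "fq.pe w = (wrd w :: 'a::comm_ring_1 bmw_free)"
  by (induction w) (simp_all add: single_Nil_1 single_mult_list)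

lemma fin_lookup: "fin (Poly_Mapping.lookup x)" for x :: "'a::comm_ring_1 bmw_free"
  by (simp add: fa_supp_def)

lemma fq_Ev: "fq.Ev f = (\<Sum>w\<in>fa_supp f. Poly_Mapping.single w (f w))"
  by (simp add: fq.Ev_def fq_pe single_mult_list)

lemma lookup_Ev: "fin f \<Longrightarrow> Poly_Mapping.lookup (fq.Ev f) = f"
  by (auto simp: fun_eq_iff fq_Ev lookup_sum lookup_single when_def sum.delta' fa_supp_def)

lemma Ev_lookup: "fq.Ev (Poly_Mapping.lookup x) = x"
  by (rule poly_mapping_eqI) (simp add: lookup_Ev[OF fin_lookup])

lemma lookup_mult_fa: "Poly_Mapping.lookup (x * y) = fa_mult (Poly_Mapping.lookup x) (Poly_Mapping.lookup y)"
  for x y :: "'a::comm_ring_1 bmw_free"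
  using fq.Ev_mult[OF fin_lookup fin_lookup, of x y] lookup_Ev[OF fin_mult[OF fin_lookup fin_lookup], of x y]
  by (simp add: Ev_lookup)

lemma lookup_smult: "Poly_Mapping.lookup (Poly_Mapping.single [] c * y) = fa_smult c (Poly_Mapping.lookup y)"
  for y :: "'a::comm_ring_1 bmw_free"
  using fq.Ev_smult[OF fin_lookup, of c y] lookup_Ev[OF fin_smult[OF fin_lookup], of c y]
  by (simp add: Ev_lookup)

definition star_free :: "'a::comm_ring_1 bmw_free \<Rightarrow> 'a bmw_free" where
  "star_free x = Poly_Mapping.map_key rev x"

lemma lookup_star: "Poly_Mapping.lookup (star_free x) w = Poly_Mapping.lookup x (rev w)"
  by (simp add: star_free_def map_key.rep_eq)

lemma star_free_add: "star_free (x + y) = star_free x + star_free y"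
  and star_free_diff: "star_free (x - y) = star_free x - star_free y"
  and star_free_star: "star_free (star_free x) = x"
  by (rule poly_mapping_eqI, simp add: lookup_star lookup_add lookup_minus)+

lemma star_free_single: "star_free (Poly_Mapping.single u c) = Poly_Mapping.single (rev u) c"
  by (rule poly_mapping_eqI) (auto simp: lookup_star lookup_single when_def)

lemma star_free_mult: "star_free (x * y) = star_free y * star_free x"
proof (induction x arbitrary: y rule: poly_mapping_single_induct)
  case (single u c)
  show ?case
  proof (induction y rule: poly_mapping_single_induct)
    case (single w d)
    then show ?case by (simp add: star_free_single single_mult_list mult.commute)
  next
    case (sum f g)
    then show ?case by (simp add: star_free_add algebra_simps)
  qed
next
  case (sum f g)
  then show ?case by (simp add: star_free_add algebra_simps)
qed

subsection \<open>The defining ideal\<close>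

definition rel_gens :: "((bgen list \<Rightarrow> 'a::comm_ring_1) \<times> (bgen list \<Rightarrow> 'a)) set \<Rightarrow> 'a bmw_free set" where
  "rel_gens rels = {wrd u * (fq.Ev a - fq.Ev b) * wrd w | u w a b. (a, b) \<in> rels}"

abbreviation rel_ideal :: "((bgen list \<Rightarrow> 'a::comm_ring_1) \<times> (bgen list \<Rightarrow> 'a)) set \<Rightarrow> 'a bmw_free set" where
  "rel_ideal rels \<equiv> fq.md.span (rel_gens rels)"

definition star_ideal :: "'a::comm_ring_1 bmw_free set \<Rightarrow> bool" where
  "star_ideal J \<longleftrightarrow> 0 \<in> J \<and> (\<forall>x\<in>J. \<forall>y\<in>J. x + y \<in> J) \<and> (\<forall>x\<in>J. - x \<in> J) \<and>
     (\<forall>x\<in>J. \<forall>r. r * x \<in> J \<and> x * r \<in> J) \<and> (\<forall>x\<in>J. star_free x \<in> J)"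

lemma rel_gens_mult_word:
  fixes s :: "'a::comm_ring_1 bmw_free"
  shows "s \<in> rel_gens rels \<Longrightarrow> wrd t * s \<in> rel_gens rels"
    and "s \<in> rel_gens rels \<Longrightarrow> s * wrd t \<in> rel_gens rels"
proof -
  assume "s \<in> rel_gens rels"
  then obtain u w a b where s: "s = wrd u * (fq.Ev a - fq.Ev b) * wrd w" "(a, b) \<in> rels"
    by (auto simp: rel_gens_def)
  have "wrd t * s = wrd (t @ u) * (fq.Ev a - fq.Ev b) * wrd w"
    using single_mult_list[of t "1::'a" u 1] by (simp add: s(1) flip: mult.assoc)
  then show "wrd t * s \<in> rel_gens rels"
    using s(2) unfolding rel_gens_def by blast
  have "s * wrd t = wrd u * (fq.Ev a - fq.Ev b) * wrd (w @ t)"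
    using single_mult_list[of w "1::'a" t 1] by (simp add: s(1) mult.assoc)
  then show "s * wrd t \<in> rel_gens rels"
    using s(2) unfolding rel_gens_def by blast
qed

lemma rel_ideal_mult:
  assumes x: "x \<in> rel_ideal rels"
  shows "r * x \<in> rel_ideal rels \<and> x * r \<in> rel_ideal rels"
proof (induction r rule: poly_mapping_single_induct)
  case (single t c)
  have "wrd t * x \<in> rel_ideal rels" "x * wrd t \<in> rel_ideal rels"
    by (rule fq.span_multL[OF x] fq.span_multR[OF x]; intro fq.md.span_base rel_gens_mult_word; assumption)+
  then have "Poly_Mapping.single [] c * (wrd t * x) \<in> rel_ideal rels"
    "Poly_Mapping.single [] c * (x * wrd t) \<in> rel_ideal rels"
    by (auto intro: fq.md.span_scale)
  moreover have "Poly_Mapping.single [] c * (wrd t * x) = Poly_Mapping.single t c * x"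
    using single_mult_list[of "[]" c t 1] by (simp flip: mult.assoc)
  moreover have "Poly_Mapping.single [] c * (x * wrd t) = x * Poly_Mapping.single t c"
    using single_mult_list[of "[]" c t 1] fq.mult_sc[of x c "wrd t"] by simp
  ultimately show ?case by simp
next
  case (sum f g)
  then show ?case by (simp add: ring_distribs fq.md.span_add)
qed

text \<open>Reversal may exchange the two sides of a relation, since this only changes the sign of
  their difference.\<close>

lemma star_ideal_rel_ideal:
  assumes star: "\<And>a b. (a, b) \<in> rels \<Longrightarrow> fin a \<and> fin b \<and> ((a \<circ> rev, b \<circ> rev) \<in> rels \<or> (b \<circ> rev, a \<circ> rev) \<in> rels)"
  shows "star_ideal (rel_ideal rels)"
proof -
  have Ev_rev: "star_free (fq.Ev a) = fq.Ev (a \<circ> rev)" if "fin a" for a :: "bgen list \<Rightarrow> 'a"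
  proof -
    have "fa_supp (a \<circ> rev) = rev ` fa_supp a"
      by (auto simp: fa_supp_def intro: rev_image_eqI[of "rev _"])
    then have "fin (a \<circ> rev)" using that by simp
    then show ?thesis
      using that by (intro poly_mapping_eqI) (simp add: lookup_star lookup_Ev)
  qed
  have "star_free x \<in> rel_ideal rels" if "x \<in> rel_ideal rels" for x
    using that
  proof (induction rule: fq.md.span_induct_alt)
    case base
    then show ?case by (simp add: star_free_def fq.md.span_zero)
  next
    case (step c y z)
    then obtain u w a b where y: "y = wrd u * (fq.Ev a - fq.Ev b) * wrd w" and r: "(a, b) \<in> rels"
      by (auto simp: rel_gens_def)
    have sy: "star_free y = wrd (rev w) * (fq.Ev (a \<circ> rev) - fq.Ev (b \<circ> rev)) * wrd (rev u)"
      using star[OF r] by (simp add: y star_free_mult star_free_diff star_free_single Ev_rev mult.assoc)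
    have "star_free y \<in> rel_ideal rels"
    proof (cases "(a \<circ> rev, b \<circ> rev) \<in> rels")
      case True
      then show ?thesis unfolding sy by (intro fq.md.span_base) (auto simp: rel_gens_def)
    next
      case False
      then have "wrd (rev w) * (fq.Ev (b \<circ> rev) - fq.Ev (a \<circ> rev)) * wrd (rev u) \<in> rel_ideal rels"
        using star[OF r] by (intro fq.md.span_base) (auto simp: rel_gens_def)
      from fq.md.span_neg[OF this] show ?thesis unfolding sy by (simp add: algebra_simps)
    qed
    then show ?case
      using step by (simp add: star_free_add star_free_mult star_free_single fq.md.span_add fq.md.span_scale
          flip: single_Nil_central)
  qed
  then show ?thesis
    unfolding star_ideal_def using rel_ideal_mult
    by (auto intro: fq.md.span_add fq.md.span_zero fq.md.span_neg)
qed

lemma rel_ideal_lspan: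
  assumes fin: "\<And>a b. (a, b) \<in> rels \<Longrightarrow> fin a \<and> fin b" and x: "x \<in> rel_ideal rels"
  shows "Poly_Mapping.lookup x \<in> lspan (ideal_gens rels)"
  using x
proof (induction rule: fq.md.span_induct_alt)
  case base
  then show ?case using lspan.zero by (simp add: zero_poly_mapping.rep_eq)
next
  case (step c y z)
  then obtain u w a b where y: "y = wrd u * (fq.Ev a - fq.Ev b) * wrd w" and r: "(a, b) \<in> rels"
    by (auto simp: rel_gens_def)
  have m: "Poly_Mapping.lookup (Poly_Mapping.single u (1::'a)) = fa_mono u" for u :: "bgen list"
    by (auto simp: fun_eq_iff lookup_single fa_mono_def when_def)
  have d: "Poly_Mapping.lookup (fq.Ev a - fq.Ev b) = (\<lambda>w. a w - b w)"
    using fin[OF r] by (simp add: fun_eq_iff lookup_minus lookup_Ev)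
  have "Poly_Mapping.lookup y = fa_mult (fa_mult (fa_mono u) (\<lambda>w. a w - b w)) (fa_mono w)"
    by (simp add: y lookup_mult_fa m d)
  then have "Poly_Mapping.lookup y \<in> ideal_gens rels"
    using r unfolding ideal_gens_def by force
  then have "(\<lambda>v. c * Poly_Mapping.lookup y v + Poly_Mapping.lookup z v) \<in> lspan (ideal_gens rels)"
    using step by (intro lspan.step)
  then show ?case by (simp add: plus_poly_mapping.rep_eq lookup_smult fa_smult_def)
qed

section \<open>The BMW relations and their closure under reversal of words\<close>

lemma fa_mono_inject: "(fa_mono u :: _ \<Rightarrow> 'a::comm_ring_1) = fa_mono w \<longleftrightarrow> u = w"
  by (auto simp: fa_mono_def fun_eq_iff split: if_splits)

lemma bmw_rels_intros:
  fixes q qi lam lami :: "'a::comm_ring_1" and qs As :: "nat \<Rightarrow> 'a"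
  defines "R \<equiv> bmw_rels q qi lam lami qs As"
  shows "(fa_mono [Yp, Ym], fa_mono []) \<in> R k n"
    and "(fa_mono [Ym, Yp], fa_mono []) \<in> R k n"
    and "\<And>i. 1 \<le> i \<Longrightarrow> i < n \<Longrightarrow> (fa_mono [Xp i, Xm i], fa_mono []) \<in> R k n"
    and "\<And>i. 1 \<le> i \<Longrightarrow> i < n \<Longrightarrow> (fa_mono [Xm i, Xp i], fa_mono []) \<in> R k n"
    and "\<And>i. 1 \<le> i \<Longrightarrow> i < n \<Longrightarrow>
      (fa_mono [Xp i] - fa_mono [Xm i], fa_smult (q - qi) (fa_mono [] - fa_mono [E i])) \<in> R k n"
    and "\<And>i j. 1 \<le> i \<Longrightarrow> i < n \<Longrightarrow> 1 \<le> j \<Longrightarrow> j < n \<Longrightarrow> i + 2 \<le> j \<or> j + 2 \<le> i \<Longrightarrow>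
      (fa_mono [Xp i, Xp j], fa_mono [Xp j, Xp i]) \<in> R k n"
    and "\<And>i j. 1 \<le> i \<Longrightarrow> i < n \<Longrightarrow> 1 \<le> j \<Longrightarrow> j < n \<Longrightarrow> i + 2 \<le> j \<or> j + 2 \<le> i \<Longrightarrow>
      (fa_mono [Xp i, E j], fa_mono [E j, Xp i]) \<in> R k n"
    and "\<And>i j. 1 \<le> i \<Longrightarrow> i < n \<Longrightarrow> 1 \<le> j \<Longrightarrow> j < n \<Longrightarrow> i + 2 \<le> j \<or> j + 2 \<le> i \<Longrightarrow>
      (fa_mono [E i, E j], fa_mono [E j, E i]) \<in> R k n"
    and "\<And>i. 1 \<le> i \<Longrightarrow> Suc i < n \<Longrightarrow>
      (fa_mono [Xp i, Xp (Suc i), Xp i], fa_mono [Xp (Suc i), Xp i, Xp (Suc i)]) \<in> R k n"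
    and "\<And>i. 1 \<le> i \<Longrightarrow> i < n \<Longrightarrow> (fa_mono [Xp i, E i], fa_smult lam (fa_mono [E i])) \<in> R k n"
    and "\<And>i. 1 \<le> i \<Longrightarrow> i < n \<Longrightarrow> (fa_mono [E i, Xp i], fa_smult lam (fa_mono [E i])) \<in> R k n"
    and "\<And>i j. 1 \<le> i \<Longrightarrow> i < n \<Longrightarrow> 1 \<le> j \<Longrightarrow> j < n \<Longrightarrow> j = Suc i \<or> i = Suc j \<Longrightarrow>
      (fa_mono [Xp i, Xp j, E i], fa_mono [E j, E i]) \<in> R k n"
    and "\<And>i j. 1 \<le> i \<Longrightarrow> i < n \<Longrightarrow> 1 \<le> j \<Longrightarrow> j < n \<Longrightarrow> j = Suc i \<or> i = Suc j \<Longrightarrow>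
      (fa_mono [E j, E i], fa_mono [E j, Xp i, Xp j]) \<in> R k n"
    and "\<And>i j. 1 \<le> i \<Longrightarrow> i < n \<Longrightarrow> 1 \<le> j \<Longrightarrow> j < n \<Longrightarrow> j = Suc i \<or> i = Suc j \<Longrightarrow>
      (fa_mono [E i, E j, E i], fa_mono [E i]) \<in> R k n"
    and "\<And>i. 1 \<le> i \<Longrightarrow> i < n \<Longrightarrow> (fa_mono [E i, E i], fa_smult (As 0) (fa_mono [E i])) \<in> R k n"
    and "(fa_mono (replicate k Yp), (\<Sum>i<k. fa_smult (qs i) (fa_mono (replicate i Yp)))) \<in> R k n"
    and "1 < n \<Longrightarrow> (fa_mono [Xp 1, Yp, Xp 1, Yp], fa_mono [Yp, Xp 1, Yp, Xp 1]) \<in> R k n"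
    and "\<And>i. 1 < i \<Longrightarrow> i < n \<Longrightarrow> (fa_mono [Yp, Xp i], fa_mono [Xp i, Yp]) \<in> R k n"
    and "\<And>i. 1 < i \<Longrightarrow> i < n \<Longrightarrow> (fa_mono [Yp, E i], fa_mono [E i, Yp]) \<in> R k n"
    and "1 < n \<Longrightarrow> (fa_mono [Yp, Xp 1, Yp, E 1], fa_smult lami (fa_mono [E 1])) \<in> R k n"
    and "1 < n \<Longrightarrow> (fa_mono [E 1, Yp, Xp 1, Yp], fa_smult lami (fa_mono [E 1])) \<in> R k n"
    and "\<And>m. 1 < n \<Longrightarrow> m < k \<Longrightarrow>
      (fa_mono ([E 1] @ replicate m Yp @ [E 1]), fa_smult (As m) (fa_mono [E 1])) \<in> R k n"
  unfolding R_def bmw_rels_def Let_def by (simp_all add: fa_mono_inject) force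

lemma fa_mono_rev: "fa_mono u \<circ> rev = fa_mono (rev u)"
  by (auto simp: fa_mono_def fun_eq_iff)

lemma fa_smult_rev: "fa_smult c f \<circ> rev = fa_smult c (f \<circ> rev)"
  by (simp add: fa_smult_def fun_eq_iff)

lemma diff_rev: "(f - g) \<circ> rev = (f \<circ> rev) - (g \<circ> rev)"
  by (simp add: fun_eq_iff)

lemma sum_rev: "(\<Sum>i\<in>A. F i) \<circ> rev = (\<Sum>i\<in>A. F i \<circ> rev)"
  by (induction A rule: infinite_finite_induct) (auto simp: fun_eq_iff)

lemmas rev_simps = fa_mono_rev fa_smult_rev diff_rev sum_rev

text \<open>Palindromic relations are fixed, commutation and four-term braid relations have their
  sides exchanged, and the remaining ones occur in mirror pairs, such as the two forms of
  \<open>XXE\<close> and of \<open>YXYE\<close>.\<close>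

lemma bmw_rels_rev:
  assumes "(a, b) \<in> bmw_rels q qi lam lami qs As k n"
  shows "fin a \<and> fin b \<and> ((a \<circ> rev, b \<circ> rev) \<in> bmw_rels q qi lam lami qs As k n \<or>
    (b \<circ> rev, a \<circ> rev) \<in> bmw_rels q qi lam lami qs As k n)" (is "_ \<and> _ \<and> ?P")
proof -
  note i = bmw_rels_intros[where q = q and qi = qi and lam = lam and lami = lami and qs = qs and As = As
    and k = k and n = n]
  have "fin a \<and> fin b"
    using assms unfolding bmw_rels_def Let_def by (elim UnE) (auto split: if_splits)
  moreover have ?P
    using assms unfolding bmw_rels_def Let_def
    by (elim UnE; fold bmw_rels_def[unfolded Let_def])
      (auto simp: rev_simps i i[unfolded One_nat_def] split: if_splits)
  ultimately show ?thesis by blast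
qed

lemma bmw_rels_fin: "(a, b) \<in> bmw_rels q qi lam lami qs As k n \<Longrightarrow> fin a \<and> fin b"
  using bmw_rels_rev by blast

subsection \<open>The quotient algebra as a ring type\<close>

text \<open>A type cannot depend on the parameters of the theorem. The quotient is therefore formed by
  the ideal of one tuple of parameters violating the claim, selected by Hilbert choice: the quotient
  ring then shows that this tuple satisfies the claim after all.\<close>

definition bmw_params :: "'a::comm_ring_1 \<Rightarrow> 'a \<Rightarrow> 'a \<Rightarrow> 'a \<Rightarrow> (nat \<Rightarrow> 'a) \<Rightarrow> nat \<Rightarrow> nat \<Rightarrow> bool" where
  "bmw_params q qi lam lami qs n k \<longleftrightarrow>
     1 \<le> n \<and> 1 \<le> k \<and> q * qi = 1 \<and> lam * lami = 1 \<and> (\<exists>q0i. qs 0 * q0i = 1)"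

text \<open>The lifts enter as sets of elements, not as a family over \<open>'i\<close>: the ideal
  chosen below may depend on the type \<open>'a\<close> only.\<close>

definition bmw_claim ::
  "'a::comm_ring_1 \<Rightarrow> 'a \<Rightarrow> 'a \<Rightarrow> 'a \<Rightarrow> (nat \<Rightarrow> 'a) \<Rightarrow> (nat \<Rightarrow> 'a) \<Rightarrow> nat \<Rightarrow> nat \<Rightarrow> bool" where
  "bmw_claim q qi lam lami qs As n k \<longleftrightarrow>
     (\<forall>Xs f. (\<forall>l. 1 \<le> l \<and> l \<le> n \<longrightarrow> (\<forall>g\<in>Xs l. fa_elem (bmw_letter l) g) \<and>
         (\<forall>h. fa_elem (ak_letter l) h \<longrightarrow> h \<in> lspan (pi_elem q qi ` Xs l \<union> ideal_gens (ak_rels q qs k l)))) \<longrightarrow>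
       fa_elem (bmw_letter n) f \<longrightarrow>
       f \<in> lspan (bmw_spanning n k Xs \<union> ideal_gens (bmw_rels q qi lam lami qs As k n)))"

text \<open>The condition \<open>1 \<notin> J\<close> is there because the quotient must have
  \<open>0 \<noteq> 1\<close> to be an instance of \<open>ring_1\<close>. For an ideal containing
  \<open>1\<close> the claim is proved directly in \<open>bmw_claim\<close>.\<close>

definition counter_ideal :: "'a::comm_ring_1 bmw_free set \<Rightarrow> bool" where
  "counter_ideal J \<longleftrightarrow> 1 \<notin> J \<and> (\<exists>q qi lam lami qs As n k. bmw_params q qi lam lami qs n k \<and>
     J = rel_ideal (bmw_rels q qi lam lami qs As k n) \<and> \<not> bmw_claim q qi lam lami qs As n k)"

text \<open>The default \<open>{0}\<close> keeps the type a nontrivial ring with anti-involution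
  when there is no counterexample.\<close>

definition the_ideal :: "'a::comm_ring_1 bmw_free set" where
  "the_ideal = (if \<exists>J :: 'a bmw_free set. counter_ideal J then SOME J. counter_ideal J else {0})"

lemma counter_the_ideal:
  "counter_ideal (J :: 'a::comm_ring_1 bmw_free set) \<Longrightarrow> counter_ideal (the_ideal :: 'a bmw_free set)"
  unfolding the_ideal_def by (auto intro: someI)

lemma the_ideal: "star_ideal (the_ideal :: 'a::comm_ring_1 bmw_free set)"
  and one_notin_the_ideal: "1 \<notin> (the_ideal :: 'a bmw_free set)"
proof -
  have z: "star_free 0 = (0 :: 'a bmw_free)" by (simp add: star_free_def)
  have "star_ideal (the_ideal :: 'a bmw_free set) \<and> 1 \<notin> (the_ideal :: 'a bmw_free set)"
  proof (cases "\<exists>J :: 'a bmw_free set. counter_ideal J")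
    case True
    then have "counter_ideal (the_ideal :: 'a bmw_free set)" using counter_the_ideal by blast
    then obtain q qi lam lami :: 'a and qs As k n
      where "1 \<notin> (the_ideal :: 'a bmw_free set)"
        and J: "the_ideal = rel_ideal (bmw_rels q qi lam lami qs As k n)"
      unfolding counter_ideal_def by blast
    moreover have "star_ideal (rel_ideal (bmw_rels q qi lam lami qs As k n))"
      by (rule star_ideal_rel_ideal[OF bmw_rels_rev])
    ultimately show ?thesis by simp
  next
    case False
    then show ?thesis by (simp add: the_ideal_def star_ideal_def z)
  qed
  then show "star_ideal (the_ideal :: 'a bmw_free set)" "1 \<notin> (the_ideal :: 'a bmw_free set)" by auto
qed

lemma the_ideal_0: "0 \<in> the_ideal"
  and the_ideal_add: "x \<in> the_ideal \<Longrightarrow> y \<in> the_ideal \<Longrightarrow> x + y \<in> the_ideal"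
  and the_ideal_uminus: "x \<in> the_ideal \<Longrightarrow> - x \<in> the_ideal"
  and the_ideal_mult: "x \<in> the_ideal \<Longrightarrow> r * x \<in> the_ideal" "x \<in> the_ideal \<Longrightarrow> x * r \<in> the_ideal"
  and the_ideal_star: "x \<in> the_ideal \<Longrightarrow> star_free x \<in> the_ideal"
  using the_ideal unfolding star_ideal_def by blast+

lemma the_ideal_diff: "x \<in> the_ideal \<Longrightarrow> y \<in> the_ideal \<Longrightarrow> x - y \<in> the_ideal"
  using the_ideal_add[of x "- y"] the_ideal_uminus[of y] by simp

quotient_type (overloaded) 'a bmw_quot = "'a::comm_ring_1 bmw_free" / "\<lambda>x y. x - y \<in> the_ideal"
proof (rule equivpI)
  show "reflp (\<lambda>x y :: 'a bmw_free. x - y \<in> the_ideal)"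
    by (rule reflpI) (simp add: the_ideal_0)
  show "symp (\<lambda>x y :: 'a bmw_free. x - y \<in> the_ideal)"
    by (rule sympI) (metis minus_diff_eq the_ideal_uminus)
  show "transp (\<lambda>x y :: 'a bmw_free. x - y \<in> the_ideal)"
  proof (rule transpI)
    fix x y z :: "'a bmw_free" assume "x - y \<in> the_ideal" "y - z \<in> the_ideal"
    then have "(x - y) + (y - z) \<in> the_ideal" by (rule the_ideal_add)
    then show "x - z \<in> the_ideal" by simp
  qed
qed

instantiation bmw_quot :: (comm_ring_1) ring_1
begin

lift_definition zero_bmw_quot :: "'a bmw_quot" is 0 .
lift_definition one_bmw_quot :: "'a bmw_quot" is 1 .
lift_definition plus_bmw_quot :: "'a bmw_quot \<Rightarrow> 'a bmw_quot \<Rightarrow> 'a bmw_quot" is "(+)"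
proof -
  fix x x' y y' :: "'a bmw_free" assume "x - x' \<in> the_ideal" "y - y' \<in> the_ideal"
  from the_ideal_add[OF this] show "x + y - (x' + y') \<in> the_ideal" by (simp add: algebra_simps)
qed
lift_definition minus_bmw_quot :: "'a bmw_quot \<Rightarrow> 'a bmw_quot \<Rightarrow> 'a bmw_quot" is "(-)"
proof -
  fix x x' y y' :: "'a bmw_free" assume "x - x' \<in> the_ideal" "y - y' \<in> the_ideal"
  from the_ideal_diff[OF this] show "x - y - (x' - y') \<in> the_ideal" by (simp add: algebra_simps)
qed
lift_definition uminus_bmw_quot :: "'a bmw_quot \<Rightarrow> 'a bmw_quot" is uminus
proof -
  fix x x' :: "'a bmw_free" assume "x - x' \<in> the_ideal"
  from the_ideal_uminus[OF this] show "- x - (- x') \<in> the_ideal" by (simp add: algebra_simps)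
qed
lift_definition times_bmw_quot :: "'a bmw_quot \<Rightarrow> 'a bmw_quot \<Rightarrow> 'a bmw_quot" is "(*)"
proof -
  fix x x' y y' :: "'a bmw_free" assume "x - x' \<in> the_ideal" "y - y' \<in> the_ideal"
  then have "(x - x') * y + x' * (y - y') \<in> the_ideal"
    by (intro the_ideal_add the_ideal_mult)
  then show "x * y - x' * y' \<in> the_ideal" by (simp add: algebra_simps)
qed

instance
proof
  show "0 \<noteq> (1 :: 'a bmw_quot)"
    by transfer (use one_notin_the_ideal the_ideal_uminus in force)
qed (transfer; simp add: algebra_simps the_ideal_0)+

end

lift_definition sc_quot :: "'a::comm_ring_1 \<Rightarrow> 'a bmw_quot" is "Poly_Mapping.single []" .
lift_definition gn_quot :: "bgen \<Rightarrow> 'a::comm_ring_1 bmw_quot" is "\<lambda>g. wrd [g]" .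
lift_definition star_quot :: "'a::comm_ring_1 bmw_quot \<Rightarrow> 'a bmw_quot" is star_free
  by (simp add: the_ideal_star flip: star_free_diff)

interpretation fQ: fa_eval "sc_quot :: 'a::comm_ring_1 \<Rightarrow> 'a bmw_quot" gn_quot
proof
  fix a b :: 'a and x :: "'a bmw_quot"
  show "sc_quot (a + b) = sc_quot a + sc_quot b"
    by transfer (simp add: single_add the_ideal_0)
  show "sc_quot (a * b) = sc_quot a * sc_quot b"
    by transfer (simp add: single_mult_list the_ideal_0)
  show "sc_quot (1 :: 'a) = 1"
    by transfer (simp add: single_Nil_1 the_ideal_0)
  show "sc_quot a * x = x * sc_quot a"
    by transfer (simp add: single_Nil_central the_ideal_0)
qed

lemma fQ_pe: "fQ.pe w = abs_bmw_quot (wrd w :: 'a::comm_ring_1 bmw_free)"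
  by (induction w)
    (simp_all add: one_bmw_quot_def single_Nil_1 gn_quot.abs_eq times_bmw_quot.abs_eq single_mult_list)

lemma fQ_Ev: "fQ.Ev f = abs_bmw_quot (fq.Ev f)"
proof -
  have abs_sum: "(\<Sum>w\<in>A. abs_bmw_quot (F w)) = abs_bmw_quot (sum F A)" for F :: "_ \<Rightarrow> 'a bmw_free" and A
    by (induction A rule: infinite_finite_induct) (simp_all add: zero_bmw_quot_def plus_bmw_quot.abs_eq)
  show ?thesis
    unfolding fQ.Ev_def fq.Ev_def fQ_pe fq_pe
    by (simp add: sc_quot.abs_eq times_bmw_quot.abs_eq abs_sum)
qed

text \<open>If the ideal of the tuple is the one by which the type was formed,
  \<open>bmw_quot\<close> is the BMW algebra of this tuple: the relations hold in it, and an element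
  of value zero lies in the defining ideal.\<close>

lemma bmw_claim_the_ideal:
  fixes q qi lam lami :: "'a::comm_ring_1"
  assumes params: "bmw_params q qi lam lami qs n k"
    and J: "rel_ideal (bmw_rels q qi lam lami qs As k n) = the_ideal"
  shows "bmw_claim q qi lam lami qs As n k"
proof -
  let ?R = "bmw_rels q qi lam lami qs As k n"
  note i = bmw_rels_intros[where q = q and qi = qi and lam = lam and lami = lami and qs = qs and As = As
    and k = k and n = n]
  obtain q0i where p: "1 \<le> n" "1 \<le> k" "q * qi = 1" "lam * lami = 1" "qs 0 * q0i = 1"
    using params by (auto simp: bmw_params_def)
  have rel: "fQ.Ev a = fQ.Ev b" if "(a, b) \<in> ?R" for a b
  proof -
    have "wrd [] * (fq.Ev a - fq.Ev b) * wrd [] \<in> rel_ideal ?R"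
      using that unfolding rel_gens_def by (intro fq.md.span_base) blast
    then show ?thesis
      unfolding fQ_Ev by (simp add: bmw_quot.abs_eq_iff J single_Nil_1)
  qed
  have pow: "prod_list (replicate m (gn_quot Yp)) = (gn_quot Yp ^ m :: 'a bmw_quot)" for m
    by (induction m) auto
  interpret B: cyc_bmw sc_quot gn_quot star_quot "q - qi" lam lami q0i qs As n k
  proof
    show "star_quot (x + y) = star_quot x + star_quot y" for x y :: "'a bmw_quot"
      by transfer (simp add: star_free_add the_ideal_0)
    show "star_quot (x * y) = star_quot y * star_quot x" for x y :: "'a bmw_quot"
      by transfer (simp add: star_free_mult the_ideal_0)
    show "star_quot (sc_quot a) = sc_quot a" for a :: 'a
      by transfer (simp add: star_free_single the_ideal_0)
    show "star_quot (gn_quot g) = (gn_quot g :: 'a bmw_quot)" for g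
      by transfer (simp add: star_free_single the_ideal_0)
    show "star_quot (star_quot x) = x" for x :: "'a bmw_quot"
      by transfer (simp add: star_free_star the_ideal_0)
  next
    show "gn_quot Yp * gn_quot Ym = (1 :: 'a bmw_quot)" using rel[OF i(1)] by simp
    show "gn_quot Ym * gn_quot Yp = (1 :: 'a bmw_quot)" using rel[OF i(2)] by simp
    show "gn_quot (Xp i) * gn_quot (Xm i) = (1 :: 'a bmw_quot)" if "1 \<le> i" "i < n" for i
      using rel[OF i(3)[OF that]] by simp
    show "gn_quot (Xm i) * gn_quot (Xp i) = (1 :: 'a bmw_quot)" if "1 \<le> i" "i < n" for i
      using rel[OF i(4)[OF that]] by simp
    show "gn_quot (Xp i) - gn_quot (Xm i) = sc_quot (q - qi) * (1 - gn_quot (E i))" if "1 \<le> i" "i < n" for i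
      using rel[OF i(5)[OF that]] by (simp add: fQ.Ev_diff fQ.Ev_smult)
    show "gn_quot (Xp i) * gn_quot (Xp j) = (gn_quot (Xp j) * gn_quot (Xp i) :: 'a bmw_quot)"
      if "1 \<le> i" "i + 2 \<le> j" "j < n" for i j
      using rel[OF i(6)[of i j]] that by simp
    show "gn_quot (Xp i) * gn_quot (E j) = (gn_quot (E j) * gn_quot (Xp i) :: 'a bmw_quot)"
      if "1 \<le> i" "i < n" "1 \<le> j" "j < n" "i + 2 \<le> j \<or> j + 2 \<le> i" for i j
      using rel[OF i(7)[OF that]] by simp
    show "gn_quot (E i) * gn_quot (E j) = (gn_quot (E j) * gn_quot (E i) :: 'a bmw_quot)"
      if "1 \<le> i" "i + 2 \<le> j" "j < n" for i j
      using rel[OF i(8)[of i j]] that by simp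
    show "gn_quot (Xp i) * (gn_quot (Xp (Suc i)) * gn_quot (Xp i))
        = (gn_quot (Xp (Suc i)) * (gn_quot (Xp i) * gn_quot (Xp (Suc i))) :: 'a bmw_quot)"
      if "1 \<le> i" "Suc i < n" for i
      using rel[OF i(9)[OF that]] by simp
    show "gn_quot (Xp i) * gn_quot (E i) = sc_quot lam * gn_quot (E i)" if "1 \<le> i" "i < n" for i
      using rel[OF i(10)[OF that]] by (simp add: fQ.Ev_smult)
    show "gn_quot (Xp i) * (gn_quot (Xp j) * gn_quot (E i)) = (gn_quot (E j) * gn_quot (E i) :: 'a bmw_quot)"
      if "1 \<le> i" "i < n" "1 \<le> j" "j < n" "j = Suc i \<or> i = Suc j" for i j
      using rel[OF i(12)[OF that]] by simp
    show "gn_quot (E i) * (gn_quot (E j) * gn_quot (E i)) = (gn_quot (E i) :: 'a bmw_quot)"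
      if "1 \<le> i" "i < n" "1 \<le> j" "j < n" "j = Suc i \<or> i = Suc j" for i j
      using rel[OF i(14)[OF that]] by simp
    show "gn_quot (E i) * gn_quot (E i) = sc_quot (As 0) * gn_quot (E i)" if "1 \<le> i" "i < n" for i
      using rel[OF i(15)[OF that]] by (simp add: fQ.Ev_smult)
    show "gn_quot Yp ^ k = (\<Sum>i<k. sc_quot (qs i) * gn_quot Yp ^ i)"
      using rel[OF i(16)] by (simp add: fQ.Ev_sum fQ.Ev_smult pow)
    show "gn_quot (Xp 1) * (gn_quot Yp * (gn_quot (Xp 1) * gn_quot Yp))
        = (gn_quot Yp * (gn_quot (Xp 1) * (gn_quot Yp * gn_quot (Xp 1))) :: 'a bmw_quot)" if "1 < n"
      using rel[OF i(17)[OF that]] by simp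
    show "gn_quot Yp * gn_quot (Xp i) = (gn_quot (Xp i) * gn_quot Yp :: 'a bmw_quot)" if "1 < i" "i < n" for i
      using rel[OF i(18)[OF that]] by simp
    show "gn_quot Yp * gn_quot (E i) = (gn_quot (E i) * gn_quot Yp :: 'a bmw_quot)" if "1 < i" "i < n" for i
      using rel[OF i(19)[OF that]] by simp
    show "gn_quot Yp * (gn_quot (Xp 1) * (gn_quot Yp * gn_quot (E 1))) = sc_quot lami * gn_quot (E 1)" if "1 < n"
      using rel[OF i(20)[OF that]] by (simp add: fQ.Ev_smult)
    show "gn_quot (E 1) * (gn_quot Yp ^ m * gn_quot (E 1)) = sc_quot (As m) * gn_quot (E 1)"
      if "1 < n" "m < k" for m
      using rel[OF i(22)[OF that]] by (simp add: fQ.Ev_smult pow)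
  qed (use p in auto)
  have faithful: "f \<in> lspan (ideal_gens ?R)" if f: "fin f" "fQ.Ev f = 0" for f
  proof -
    have "fq.Ev f \<in> rel_ideal ?R"
      using f(2) unfolding fQ_Ev zero_bmw_quot_def by (simp add: bmw_quot.abs_eq_iff J)
    from rel_ideal_lspan[OF bmw_rels_fin this] show ?thesis
      by (simp add: lookup_Ev[OF f(1)])
  qed
  show ?thesis
    unfolding bmw_claim_def
    using B.bmw_spanned[OF p(3) refl p(1), of "ideal_gens ?R"] faithful by blast
qed

text \<open>If \<open>1\<close> lies in the ideal, every element does and the claim is trivial.
  Otherwise a failure makes \<open>the_ideal\<close> the ideal of some failing tuple, possibly
  another one than the given, and \<open>bmw_claim_the_ideal\<close> refutes that tuple.\<close>

lemma bmw_claim: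
  fixes q qi lam lami :: "'a::comm_ring_1"
  assumes "bmw_params q qi lam lami qs n k"
  shows "bmw_claim q qi lam lami qs As n k"
proof (rule ccontr)
  let ?R = "bmw_rels q qi lam lami qs As k n"
  assume neg: "\<not> bmw_claim q qi lam lami qs As n k"
  have "1 \<notin> rel_ideal ?R"
  proof
    assume "1 \<in> rel_ideal ?R"
    then have "fq.Ev f \<in> rel_ideal ?R" for f
      using rel_ideal_mult[of 1 ?R "fq.Ev f"] by simp
    then have "Poly_Mapping.lookup (fq.Ev f) \<in> lspan (ideal_gens ?R)" for f
      by (intro rel_ideal_lspan bmw_rels_fin)
    then have "f \<in> lspan (ideal_gens ?R)" if "fin f" for f
      using lookup_Ev[OF that] by metis
    then have "f \<in> lspan (S \<union> ideal_gens ?R)" if "fa_elem ok f" for f ok S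
      using lspan_mono[of f "ideal_gens ?R" "S \<union> ideal_gens ?R"] fa_elem_fin[OF that] by blast
    then have "bmw_claim q qi lam lami qs As n k"
      unfolding bmw_claim_def by blast
    with neg show False ..
  qed
  then have "counter_ideal (rel_ideal ?R)"
    unfolding counter_ideal_def using assms neg by blast
  then have "counter_ideal (the_ideal :: 'a bmw_free set)"
    by (rule counter_the_ideal)
  then obtain q qi lam lami :: 'a and qs As n k where "bmw_params q qi lam lami qs n k"
    "the_ideal = rel_ideal (bmw_rels q qi lam lami qs As k n)" "\<not> bmw_claim q qi lam lami qs As n k"
    unfolding counter_ideal_def by blast
  then show False
    using bmw_claim_the_ideal[of q qi lam lami qs n k As] by simp
qed

theorem mainTheorem5:
  fixes q qi lam lami q0i :: "'a::comm_ring_1"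
    and qs As :: "nat \<Rightarrow> 'a"
    and n k :: nat
    and Ix :: "nat \<Rightarrow> 'i set"
    and xb :: "nat \<Rightarrow> 'i \<Rightarrow> bgen list \<Rightarrow> 'a"
  assumes "1 \<le> n" and "1 \<le> k"
    and "q * qi = 1" and "lam * lami = 1" and "qs 0 * q0i = 1"
    and "lam - lami = (q - qi) * (1 - As 0)"
    and "\<forall>l. 1 \<le> l \<and> l \<le> n \<longrightarrow> AK_basis q qi qs k l (Ix l) (xb l)"
  shows "\<forall>f. fa_elem (bmw_letter n) f \<longrightarrow>
           f \<in> lspan (bmw_span_set n k Ix xb \<union> ideal_gens (bmw_rels q qi lam lami qs As k n))"
proof (intro allI impI)
  fix f :: "bgen list \<Rightarrow> 'a"
  assume f: "fa_elem (bmw_letter n) f"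
  have AK: "AK_basis q qi qs k l (Ix l) (xb l)" if "1 \<le> l" "l \<le> n" for l
    using assms(7) that by blast
  have "bmw_params q qi lam lami qs n k"
    unfolding bmw_params_def using assms(1-5) by blast
  from bmw_claim[OF this, unfolded bmw_claim_def, rule_format, of "\<lambda>l. xb l ` Ix l", OF _ f]
  show "f \<in> lspan (bmw_span_set n k Ix xb \<union> ideal_gens (bmw_rels q qi lam lami qs As k n))"
    unfolding bmw_span_set_eq[of n k Ix xb] using AK unfolding AK_basis_def by blast
qed

end
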